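(* Let $\mathscr{P}$ be a $C^*$-planar algebra and let $x\in\mathscr{P}_{2,\pm}$ be $\mathfrak{F}$-positive. Suppose that there exists a right PF eigenvector $y_1\in\mathscr{P}_{1,\mp}$ of $x$ such that $p_{\max}\wedge\overline{\mathcal{R}(y_1)}^{\perp}=0$. Then $$\mathcal{E}^+=(\mathcal{A}_p\zeta)^+=(\zeta\mathcal{B}_p)^+,$$ where $\mathcal{E}^+$, $p=p_{\max}$, $\zeta$, $\mathcal{A}_p$ and $\mathcal{B}_p$ are associated with $x$ as defined in the context, and $S^+$ denotes the set of positive elements of $\mathscr{P}_{1,\pm}$ lying in a subset $S$.
   Context: $C^*$-planar algebra: a (shaded) planar algebra in the sense of Jones is a family $\mathscr{P}=\{\mathscr{P}_{n,\pm}\}_{n\ge 0}$ of complex vector spaces on which shaded planar tangles act multilinearly, compatibly with isotopy and composition of tangles. Elements of $\mathscr{P}_{n,\pm}$ are boxes with $n$ strings attached on top and $n$ on the bottom; the region at the left (marked) side is unshaded for $+$ and shaded for $-$. It is a $C^*$-planar algebra if each $\mathscr{P}_{n,\pm}$ is a finite-dimensional unital $C^*$-algebra (unit $I$ or $1$) for the vertical stacking product ($xy$ is drawn with $y$ above $x$), the involution $*$ is compatible with reflection of tangles in a horizontal line, and there are positive faithful traces $tr_{n,\pm}$ with $tr_{n,\pm}(x)=tr_{0,\pm}$(closure of $x$), the closure joining each top string to the corresponding bottom string. Fourier transform: $\mathfrak{F}:\mathscr{P}_{2,\pm}\to\mathscr{P}_{2,\mp}$, $\widehat{x}=\mathfrak{F}(x)$,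 is the $90^\circ$ rotation: the top-left, top-right, bottom-left, bottom-right boundary points of $\widehat{x}$ are connected respectively to the bottom-left, top-left, bottom-right, top-right points of $x$. $x\in\mathscr{P}_{2,\pm}$ is $\mathfrak{F}$-positive if $\widehat{x}$ is positive in $\mathscr{P}_{2,\mp}$. Convolution: for $u,v\in\mathscr{P}_{2,\mp}$, $u*v$ is obtained by placing $u$ to the left of $v$ and joining the top-right (bottom-right) point of $u$ to the top-left (bottom-left) point of $v$. For $y\in\mathscr{P}_{1,\pm}$, $u\in\mathscr{P}_{2,\mp}$, $y*u\in\mathscr{P}_{1,\pm}$ is obtained by placing $y$ to the left of $u$ and joining the top (bottom) end of $y$ to the top-left (bottom-left) point of $u$; for $z\in\mathscr{P}_{1,\mp}$, $u*z\in\mathscr{P}_{1,\mp}$ is obtained by placing $z$ to the right of $u$ and joining its ends to the right points of $u$. $u^{( *j)}$ is the $j$-fold convolution power, and $y*u^{( *0)}=y$. $\overline{y}$ is the $180^\circ$ rotation of $y$ ($\mathscr{P}_{1,\pm}\to\mathscr{P}_{1,\mp}$); $a\otimes b$ is horizontal juxtaposition; $\mathcal{R}(a)$ is the range projection of $a$; $q^\perp=I-q$ for a projection $q$. PF data of $x$: $r$ is the spectral radius of $x$; $\mathcal{E}=\{y\in\mathscr{P}_{1,\pm}:y*\widehat{x}=ry\}$; $\mathcal{E}^+$ is its set of positive elements; $p=p_{\max}$ is the largest element of $\mathscr{Q}=\{\mathcal{R}(y):y\in\mathcal{E}^+\}$. A right PF eigenvector of $x$ is a nonzero positive $y_1\in\mathscr{P}_{1,\mp}$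 with $\widehat{x}*y_1=ry_1$. The maximal-support PF eigenvector is $\zeta=\lim_{\mathbb{R}\ni z\to r^+}(z-r)\sum_{j=0}^\infty \frac{p*\widehat{x}^{( *j)}}{z^{j+1}}$ (the limit exists, $\zeta\in\mathcal{E}^+$, $\mathcal{R}(\zeta)=p$). Put $x_p=(p\otimes\overline{p})\,x\,(p\otimes\overline{p})\in\mathscr{P}_{2,\pm}$. The algebras are $\mathcal{A}_p=\{y\in\mathscr{P}_{1,\pm}:x_p(1\otimes\overline{y})=(1\otimes\overline{y})x_p\}$ (equivalently $(\overline{y}\otimes1)\widehat{x_p}=(1\otimes y)\widehat{x_p}$) and $\mathcal{B}_p=\{y\in\mathscr{P}_{1,\pm}:x_p(y\otimes1)=(y\otimes1)x_p\}$ (equivalently $\widehat{x_p}(1\otimes y)=\widehat{x_p}(\overline{y}\otimes1)$). *)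

theory Defs
  imports "HOL-Analysis.Analysis"
begin

section \<open>Shaded planar tangles\<close>

text \<open>
  A tangle is drawn with a rectangular outer disc and rectangular input discs whose marked side is
  on the left and which have as many boundary points on the top as on the bottom. In generic
  position (strings in Morse position with respect to the height, all critical points and input
  discs at different heights, input discs upright) it is read off from the bottom to the top as a
  list of slices. The slice \<open>(a, e)\<close> consists of the piece \<open>e\<close> with exactly \<open>a\<close> vertical strings on its
  left; the remaining strings run vertically on its right. The piece \<open>Box i k\<close> is the input disc with
  label \<open>i\<close> and \<open>k\<close> strings on the top and on the bottom, \<open>Cup\<close> is a local minimum and \<open>Cap\<close> is a local
  maximum of a string. Every planar tangle, including those with closed strings, with input discs
  without boundary points and with several connected components, is isotopic to one of this form.
\<close>

datatype shade = Unshaded | Shaded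

primrec opp :: "shade \<Rightarrow> shade" where
  "opp Unshaded = Shaded"
| "opp Shaded = Unshaded"

datatype piece = Cup | Cap | Box nat nat

type_synonym diagram = "(nat \<times> piece) list"

primrec legs_below :: "piece \<Rightarrow> nat" where
  "legs_below Cup = 0"
| "legs_below Cap = 2"
| "legs_below (Box i k) = k"

primrec legs_above :: "piece \<Rightarrow> nat" where
  "legs_above Cup = 2"
| "legs_above Cap = 0"
| "legs_above (Box i k) = k"

text \<open>\<open>wf_diagram m D n\<close>: \<open>D\<close> has \<open>m\<close> boundary points on the bottom and \<open>n\<close> on the top.\<close>

fun wf_diagram :: "nat \<Rightarrow> diagram \<Rightarrow> nat \<Rightarrow> bool" where
  "wf_diagram m [] n \<longleftrightarrow> m = n"
| "wf_diagram m ((a, e) # D) n \<longleftrightarrow>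
     a + legs_below e \<le> m \<and> wf_diagram (m - legs_below e + legs_above e) D n"

fun labels :: "diagram \<Rightarrow> nat list" where
  "labels [] = []"
| "labels ((a, Box i k) # D) = i # labels D"
| "labels ((a, Cup) # D) = labels D"
| "labels ((a, Cap) # D) = labels D"

text \<open>
  \<open>Tangle n s D\<close> has \<open>n\<close> boundary points on the top and on the bottom of its outer disc, and \<open>s\<close> is the
  shading of the region at the left side of the outer disc. The shading alternates across strings,
  so that the region at the left of a piece at position \<open>a\<close> has the shading \<open>(opp ^^ a) s\<close>.
\<close>

datatype tangle = Tangle (size_of: nat) (shade_of: shade) (diagram_of: diagram)

definition is_tangle :: "tangle \<Rightarrow> bool" where
  "is_tangle T \<longleftrightarrow>
     wf_diagram (size_of T) (diagram_of T) (size_of T) \<and> distinct (labels (diagram_of T))"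

definition has_input :: "tangle \<Rightarrow> nat \<Rightarrow> nat \<Rightarrow> shade \<Rightarrow> bool" where
  "has_input T i k t \<longleftrightarrow>
     (\<exists>a. (a, Box i k) \<in> set (diagram_of T) \<and> t = (opp ^^ a) (shade_of T))"


subsection \<open>Planar isotopy\<close>

text \<open>
  \<open>nested_cups a k\<close> creates \<open>2k\<close> strings at the positions \<open>a, \<dots>, a+2k-1\<close>, the \<open>j\<close>-th from the left
  being connected to the \<open>j\<close>-th from the right; \<open>nested_caps a k\<close> is its mirror image.
\<close>

definition nested_cups :: "nat \<Rightarrow> nat \<Rightarrow> diagram" where
  "nested_cups a k = map (\<lambda>j. (a + j, Cup)) [0..<k]"

definition nested_caps :: "nat \<Rightarrow> nat \<Rightarrow> diagram" where
  "nested_caps a k = map (\<lambda>j. (a + j, Cap)) (rev [0..<k])"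

text \<open>
  Two diagrams in generic position are isotopic relative to the boundary of the outer disc iff they
  are connected by finitely many of the following moves. \<open>exchange\<close>: a piece and another one which
  lies entirely to the right of it exchange their heights. \<open>zigzag\<close>: a local minimum and a local
  maximum on the same string cancel. \<open>turn\<close>: an input disc rotates by a full turn, which is stated
  by saying that its half turns in the two directions are isotopic.
\<close>

inductive move :: "diagram \<Rightarrow> diagram \<Rightarrow> bool" where
  exchange: "a + legs_above e \<le> b \<Longrightarrow>
     move [(a, e), (b, f)] [(b - legs_above e + legs_below e, f), (a, e)]"
| zigzag_right: "move [(a, Cup), (a + 1, Cap)] []"
| zigzag_left: "move [(a + 1, Cup), (a, Cap)] []"
| turn: "move
     (nested_cups (a + k) k @ [(a + k, Box i k)] @ nested_caps a k)
     (nested_cups a k @ [(a + k, Box i k)] @ nested_caps (a + k) k)"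

inductive isotopic :: "nat \<Rightarrow> nat \<Rightarrow> diagram \<Rightarrow> diagram \<Rightarrow> bool" for m n :: nat where
  isotopic_move: "move L R \<Longrightarrow> wf_diagram m (U @ L @ W) n \<Longrightarrow> wf_diagram m (U @ R @ W) n \<Longrightarrow>
     isotopic m n (U @ L @ W) (U @ R @ W)"
| isotopic_refl: "wf_diagram m D n \<Longrightarrow> isotopic m n D D"
| isotopic_sym: "isotopic m n D D' \<Longrightarrow> isotopic m n D' D"
| isotopic_trans: "isotopic m n D D' \<Longrightarrow> isotopic m n D' D'' \<Longrightarrow> isotopic m n D D''"

definition isotopic_tangles :: "tangle \<Rightarrow> tangle \<Rightarrow> bool" where
  "isotopic_tangles T T' \<longleftrightarrow> is_tangle T \<and> is_tangle T' \<and>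
     size_of T = size_of T' \<and> shade_of T = shade_of T' \<and>
     isotopic (size_of T) (size_of T) (diagram_of T) (diagram_of T')"


subsection \<open>Composition and reflection\<close>

text \<open>\<open>insert_diagram E i D\<close> glues \<open>E\<close> into the input disc \<open>i\<close> of \<open>D\<close>.\<close>

fun insert_diagram :: "diagram \<Rightarrow> nat \<Rightarrow> diagram \<Rightarrow> diagram" where
  "insert_diagram E i [] = []"
| "insert_diagram E i ((a, Box j k) # D) =
     (if j = i then map (\<lambda>(b, e). (a + b, e)) E else [(a, Box j k)]) @ insert_diagram E i D"
| "insert_diagram E i ((a, Cup) # D) = (a, Cup) # insert_diagram E i D"
| "insert_diagram E i ((a, Cap) # D) = (a, Cap) # insert_diagram E i D"

definition compose_tangle :: "tangle \<Rightarrow> nat \<Rightarrow> tangle \<Rightarrow> tangle" where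
  "compose_tangle T i S =
     Tangle (size_of T) (shade_of T) (insert_diagram (diagram_of S) i (diagram_of T))"

primrec reflect_piece :: "piece \<Rightarrow> piece" where
  "reflect_piece Cup = Cap"
| "reflect_piece Cap = Cup"
| "reflect_piece (Box i k) = Box i k"

definition reflect_tangle :: "tangle \<Rightarrow> tangle" where
  "reflect_tangle T = Tangle (size_of T) (shade_of T)
     (rev (map (\<lambda>(a, e). (a, reflect_piece e)) (diagram_of T)))"


section \<open>Planar algebras\<close>

text \<open>
  The spaces \<open>box_space P n s\<close> are subspaces of one ambient complex vector space \<open>'a\<close>; any family of
  vector spaces is of this form inside its direct sum. The left region of an \<open>n\<close>-box has the shading
  \<open>s\<close>, so \<open>Unshaded\<close> stands for \<open>+\<close> and \<open>Shaded\<close> for \<open>-\<close>. The vector \<open>act P T f\<close> is the result of the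
  tangle \<open>T\<close> applied to the vectors \<open>f i\<close> in its input discs \<open>i\<close>.
\<close>

record 'a planar_algebra =
  box_space :: "nat \<Rightarrow> shade \<Rightarrow> 'a set"
  cscale :: "complex \<Rightarrow> 'a \<Rightarrow> 'a"
  act :: "tangle \<Rightarrow> (nat \<Rightarrow> 'a) \<Rightarrow> 'a"

definition inputs_ok :: "('a, 'm) planar_algebra_scheme \<Rightarrow> tangle \<Rightarrow> (nat \<Rightarrow> 'a) \<Rightarrow> bool" where
  "inputs_ok P T f \<longleftrightarrow> (\<forall>i k t. has_input T i k t \<longrightarrow> f i \<in> box_space P k t)"

definition shaded_planar_algebra :: "('a::ab_group_add, 'm) planar_algebra_scheme \<Rightarrow> bool" where
  "shaded_planar_algebra P \<longleftrightarrow>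
     vector_space (cscale P) \<and>
     (\<forall>n s. module.subspace (cscale P) (box_space P n s)) \<and>
     \<comment> \<open>a tangle acts on vectors in its input discs, multilinearly\<close>
     (\<forall>T f. is_tangle T \<longrightarrow> inputs_ok P T f \<longrightarrow>
        act P T f \<in> box_space P (size_of T) (shade_of T)) \<and>
     (\<forall>T f g. is_tangle T \<longrightarrow> inputs_ok P T f \<longrightarrow> (\<forall>i\<in>set (labels (diagram_of T)). f i = g i) \<longrightarrow>
        act P T f = act P T g) \<and>
     (\<forall>T f i k t u v. is_tangle T \<longrightarrow> inputs_ok P T f \<longrightarrow> has_input T i k t \<longrightarrow>
        u \<in> box_space P k t \<longrightarrow> v \<in> box_space P k t \<longrightarrow>
        act P T (f(i := u + v)) = act P T (f(i := u)) + act P T (f(i := v))) \<and>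
     (\<forall>T f i k t c u. is_tangle T \<longrightarrow> inputs_ok P T f \<longrightarrow> has_input T i k t \<longrightarrow>
        u \<in> box_space P k t \<longrightarrow>
        act P T (f(i := cscale P c u)) = cscale P c (act P T (f(i := u)))) \<and>
     \<comment> \<open>compatibility with isotopy\<close>
     (\<forall>T T' f. isotopic_tangles T T' \<longrightarrow> inputs_ok P T f \<longrightarrow> act P T f = act P T' f) \<and>
     \<comment> \<open>compatibility with composition, and the action of the identity tangles\<close>
     (\<forall>T S f i. is_tangle T \<longrightarrow> is_tangle S \<longrightarrow> has_input T i (size_of S) (shade_of S) \<longrightarrow>
        set (labels (diagram_of S)) \<inter> (set (labels (diagram_of T)) - {i}) = {} \<longrightarrow>
        inputs_ok P (compose_tangle T i S) f \<longrightarrow>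
        act P (compose_tangle T i S) f = act P T (f(i := act P S f))) \<and>
     (\<forall>n s f i. f i \<in> box_space P n s \<longrightarrow> act P (Tangle n s [(0, Box i n)]) f = f i)"


subsection \<open>Operations given by tangles\<close>

text \<open>The product \<open>xy\<close> is drawn with \<open>y\<close> above \<open>x\<close>.\<close>

definition pa_mult :: "('a, 'm) planar_algebra_scheme \<Rightarrow> nat \<Rightarrow> shade \<Rightarrow> 'a \<Rightarrow> 'a \<Rightarrow> 'a" where
  "pa_mult P n s x y = act P (Tangle n s [(0, Box 0 n), (0, Box 1 n)]) ((!) [x, y])"

definition pa_one :: "('a, 'm) planar_algebra_scheme \<Rightarrow> nat \<Rightarrow> shade \<Rightarrow> 'a" where
  "pa_one P n s = act P (Tangle n s []) ((!) [])"

definition pa_closure :: "('a, 'm) planar_algebra_scheme \<Rightarrow> nat \<Rightarrow> shade \<Rightarrow> 'a \<Rightarrow> 'a" where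
  "pa_closure P n s x =
     act P (Tangle 0 s (nested_cups 0 n @ [(0, Box 0 n)] @ nested_caps 0 n)) ((!) [x])"

text \<open>\<open>x \<in> box_space P 2 s\<close>; the result is in \<open>box_space P 2 (opp s)\<close>.\<close>

definition fourier :: "('a, 'm) planar_algebra_scheme \<Rightarrow> shade \<Rightarrow> 'a \<Rightarrow> 'a" where
  "fourier P s x = act P (Tangle 2 (opp s) [(0, Cup), (1, Box 0 2), (2, Cap)]) ((!) [x])"

text \<open>\<open>u, v \<in> box_space P 2 t\<close>, \<open>u\<close> on the left of \<open>v\<close>.\<close>

definition conv :: "('a, 'm) planar_algebra_scheme \<Rightarrow> shade \<Rightarrow> 'a \<Rightarrow> 'a \<Rightarrow> 'a" where
  "conv P t u v =
     act P (Tangle 2 t [(1, Cup), (0, Box 0 2), (2, Box 1 2), (1, Cap)]) ((!) [u, v])"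

text \<open>\<open>y \<in> box_space P 1 s\<close> and \<open>u \<in> box_space P 2 (opp s)\<close>; the result is in \<open>box_space P 1 s\<close>.\<close>

definition conv_left :: "('a, 'm) planar_algebra_scheme \<Rightarrow> shade \<Rightarrow> 'a \<Rightarrow> 'a \<Rightarrow> 'a" where
  "conv_left P s y u =
     act P (Tangle 1 s [(0, Cup), (0, Box 0 1), (1, Box 1 2), (0, Cap)]) ((!) [y, u])"

text \<open>\<open>u \<in> box_space P 2 t\<close> and \<open>z \<in> box_space P 1 t\<close>; the result is in \<open>box_space P 1 t\<close>.\<close>

definition conv_right :: "('a, 'm) planar_algebra_scheme \<Rightarrow> shade \<Rightarrow> 'a \<Rightarrow> 'a \<Rightarrow> 'a" where
  "conv_right P t u z =
     act P (Tangle 1 t [(1, Cup), (0, Box 0 2), (2, Box 1 1), (1, Cap)]) ((!) [u, z])"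

text \<open>The \<open>j\<close>-fold convolution power of \<open>u \<in> box_space P 2 t\<close> for \<open>j \<ge> 1\<close>.\<close>

definition conv_power :: "('a, 'm) planar_algebra_scheme \<Rightarrow> shade \<Rightarrow> 'a \<Rightarrow> nat \<Rightarrow> 'a" where
  "conv_power P t u j = ((\<lambda>v. conv P t v u) ^^ (j - 1)) u"

definition conv_left_power :: "('a, 'm) planar_algebra_scheme \<Rightarrow> shade \<Rightarrow> 'a \<Rightarrow> 'a \<Rightarrow> nat \<Rightarrow> 'a" where
  "conv_left_power P s y u j =
     (if j = 0 then y else conv_left P s y (conv_power P (opp s) u j))"

text \<open>The \<open>180\<close> degree rotation of \<open>y \<in> box_space P 1 s\<close>; the result is in \<open>box_space P 1 (opp s)\<close>.\<close>

definition bar :: "('a, 'm) planar_algebra_scheme \<Rightarrow> shade \<Rightarrow> 'a \<Rightarrow> 'a" where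
  "bar P s y = act P (Tangle 1 (opp s) [(1, Cup), (1, Box 0 1), (0, Cap)]) ((!) [y])"

text \<open>\<open>a \<in> box_space P 1 s\<close> and \<open>b \<in> box_space P 1 (opp s)\<close>; the result is in \<open>box_space P 2 s\<close>.\<close>

definition juxtapose :: "('a, 'm) planar_algebra_scheme \<Rightarrow> shade \<Rightarrow> 'a \<Rightarrow> 'a \<Rightarrow> 'a" where
  "juxtapose P s a b = act P (Tangle 2 s [(0, Box 0 1), (1, Box 1 1)]) ((!) [a, b])"


section \<open>\<open>C\<^sup>*\<close>-planar algebras\<close>

text \<open>Completeness of the norm is automatic in finite dimension.\<close>

definition findim_cstar_algebra ::
  "(complex \<Rightarrow> 'a \<Rightarrow> 'a) \<Rightarrow> 'a::real_normed_vector set \<Rightarrow> ('a \<Rightarrow> 'a \<Rightarrow> 'a) \<Rightarrow> 'a \<Rightarrow> ('a \<Rightarrow> 'a) \<Rightarrow> bool"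
where
  "findim_cstar_algebra scl A mul e adj \<longleftrightarrow>
     (\<exists>B. finite B \<and> A = module.span scl B) \<and>
     e \<in> A \<and>
     (\<forall>x\<in>A. mul e x = x \<and> mul x e = x) \<and>
     (\<forall>x\<in>A. \<forall>y\<in>A. mul x y \<in> A) \<and>
     (\<forall>x\<in>A. \<forall>y\<in>A. \<forall>z\<in>A. mul (mul x y) z = mul x (mul y z)) \<and>
     (\<forall>x\<in>A. \<forall>y\<in>A. \<forall>z\<in>A. mul (x + y) z = mul x z + mul y z) \<and>
     (\<forall>x\<in>A. \<forall>y\<in>A. \<forall>z\<in>A. mul x (y + z) = mul x y + mul x z) \<and>
     (\<forall>c. \<forall>x\<in>A. \<forall>y\<in>A. mul (scl c x) y = scl c (mul x y) \<and> mul x (scl c y) = scl c (mul x y)) \<and>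
     (\<forall>x\<in>A. adj x \<in> A \<and> adj (adj x) = x) \<and>
     (\<forall>x\<in>A. \<forall>y\<in>A. adj (x + y) = adj x + adj y) \<and>
     (\<forall>c. \<forall>x\<in>A. adj (scl c x) = scl (cnj c) (adj x)) \<and>
     (\<forall>x\<in>A. \<forall>y\<in>A. adj (mul x y) = mul (adj y) (adj x)) \<and>
     (\<forall>c. \<forall>x\<in>A. norm (scl c x) = cmod c * norm x) \<and>
     (\<forall>x\<in>A. \<forall>y\<in>A. norm (mul x y) \<le> norm x * norm y) \<and>
     (\<forall>x\<in>A. norm (mul (adj x) x) = (norm x)\<^sup>2)"

text \<open>
  The involutions of all box spaces are restrictions of one operation \<open>adj\<close>, and their \<open>C\<^sup>*\<close>-norms are
  restrictions of the norm of \<open>'a\<close>, as for the direct sum of the box spaces with the sum norm.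
\<close>

record 'a star_planar_algebra = "'a planar_algebra" +
  adj :: "'a \<Rightarrow> 'a"

definition cstar_planar_algebra ::
  "('a::real_normed_vector, 'm) star_planar_algebra_scheme \<Rightarrow> bool"
where
  "cstar_planar_algebra P \<longleftrightarrow>
     shaded_planar_algebra P \<and>
     (\<forall>c x. cscale P (complex_of_real c) x = c *\<^sub>R x) \<and>
     (\<forall>n s. findim_cstar_algebra (cscale P) (box_space P n s) (pa_mult P n s) (pa_one P n s) (adj P)) \<and>
     (\<forall>T f. is_tangle T \<longrightarrow> inputs_ok P T f \<longrightarrow>
        adj P (act P T f) = act P (reflect_tangle T) (\<lambda>i. adj P (f i))) \<and>
     (\<exists>tr :: nat \<Rightarrow> shade \<Rightarrow> 'a \<Rightarrow> complex. \<forall>n s.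
        (\<forall>x\<in>box_space P n s. \<forall>y\<in>box_space P n s. tr n s (x + y) = tr n s x + tr n s y) \<and>
        (\<forall>c. \<forall>x\<in>box_space P n s. tr n s (cscale P c x) = c * tr n s x) \<and>
        (\<forall>x\<in>box_space P n s. \<forall>y\<in>box_space P n s.
           tr n s (pa_mult P n s x y) = tr n s (pa_mult P n s y x)) \<and>
        (\<forall>x\<in>box_space P n s. \<exists>t\<ge>0. tr n s (pa_mult P n s (adj P x) x) = complex_of_real t) \<and>
        (\<forall>x\<in>box_space P n s. tr n s (pa_mult P n s (adj P x) x) = 0 \<longrightarrow> x = 0) \<and>
        (\<forall>x\<in>box_space P n s. tr n s x = tr 0 s (pa_closure P n s x)))"


subsection \<open>Positive elements, projections and spectra\<close>

definition positive :: "('a, 'm) star_planar_algebra_scheme \<Rightarrow> nat \<Rightarrow> shade \<Rightarrow> 'a \<Rightarrow> bool" where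
  "positive P n s x \<longleftrightarrow> (\<exists>y\<in>box_space P n s. x = pa_mult P n s (adj P y) y)"

definition pos_part :: "('a, 'm) star_planar_algebra_scheme \<Rightarrow> nat \<Rightarrow> shade \<Rightarrow> 'a set \<Rightarrow> 'a set" where
  "pos_part P n s S = {x \<in> S. positive P n s x}"

definition below :: "('a::ab_group_add, 'm) star_planar_algebra_scheme \<Rightarrow> nat \<Rightarrow> shade \<Rightarrow> 'a \<Rightarrow> 'a \<Rightarrow> bool"
where
  "below P n s x y \<longleftrightarrow> positive P n s (y - x)"

definition projection :: "('a, 'm) star_planar_algebra_scheme \<Rightarrow> nat \<Rightarrow> shade \<Rightarrow> 'a \<Rightarrow> bool" where
  "projection P n s q \<longleftrightarrow> q \<in> box_space P n s \<and> adj P q = q \<and> pa_mult P n s q q = q"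

definition perp :: "('a::ab_group_add, 'm) star_planar_algebra_scheme \<Rightarrow> nat \<Rightarrow> shade \<Rightarrow> 'a \<Rightarrow> 'a" where
  "perp P n s q = pa_one P n s - q"

text \<open>The smallest projection \<open>q\<close> with \<open>q a = a\<close>.\<close>

definition range_proj ::
  "('a::ab_group_add, 'm) star_planar_algebra_scheme \<Rightarrow> nat \<Rightarrow> shade \<Rightarrow> 'a \<Rightarrow> 'a"
where
  "range_proj P n s a = (THE q. projection P n s q \<and> pa_mult P n s q a = a \<and>
     (\<forall>q'. projection P n s q' \<and> pa_mult P n s q' a = a \<longrightarrow> below P n s q q'))"

text \<open>The largest projection below \<open>p\<close> and \<open>q\<close>.\<close>

definition proj_meet ::
  "('a::ab_group_add, 'm) star_planar_algebra_scheme \<Rightarrow> nat \<Rightarrow> shade \<Rightarrow> 'a \<Rightarrow> 'a \<Rightarrow> 'a"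
where
  "proj_meet P n s p q = (THE e. projection P n s e \<and> below P n s e p \<and> below P n s e q \<and>
     (\<forall>e'. projection P n s e' \<and> below P n s e' p \<and> below P n s e' q \<longrightarrow> below P n s e' e))"

definition spectrum_of ::
  "('a::ab_group_add, 'm) star_planar_algebra_scheme \<Rightarrow> nat \<Rightarrow> shade \<Rightarrow> 'a \<Rightarrow> complex set"
where
  "spectrum_of P n s x = {c. \<not> (\<exists>y\<in>box_space P n s.
     pa_mult P n s (x - cscale P c (pa_one P n s)) y = pa_one P n s \<and>
     pa_mult P n s y (x - cscale P c (pa_one P n s)) = pa_one P n s)}"

definition spectral_radius_of ::
  "('a::ab_group_add, 'm) star_planar_algebra_scheme \<Rightarrow> nat \<Rightarrow> shade \<Rightarrow> 'a \<Rightarrow> real"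
where
  "spectral_radius_of P n s x = Sup (cmod ` spectrum_of P n s x)"


section \<open>Perron-Frobenius data of \<open>x \<in> box_space P 2 s\<close>\<close>

definition F_positive :: "('a, 'm) star_planar_algebra_scheme \<Rightarrow> shade \<Rightarrow> 'a \<Rightarrow> bool" where
  "F_positive P s x \<longleftrightarrow> positive P 2 (opp s) (fourier P s x)"

definition PF_radius :: "('a::ab_group_add, 'm) star_planar_algebra_scheme \<Rightarrow> shade \<Rightarrow> 'a \<Rightarrow> real" where
  "PF_radius P s x = spectral_radius_of P 2 s x"

definition PF_space ::
  "('a::real_normed_vector, 'm) star_planar_algebra_scheme \<Rightarrow> shade \<Rightarrow> 'a \<Rightarrow> 'a set"
where
  "PF_space P s x =
     {y \<in> box_space P 1 s. conv_left P s y (fourier P s x) = PF_radius P s x *\<^sub>R y}"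

definition right_PF_eigenvector ::
  "('a::real_normed_vector, 'm) star_planar_algebra_scheme \<Rightarrow> shade \<Rightarrow> 'a \<Rightarrow> 'a \<Rightarrow> bool"
where
  "right_PF_eigenvector P s x y \<longleftrightarrow> y \<noteq> 0 \<and> positive P 1 (opp s) y \<and>
     conv_right P (opp s) (fourier P s x) y = PF_radius P s x *\<^sub>R y"

definition PF_projections ::
  "('a::real_normed_vector, 'm) star_planar_algebra_scheme \<Rightarrow> shade \<Rightarrow> 'a \<Rightarrow> 'a set"
where
  "PF_projections P s x = range_proj P 1 s ` pos_part P 1 s (PF_space P s x)"

definition p_max :: "('a::real_normed_vector, 'm) star_planar_algebra_scheme \<Rightarrow> shade \<Rightarrow> 'a \<Rightarrow> 'a" where
  "p_max P s x = (THE p. p \<in> PF_projections P s x \<and> (\<forall>q\<in>PF_projections P s x. below P 1 s q p))"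

definition PF_zeta :: "('a::real_normed_vector, 'm) star_planar_algebra_scheme \<Rightarrow> shade \<Rightarrow> 'a \<Rightarrow> 'a" where
  "PF_zeta P s x = Lim (at_right (PF_radius P s x)) (\<lambda>z::real.
     (z - PF_radius P s x) *\<^sub>R
       (\<Sum>j. (1 / z ^ (j + 1)) *\<^sub>R conv_left_power P s (p_max P s x) (fourier P s x) j))"

definition cut_down :: "('a, 'm) star_planar_algebra_scheme \<Rightarrow> shade \<Rightarrow> 'a \<Rightarrow> 'a \<Rightarrow> 'a" where
  "cut_down P s p x = pa_mult P 2 s (pa_mult P 2 s (juxtapose P s p (bar P s p)) x)
     (juxtapose P s p (bar P s p))"

definition PF_algebra_A ::
  "('a::real_normed_vector, 'm) star_planar_algebra_scheme \<Rightarrow> shade \<Rightarrow> 'a \<Rightarrow> 'a set"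
where
  "PF_algebra_A P s x = {y \<in> box_space P 1 s.
     pa_mult P 2 s (cut_down P s (p_max P s x) x) (juxtapose P s (pa_one P 1 s) (bar P s y)) =
     pa_mult P 2 s (juxtapose P s (pa_one P 1 s) (bar P s y)) (cut_down P s (p_max P s x) x)}"

definition PF_algebra_B ::
  "('a::real_normed_vector, 'm) star_planar_algebra_scheme \<Rightarrow> shade \<Rightarrow> 'a \<Rightarrow> 'a set"
where
  "PF_algebra_B P s x = {y \<in> box_space P 1 s.
     pa_mult P 2 s (cut_down P s (p_max P s x) x) (juxtapose P s y (pa_one P 1 (opp s))) =
     pa_mult P 2 s (juxtapose P s y (pa_one P 1 (opp s))) (cut_down P s (p_max P s x) x)}"

end

(*
  Write Phi(y) = y * F(x) on M = box_space P 1 s, with F the Fourier transform, and eta for the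
  180 degree rotation of y1. The right eigenvector equation says that Phi multiplies the functional
  v |-> tr(v eta) by r, and the condition on the supports makes this functional faithful on pMp, which
  contains E+. For y in E+ put a = y zeta^{-1}, the inverse being taken in pMp. Factor F(x_p) as
  c adj(c) and let D = (bar(a) | 1) c - (1 | a) c be the defect of a to lie in A_p. Then
  zeta * (D adj D) = Phi(k) - r k for k = a zeta adj(a); it is positive and killed by the functional,
  hence zero. As zeta dominates a multiple of p, also 1 * (D adj D) = p * (D adj D) = 0, and this
  forces D = 0 because the trace of 1 * (D adj D) is the trace of F(D) adj F(D). So a lies in A_p and
  y = a zeta. The converse inclusion holds because an element of A_p slides through the convolution,
  and B_p consists of the adjoints of the elements of A_p.

  The existence of zeta needs no formula for the spectral radius: as the orbit of p under Phi/r is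
  bounded, a linear relation between the vectors (1 - Phi/r)^i p splits p into a fixed vector and a
  coboundary.

  Planar isotopies are handled by diagrams whose boxes carry vectors; an identity between two such
  diagrams is certified by the list of heights at which neighbouring pieces are exchanged or cancelled.
*)

theory Submission
  imports Defs "HOL-Computational_Algebra.Fundamental_Theorem_Algebra"
begin

section \<open>Diagrams filled with vectors\<close>

text \<open>Why the defect of \<open>a = y \<cdot> w\<close>, with \<open>w\<close> inverse to
  \<open>zeta\<close> on its support, is the right object:
  \<open>a \<cdot> zeta = y = zeta \<cdot> adj P a\<close>, so the square of the defect, convolved
  with \<open>zeta\<close>, has four terms, three of which collapse to \<open>r *\<^sub>R k\<close>
  by the eigenvector equations of \<open>y\<close> and \<open>zeta\<close>; the fourth is
  \<open>Phi k\<close>.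

  The functional is faithful only on the corner of \<open>p\<close>, so every vector fed to it must
  be shown to lie there. Order does this: a positive element below a multiple of \<open>zeta\<close>
  has its support under \<open>p\<close>.

  An algebra is here a subset of a normed space that is not assumed complete, with its own product.
  Hence the spectral theorem is drawn from a minimal polynomial, and the series behind
  \<open>zeta\<close> converge because the linear equation for their sum is solved first and the
  remainder is estimated afterwards.

  Range projections, meets, \<open>p_max\<close> and \<open>zeta\<close> are definite descriptions
  or limits, so each of them first needs an existence proof.\<close>

datatype 'a fpiece = FCup | FCap | FBox 'a nat

type_synonym 'a fdiagram = "(nat \<times> 'a fpiece) list"

primrec fbelow :: "'a fpiece \<Rightarrow> nat" where
  "fbelow FCup = 0" | "fbelow FCap = 2" | "fbelow (FBox x k) = k"

primrec fabove :: "'a fpiece \<Rightarrow> nat" where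
  "fabove FCup = 2" | "fabove FCap = 0" | "fabove (FBox x k) = k"

primrec fill_piece :: "(nat \<Rightarrow> 'a) \<Rightarrow> piece \<Rightarrow> 'a fpiece" where
  "fill_piece f Cup = FCup" | "fill_piece f Cap = FCap" | "fill_piece f (Box i k) = FBox (f i) k"

definition fill :: "(nat \<Rightarrow> 'a) \<Rightarrow> diagram \<Rightarrow> 'a fdiagram" where
  "fill f = map (map_prod id (fill_piece f))"

definition shift :: "nat \<Rightarrow> (nat \<times> 'b) list \<Rightarrow> (nat \<times> 'b) list" where
  "shift a = map (\<lambda>(b, e). (a + b, e))"

text \<open>The start \<open>N\<close> is free, so that the labels can avoid a given finite set or
  leave one label for a disc that is still to be filled.\<close>

fun number :: "nat \<Rightarrow> 'a fdiagram \<Rightarrow> diagram" where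
  "number N [] = []"
| "number N ((a, FBox x k) # G) = (a, Box N k) # number (Suc N) G"
| "number N ((a, FCup) # G) = (a, Cup) # number N G"
| "number N ((a, FCap) # G) = (a, Cap) # number N G"

fun contents :: "'a fdiagram \<Rightarrow> 'a list" where
  "contents [] = []"
| "contents ((a, FBox x k) # G) = x # contents G"
| "contents ((a, FCup) # G) = contents G"
| "contents ((a, FCap) # G) = contents G"

definition val :: "('a, 'm) planar_algebra_scheme \<Rightarrow> nat \<Rightarrow> shade \<Rightarrow> 'a fdiagram \<Rightarrow> 'a" where
  "val P n s G = act P (Tangle n s (number 0 G)) ((!) (contents G))"

text \<open>Membership in the box spaces is part of well-formedness, and the shading is expressed by
  parity, so that a concrete diagram is checked by rewriting.\<close>

fun fwf :: "('a, 'm) planar_algebra_scheme \<Rightarrow> shade \<Rightarrow> nat \<Rightarrow> 'a fdiagram \<Rightarrow> nat \<Rightarrow> bool" where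
  "fwf P s m [] n \<longleftrightarrow> m = n"
| "fwf P s m ((a, FBox x k) # G) n \<longleftrightarrow>
     a + k \<le> m \<and> x \<in> box_space P k (if even a then s else opp s) \<and> fwf P s m G n"
| "fwf P s m ((a, FCup) # G) n \<longleftrightarrow> a \<le> m \<and> fwf P s (m + 2) G n"
| "fwf P s m ((a, FCap) # G) n \<longleftrightarrow> a + 2 \<le> m \<and> fwf P s (m - 2) G n"

primrec freflect_piece :: "('a \<Rightarrow> 'a) \<Rightarrow> 'a fpiece \<Rightarrow> 'a fpiece" where
  "freflect_piece h FCup = FCap" | "freflect_piece h FCap = FCup"
| "freflect_piece h (FBox x k) = FBox (h x) k"

definition freflect :: "('a \<Rightarrow> 'a) \<Rightarrow> 'a fdiagram \<Rightarrow> 'a fdiagram" where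
  "freflect h G = rev (map (map_prod id (freflect_piece h)) G)"

text \<open>
  Exchanges the pieces at the heights \<open>i\<close> and \<open>i + 1\<close>, or cancels them if they form a zigzag. A diagram
  that admits neither is left alone, so \<open>slide\<close> is sound for every index.
\<close>

fun slide :: "nat \<Rightarrow> 'a fdiagram \<Rightarrow> 'a fdiagram" where
  "slide 0 ((a, e) # (b, f) # G) =
     (if e = FCup \<and> f = FCap \<and> (b = a + 1 \<or> a = b + 1) then G
      else if a + fabove e \<le> b then (b - fabove e + fbelow e, f) # (a, e) # G
      else if b + fbelow f \<le> a then (b, f) # (a - fbelow f + fabove f, e) # G
      else (a, e) # (b, f) # G)"
| "slide (Suc i) (d # G) = d # slide i G"
| "slide i G = G"

lemma opp_opp [simp]: "opp (opp s) = s"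
  by (cases s) auto

lemma funpow_opp [simp]: "(opp ^^ a) s = (if even a then s else opp s)"
  by (induction a) auto

lemma fill_simps [simp]:
  "fill f [] = []" "fill f ((a, e) # D) = (a, fill_piece f e) # fill f D"
  "fill f (D @ D') = fill f D @ fill f D'"
  by (auto simp: fill_def)

lemma shift_simps [simp]:
  "shift a [] = []" "shift a ((b, e) # D) = (a + b, e) # shift a D"
  "shift a (D @ D') = shift a D @ shift a D'"
  by (auto simp: shift_def)

lemma shift_0 [simp]: "shift 0 D = D"
  by (induction D) auto

lemma fill_shift: "fill f (shift a D) = shift a (fill f D)"
  by (induction D) auto

lemma fbelow_fill [simp]: "fbelow (fill_piece f e) = legs_below e"
  by (cases e) auto

lemma fabove_fill [simp]: "fabove (fill_piece f e) = legs_above e"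
  by (cases e) auto

lemma labels_append [simp]: "labels (D @ E) = labels D @ labels E"
  by (induction D rule: labels.induct) auto

lemma labels_rev [simp]: "labels (rev D) = rev (labels D)"
  by (induction D rule: labels.induct) auto

lemma labels_shift [simp]: "labels (shift a D) = labels D"
  by (induction D rule: labels.induct) auto

lemma number_append [simp]:
  "number N (G @ H) = number N G @ number (N + length (contents G)) H"
  by (induction N G rule: number.induct) auto

lemma contents_append [simp]: "contents (G @ H) = contents G @ contents H"
  by (induction G rule: contents.induct) auto

lemma number_shift [simp]: "number N (shift a G) = shift a (number N G)"
  by (induction N G rule: number.induct) auto

lemma contents_shift [simp]: "contents (shift a G) = contents G"
  by (induction G rule: contents.induct) auto

lemma labels_number [simp]: "labels (number N G) = [N..<N + length (contents G)]"
  by (induction N G rule: number.induct) (auto simp del: upt_Suc simp: upt_conv_Cons)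

lemma fill_number:
  "(\<And>i. i < length (contents G) \<Longrightarrow> f (N + i) = contents G ! i) \<Longrightarrow> fill f (number N G) = G"
proof (induction N G rule: number.induct)
  case (2 N a x k G)
  have "f N = x" using 2(2)[of 0] by simp
  moreover have "f (Suc N + i) = contents G ! i" if "i < length (contents G)" for i
    using 2(2)[of "Suc i"] that by simp
  ultimately show ?case using 2(1) by simp
qed auto

lemma fill_cong: "(\<And>i. i \<in> set (labels D) \<Longrightarrow> f i = g i) \<Longrightarrow> fill f D = fill g D"
  by (induction D rule: labels.induct) auto

lemma wf_fill: "fwf P s m (fill f D) n \<Longrightarrow> wf_diagram m D n"
  by (induction D arbitrary: m rule: labels.induct) auto

lemma has_input_Cons:
  "has_input (Tangle q s ((a, e) # D)) i k t \<longleftrightarrow>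
     (e = Box i k \<and> t = (opp ^^ a) s) \<or> has_input (Tangle q s D) i k t"
  by (auto simp: has_input_def)

text \<open>\<open>q\<close> is free because \<open>inputs_ok\<close> sees only the diagram and the
  left shading, not the number of outer strings.\<close>

lemma fwf_fill_iff:
  "fwf P s m (fill f D) n \<longleftrightarrow> wf_diagram m D n \<and> inputs_ok P (Tangle q s D) f"
proof (induction D arbitrary: m rule: labels.induct)
  case 1
  then show ?case by (auto simp: inputs_ok_def has_input_def)
qed (auto simp: inputs_ok_def has_input_Cons)

lemma insert_append:
  "insert_diagram E i (D @ D') = insert_diagram E i D @ insert_diagram E i D'"
  by (induction E i D rule: insert_diagram.induct) auto

lemma insert_fresh: "i \<notin> set (labels D) \<Longrightarrow> insert_diagram E i D = D"
  by (induction E i D rule: insert_diagram.induct) auto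

lemma insert_at:
  "i \<notin> set (labels U) \<Longrightarrow> i \<notin> set (labels W) \<Longrightarrow>
    insert_diagram E i (U @ (a, Box i k) # W) = U @ shift a E @ W"
  by (simp add: insert_append insert_fresh shift_def)

lemma fwf_append:
  "fwf P s m (G @ H) n \<longleftrightarrow> (\<exists>k. fwf P s m G k \<and> fwf P s k H n)"
  by (induction P s m G n rule: fwf.induct) auto

lemma wf_append:
  "wf_diagram m (G @ H) n \<longleftrightarrow> (\<exists>k. wf_diagram m G k \<and> wf_diagram k H n)"
  by (induction m G n rule: wf_diagram.induct) auto

lemma freflect_simps [simp]:
  "freflect h [] = []" "freflect h ((a, e) # G) = freflect h G @ [(a, freflect_piece h e)]"
  by (auto simp: freflect_def)

lemma fill_reflect:
  "fill (\<lambda>i. h (f i)) (rev (map (\<lambda>(a, e). (a, reflect_piece e)) D)) = freflect h (fill f D)"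
proof (induction D)
  case (Cons d D)
  then show ?case by (cases d; cases "snd d") auto
qed simp

lemma labels_reflect: "labels (map (\<lambda>(a, e). (a, reflect_piece e)) D) = labels D"
  by (induction D rule: labels.induct) auto

section \<open>Evaluation of filled diagrams and its invariance under isotopy\<close>

locale planar =
  fixes P :: "('a::ab_group_add, 'm) planar_algebra_scheme"
  assumes spa: "shaded_planar_algebra P"
begin

lemmas axioms = spa[unfolded shaded_planar_algebra_def]

lemmas vs = axioms[THEN conjunct1]
  and sub = axioms[THEN conjunct2, THEN conjunct1, rule_format]
  and act_closed = axioms[THEN conjunct2, THEN conjunct2, THEN conjunct1, rule_format]
  and act_cong = axioms[THEN conjunct2, THEN conjunct2, THEN conjunct2, THEN conjunct1, rule_format]

lemmas operadic_axioms = axioms[THEN conjunct2, THEN conjunct2, THEN conjunct2, THEN conjunct2]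

lemmas act_add = operadic_axioms[THEN conjunct1, rule_format]
  and act_scale = operadic_axioms[THEN conjunct2, THEN conjunct1, rule_format]
  and act_isotopic = operadic_axioms[THEN conjunct2, THEN conjunct2, THEN conjunct1, rule_format]
  and act_compose = operadic_axioms[THEN conjunct2, THEN conjunct2, THEN conjunct2, THEN conjunct1, rule_format]
  and act_id = operadic_axioms[THEN conjunct2, THEN conjunct2, THEN conjunct2, THEN conjunct2, rule_format]

text \<open>Labels carry no information: renaming one amounts to composing with an identity tangle.\<close>

lemma act_rename:
  assumes T: "is_tangle (Tangle n s (U @ (a, Box i k) # W))"
    and ok: "inputs_ok P (Tangle n s (U @ (a, Box i k) # W)) h"
    and j: "j \<notin> set (labels U)" "j \<notin> set (labels W)" and eq: "h j = h i"
  shows "act P (Tangle n s (U @ (a, Box j k) # W)) h = act P (Tangle n s (U @ (a, Box i k) # W)) h"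
proof -
  let ?T = "Tangle n s (U @ (a, Box i k) # W)"
  let ?S = "Tangle k ((opp ^^ a) s) [(0, Box j k)]"
  have i: "i \<notin> set (labels U)" "i \<notin> set (labels W)"
    using T by (auto simp: is_tangle_def)
  have hi: "h i \<in> box_space P k ((opp ^^ a) s)"
    using ok by (fastforce simp: inputs_ok_def has_input_def)
  have comp: "compose_tangle ?T i ?S = Tangle n s (U @ (a, Box j k) # W)"
    using i by (simp add: compose_tangle_def insert_at)
  have "act P (compose_tangle ?T i ?S) h = act P ?T (h(i := act P ?S h))"
  proof (rule act_compose[OF T])
    show "is_tangle ?S" by (simp add: is_tangle_def)
    show "has_input ?T i (size_of ?S) (shade_of ?S)" by (auto simp: has_input_def)
    show "set (labels (diagram_of ?S)) \<inter> (set (labels (diagram_of ?T)) - {i}) = {}"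
      using j by auto
    have "fwf P s n (fill h (U @ (a, Box i k) # W)) n"
      unfolding fwf_fill_iff[where q = n] using T ok by (simp add: is_tangle_def)
    then show "inputs_ok P (compose_tangle ?T i ?S) h"
      unfolding comp using eq fwf_fill_iff[of P s n h "U @ (a, Box j k) # W" n n] by simp
  qed
  also have "act P ?S h = h i" using act_id[of h j k "(opp ^^ a) s"] hi eq by simp
  finally show ?thesis unfolding comp by simp
qed

text \<open>Labels are renamed one at a time from the bottom, \<open>U\<close> being the part
  already done. Disjointness keeps each new label off the old ones that still occur above
  it.\<close>

lemma act_fill_disjoint:
  assumes "is_tangle (Tangle n s (U @ D))" "is_tangle (Tangle n s (U @ D'))"
    and "inputs_ok P (Tangle n s (U @ D)) h"
    and "set (labels D) \<inter> set (labels D') = {}" "fill h D = fill h D'"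
  shows "act P (Tangle n s (U @ D)) h = act P (Tangle n s (U @ D')) h"
  using assms
proof (induction D arbitrary: U D')
  case Nil
  then show ?case by (cases D') auto
next
  case (Cons d D)
  obtain a e where d: "d = (a, e)" by (cases d)
  obtain e' D1 where D': "D' = (a, e') # D1" and e': "fill_piece h e' = fill_piece h e"
      and fD: "fill h D = fill h D1"
    using Cons.prems(5) d by (cases D') auto
  show ?case
  proof (cases e)
    case (Box i k)
    then obtain j where j: "e' = Box j k" "h j = h i" using e' by (cases e') auto
    have wf1: "fwf P s n (fill h (U @ d # D)) n"
      using Cons.prems(1,3) by (simp only: fwf_fill_iff[where q=n]) (simp add: is_tangle_def)
    have t2: "is_tangle (Tangle n s (U @ (a, Box j k) # D))"
      using Cons.prems(2,4) wf_fill[OF wf1, unfolded wf_append] Cons.prems(1) d Box j D'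
      by (auto simp: is_tangle_def wf_append)
    have ok2: "inputs_ok P (Tangle n s (U @ (a, Box j k) # D)) h"
      using wf1 fwf_fill_iff[of P s n h "U @ (a, Box j k) # D" n n] d Box j by simp
    have "act P (Tangle n s (U @ (a, Box i k) # D)) h = act P (Tangle n s (U @ (a, Box j k) # D)) h"
      using act_rename[of n s U a i k D h j] Cons.prems d Box j D'
      by (auto simp: is_tangle_def)
    also have "\<dots> = act P (Tangle n s ((U @ [(a, Box j k)]) @ D)) h" by simp
    also have "\<dots> = act P (Tangle n s ((U @ [(a, Box j k)]) @ D1)) h"
      using Cons.prems t2 ok2 d Box j D' fD by (intro Cons.IH) auto
    finally show ?thesis using d Box j D' by simp
  next
    case Cup
    then have "e' = Cup" using e' by (cases e') auto
    then show ?thesis using Cons.IH[of "U @ [d]" D1] Cons.prems d Cup D' fD by auto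
  next
    case Cap
    then have "e' = Cap" using e' by (cases e') auto
    then show ?thesis using Cons.IH[of "U @ [d]" D1] Cons.prems d Cap D' fD by auto
  qed
qed

lemma act_fill_disjoint_labels:
  assumes "is_tangle (Tangle n s D)" "is_tangle (Tangle n s D')"
    and "inputs_ok P (Tangle n s D) f" "inputs_ok P (Tangle n s D') f'"
    and "set (labels D) \<inter> set (labels D') = {}" "fill f D = fill f' D'"
  shows "act P (Tangle n s D) f = act P (Tangle n s D') f'"
proof -
  let ?h = "\<lambda>i. if i \<in> set (labels D) then f i else f' i"
  have f1: "fill ?h D = fill f D" by (rule fill_cong) auto
  have f2: "fill ?h D' = fill f' D'" by (rule fill_cong) (use assms(5) in auto)
  have "act P (Tangle n s D) f = act P (Tangle n s D) ?h"
    by (rule act_cong) (use assms in auto)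
  also have "\<dots> = act P (Tangle n s D') ?h"
  proof (rule act_fill_disjoint[of n s "[]", simplified])
    show "inputs_ok P (Tangle n s D) ?h"
      using assms(1,3) f1 fwf_fill_iff[of P s n ?h D n n] fwf_fill_iff[of P s n f D n n]
      by (auto simp: is_tangle_def)
  qed (use assms f1 f2 in auto)
  also have "\<dots> = act P (Tangle n s D') f'"
    by (rule act_cong[symmetric]) (use assms in auto)
  finally show ?thesis .
qed

text \<open>If the two label sets overlap, a new label may still be in use when it is introduced.
  Both tangles are therefore renamed to fresh labels from \<open>N\<close> on.\<close>

lemma act_fill:
  assumes "is_tangle (Tangle n s D)" "is_tangle (Tangle n s D')"
    and "inputs_ok P (Tangle n s D) f" "inputs_ok P (Tangle n s D') f'"
    and "fill f D = fill f' D'"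
  shows "act P (Tangle n s D) f = act P (Tangle n s D') f'"
proof -
  obtain N where N: "\<And>i. i \<in> set (labels D) \<union> set (labels D') \<Longrightarrow> i < N"
    using finite_nat_set_iff_bounded[of "set (labels D) \<union> set (labels D')"] by auto
  let ?G = "fill f D"
  let ?D = "number N ?G"
  let ?g = "\<lambda>i. contents ?G ! (i - N)"
  have G: "fill ?g ?D = ?G" by (rule fill_number) simp
  have wf: "fwf P s n (fill ?g ?D) n"
    using assms(1,3) unfolding G fwf_fill_iff[of P s n f D n n] by (simp add: is_tangle_def)
  have T: "is_tangle (Tangle n s ?D)" using wf_fill[OF wf] by (simp add: is_tangle_def)
  have ok: "inputs_ok P (Tangle n s ?D) ?g" using wf fwf_fill_iff[of P s n ?g ?D n n] by simp
  have "act P (Tangle n s D) f = act P (Tangle n s ?D) ?g"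
    using N by (intro act_fill_disjoint_labels assms T ok) (auto simp: G, meson UnI1 leD)
  moreover have "act P (Tangle n s D') f' = act P (Tangle n s ?D) ?g"
    using N by (intro act_fill_disjoint_labels assms T ok) (auto simp: G assms(5)[symmetric], meson UnI2 leD)
  ultimately show ?thesis by simp
qed

lemma numbered:
  assumes "fwf P s n G n"
  shows "is_tangle (Tangle n s (number N G))"
    and "inputs_ok P (Tangle n s (number N G)) (\<lambda>i. contents G ! (i - N))"
    and "fill (\<lambda>i. contents G ! (i - N)) (number N G) = G"
proof -
  let ?g = "\<lambda>i. contents G ! (i - N)"
  show G: "fill ?g (number N G) = G" by (rule fill_number) simp
  have wf: "fwf P s n (fill ?g (number N G)) n" using assms unfolding G .
  show "is_tangle (Tangle n s (number N G))" using wf_fill[OF wf] by (simp add: is_tangle_def)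
  show "inputs_ok P (Tangle n s (number N G)) ?g"
    using wf fwf_fill_iff[of P s n ?g "number N G" n n] by simp
qed

lemma act_val:
  assumes "is_tangle (Tangle n s D)" "fwf P s n (fill f D) n"
  shows "act P (Tangle n s D) f = val P n s (fill f D)"
proof -
  have "inputs_ok P (Tangle n s D) f" using assms fwf_fill_iff[of P s n f D n n] by simp
  then show ?thesis
    unfolding val_def using numbered[OF assms(2), of 0] assms by (intro act_fill) auto
qed

lemma val_closed: "fwf P s n G n \<Longrightarrow> val P n s G \<in> box_space P n s"
  unfolding val_def using act_closed[OF numbered(1,2)[of s n G 0]] by simp

lemma val_box: "y \<in> box_space P n s \<Longrightarrow> val P n s [(0, FBox y n)] = y"
  unfolding val_def using act_id[of "(!) [y]" 0 n s] by simp

text \<open>Label 0 is kept for the disc to be replaced, and \<open>U\<close>, \<open>G\<close>,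
  \<open>W\<close> are numbered consecutively from 1. The labels of the composite are then distinct
  and the composition axiom applies.\<close>

lemma val_substitute:
  assumes "fwf P s n (U @ shift a G @ W) n" "fwf P ((opp ^^ a) s) k G k"
    and "fwf P s n (U @ (a, FBox (val P k ((opp ^^ a) s) G) k) # W) n"
  shows "val P n s (U @ (a, FBox (val P k ((opp ^^ a) s) G) k) # W) = val P n s (U @ shift a G @ W)"
proof -
  let ?t = "(opp ^^ a) s"
  let ?DU = "number (Suc 0) U" and ?DG = "number (Suc (length (contents U))) G"
    and ?DW = "number (Suc (length (contents U) + length (contents G))) W"
  let ?f = "\<lambda>i. (contents U @ contents G @ contents W) ! (i - Suc 0)"
  let ?T = "Tangle n s (?DU @ (a, Box 0 k) # ?DW)" and ?S = "Tangle k ?t ?DG"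
  have fU: "fill ?f ?DU = U" and fG: "fill ?f ?DG = G" and fW: "fill ?f ?DW = W"
    by (auto intro!: fill_number simp: nth_append)
  have gU: "fill (?f(0 := x)) ?DU = U" and gW: "fill (?f(0 := x)) ?DW = W" for x
    by (auto intro!: fill_number simp: nth_append)
  have comp: "compose_tangle ?T 0 ?S = Tangle n s (?DU @ shift a ?DG @ ?DW)"
    by (simp add: compose_tangle_def) (subst insert_at; simp add: Suc_le_eq)
  have S: "is_tangle ?S" using numbered(1)[OF assms(2)] .
  have C: "is_tangle (Tangle n s (?DU @ shift a ?DG @ ?DW))"
    using numbered(1)[OF assms(1), of "Suc 0"] by (simp add: add.assoc)
  have T: "is_tangle ?T"
    using wf_fill[of P s n "?f(0 := val P k ?t G)" "?DU @ (a, Box 0 k) # ?DW" n] assms(3)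
    by (simp add: is_tangle_def gU gW) (auto simp: Suc_le_eq)
  have Sv: "act P ?S ?f = val P k ?t G"
    using act_val[OF S, of ?f] assms(2) by (simp add: fG)
  have "act P (compose_tangle ?T 0 ?S) ?f = act P ?T (?f(0 := act P ?S ?f))"
  proof (rule act_compose[OF T S])
    show "has_input ?T 0 (size_of ?S) (shade_of ?S)" by (auto simp: has_input_def)
    show "inputs_ok P (compose_tangle ?T 0 ?S) ?f"
      unfolding comp using assms(1) fwf_fill_iff[of P s n ?f "?DU @ shift a ?DG @ ?DW" n n]
      by (simp add: fill_shift fU fG fW)
  qed auto
  moreover have "act P (compose_tangle ?T 0 ?S) ?f = val P n s (U @ shift a G @ W)"
    unfolding comp using assms(1) act_val[OF C, of ?f] by (simp add: fill_shift fU fG fW)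
  moreover have "act P ?T (?f(0 := act P ?S ?f)) =
      val P n s (U @ (a, FBox (val P k ?t G) k) # W)"
    using assms(3) act_val[OF T, of "?f(0 := act P ?S ?f)"] unfolding Sv
    by (simp add: gU gW)
  ultimately show ?thesis by simp
qed

lemma val_linear:
  fixes U W and a k n :: nat and s
  defines "F \<equiv> \<lambda>x. val P n s (U @ (a, FBox x k) # W)"
  assumes "fwf P s n (U @ (a, FBox u k) # W) n" "v \<in> box_space P k ((opp ^^ a) s)"
  shows "F (u + v) = F u + F v" "F (cscale P c u) = cscale P c (F u)"
proof -
  let ?D = "number 0 U @ (a, Box (length (contents U)) k) # number (Suc (length (contents U))) W"
  let ?f = "\<lambda>i. (contents U @ u # contents W) ! i"
  let ?i = "length (contents U)"
  let ?t = "(opp ^^ a) s"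
  have fU: "fill (?f(?i := x)) (number 0 U) = U"
    and fW: "fill (?f(?i := x)) (number (Suc ?i) W) = W" for x
    by (auto intro!: fill_number simp: nth_append)
  have T: "is_tangle (Tangle n s ?D)" using numbered(1)[OF assms(2), of 0] by simp
  have ok: "inputs_ok P (Tangle n s ?D) ?f" using numbered(2)[OF assms(2), of 0] by simp
  have inp: "has_input (Tangle n s ?D) ?i k ?t" by (auto simp: has_input_def)
  have u: "u \<in> box_space P k ?t" using assms(2) by (auto simp: fwf_append)
  have F: "act P (Tangle n s ?D) (?f(?i := x)) = F x" if "x \<in> box_space P k ?t" for x
    using act_val[OF T, of "?f(?i := x)"] assms(2) that
    by (simp add: fU fW F_def) (auto simp: fwf_append)
  have uv: "u + v \<in> box_space P k ?t" "cscale P c u \<in> box_space P k ?t"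
    using sub u assms(3) vs
    by (metis module_iff_vector_space module.subspace_add module.subspace_scale)+
  show "F (u + v) = F u + F v"
    using act_add[OF T ok inp u assms(3)] F[OF u] F[OF assms(3)] F[OF uv(1)] by simp
  show "F (cscale P c u) = cscale P c (F u)"
    using act_scale[OF T ok inp u] F[OF u] F[OF uv(2)] by simp
qed

text \<open>\<open>mv\<close> is asked of every labelled diagram that fills to \<open>L\<close>,
  because the labels produced by \<open>number\<close> depend on the boxes in \<open>U\<close>. The
  multiset condition keeps the labels distinct after the move.\<close>

lemma val_move:
  assumes mv: "\<And>f D. fill f D = L \<Longrightarrow> \<exists>D'. move D D' \<and> fill f D' = R \<and> mset (labels D') = mset (labels D)"
    and L: "fwf P s n (U @ L @ W) n" and R: "fwf P s n (U @ R @ W) n"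
  shows "val P n s (U @ L @ W) = val P n s (U @ R @ W)"
proof -
  define i j where "i = length (contents U)" and "j = i + length (contents L)"
  let ?f = "\<lambda>k. contents (U @ L @ W) ! (k - 0)"
  have fU: "fill ?f (number 0 U) = U" and fL: "fill ?f (number i L) = L"
    and fW: "fill ?f (number j W) = W"
    by (auto intro!: fill_number simp: nth_append i_def j_def)
  obtain D' where D': "move (number i L) D'" "fill ?f D' = R"
      "mset (labels D') = mset (labels (number i L))"
    using mv[OF fL] by blast
  let ?T = "Tangle n s (number 0 U @ number i L @ number j W)"
  let ?T' = "Tangle n s (number 0 U @ D' @ number j W)"
  have eq: "number 0 (U @ L @ W) = number 0 U @ number i L @ number j W"
    by (simp add: i_def j_def)
  have T: "is_tangle ?T" and ok: "inputs_ok P ?T ?f" using numbered[OF L, of 0] unfolding eq by auto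
  have wf': "fwf P s n (fill ?f (number 0 U @ D' @ number j W)) n" using R by (simp only: fill_simps fU D' fW)
  have T': "is_tangle ?T'"
    using wf_fill[OF wf'] T mset_eq_setD[OF D'(3)] mset_eq_imp_distinct_iff[OF D'(3)]
    by (auto simp: is_tangle_def)
  have "isotopic_tangles ?T ?T'"
    using T T' D'(1) by (auto simp: isotopic_tangles_def is_tangle_def intro!: isotopic_move)
  then have "act P ?T ?f = act P ?T' ?f" using act_isotopic ok by blast
  moreover have "act P ?T ?f = val P n s (fill ?f (number 0 U @ number i L @ number j W))"
    using act_val[OF T, of ?f] L by (simp only: fill_simps fU fL fW)
  moreover have "act P ?T' ?f = val P n s (fill ?f (number 0 U @ D' @ number j W))"
    using act_val[OF T' wf'] .
  ultimately show ?thesis by (simp only: fill_simps fU fL fW D')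
qed

lemma fill_eq_Cons:
  "fill f D = (a, e) # G \<longleftrightarrow> (\<exists>e' D'. D = (a, e') # D' \<and> fill_piece f e' = e \<and> fill f D' = G)"
  by (cases D) auto

lemma fill_eq_Nil: "fill f D = [] \<longleftrightarrow> D = []"
  by (cases D) auto

lemma fill_piece_eq [simp]:
  "fill_piece f e = FCup \<longleftrightarrow> e = Cup" "fill_piece f e = FCap \<longleftrightarrow> e = Cap"
  by (cases e; simp)+

lemma fwf_exchange:
  assumes "a + fabove e \<le> b"
  shows "fwf P s m ((a, e) # (b, f) # W) n \<longleftrightarrow>
    fwf P s m ((b - fabove e + fbelow e, f) # (a, e) # W) n"
proof -
  have [simp]: "2 \<le> m \<Longrightarrow> Suc (Suc (m - 2)) = m" by simp
  show ?thesis by (cases e; cases f) (use assms in auto)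
qed

lemma val_exchange:
  assumes ab: "a + fabove e \<le> b" and wf: "fwf P s n (U @ (a, e) # (b, f) # W) n"
  shows "val P n s (U @ (a, e) # (b, f) # W) =
    val P n s (U @ (b - fabove e + fbelow e, f) # (a, e) # W)"
proof -
  have "val P n s (U @ [(a, e), (b, f)] @ W) =
      val P n s (U @ [(b - fabove e + fbelow e, f), (a, e)] @ W)"
  proof (rule val_move)
    fix g D assume "fill g D = [(a, e), (b, f)]"
    then obtain e' f' where D: "D = [(a, e'), (b, f')]" "fill_piece g e' = e" "fill_piece g f' = f"
      by (auto simp: fill_eq_Cons fill_eq_Nil)
    have "move [(a, e'), (b, f')] [(b - legs_above e' + legs_below e', f'), (a, e')]"
      by (rule move.exchange) (use ab D(2) in auto)
    then show "\<exists>D'. move D D' \<and> fill g D' = [(b - fabove e + fbelow e, f), (a, e)] \<and>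
        mset (labels D') = mset (labels D)"
      using D by (intro exI[of _ "[(b - legs_above e' + legs_below e', f'), (a, e')]"])
        (auto, cases e'; cases f'; auto)
  qed (use wf fwf_exchange[OF ab] in \<open>auto simp: fwf_append\<close>)
  then show ?thesis by simp
qed

lemma val_zigzag:
  assumes "b = a + 1 \<or> a = b + 1" and wf: "fwf P s n (U @ (a, FCup) # (b, FCap) # W) n"
  shows "val P n s (U @ (a, FCup) # (b, FCap) # W) = val P n s (U @ W)"
proof -
  have "val P n s (U @ [(a, FCup), (b, FCap)] @ W) = val P n s (U @ [] @ W)"
  proof (rule val_move)
    fix g D assume "fill g D = [(a, FCup), (b, FCap)]"
    then have D: "D = [(a, Cup), (b, Cap)]" by (auto simp: fill_eq_Cons fill_eq_Nil)
    then show "\<exists>D'. move D D' \<and> fill g D' = [] \<and> mset (labels D') = mset (labels D)"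
      using assms(1) by (intro exI[of _ "[]"]) (use zigzag_right[of a] zigzag_left[of b] in auto)
  qed (use wf in \<open>auto simp: fwf_append\<close>)
  then show ?thesis by simp
qed

text \<open>The two half turns of a 1-box agree, so its rotation may be drawn in whichever direction
  cancels against its surroundings.\<close>

lemma val_turn:
  assumes wf: "fwf P s n (U @ [(Suc a, FCup), (Suc a, FBox y 1), (a, FCap)] @ W) n"
  shows "val P n s (U @ [(Suc a, FCup), (Suc a, FBox y 1), (a, FCap)] @ W) =
    val P n s (U @ [(a, FCup), (Suc a, FBox y 1), (Suc a, FCap)] @ W)"
proof (rule val_move)
  fix g D assume "fill g D = [(Suc a, FCup), (Suc a, FBox y 1), (a, FCap)]"
  then obtain e where D: "D = [(Suc a, Cup), (Suc a, e), (a, Cap)]" "fill_piece g e = FBox y 1"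
    by (auto simp: fill_eq_Cons fill_eq_Nil)
  then obtain i where e: "e = Box i 1" "g i = y" by (cases e) auto
  show "\<exists>D'. move D D' \<and> fill g D' = [(a, FCup), (Suc a, FBox y 1), (Suc a, FCap)] \<and>
      mset (labels D') = mset (labels D)"
    using move.turn[of a 1 i] D e
    by (intro exI[of _ "[(a, Cup), (Suc a, Box i 1), (Suc a, Cap)]"]) (auto simp: nested_cups_def nested_caps_def)
qed (use wf in \<open>auto simp: fwf_append\<close>)

lemma slide_sound:
  "fwf P s n (U @ G) n \<Longrightarrow> fwf P s n (U @ slide i G) n \<and> val P n s (U @ slide i G) = val P n s (U @ G)"
proof (induction i G arbitrary: U rule: slide.induct)
  case (1 a e b f G)
  show ?case
  proof (cases "e = FCup \<and> f = FCap \<and> (b = a + 1 \<or> a = b + 1)")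
    case True
    then show ?thesis using val_zigzag[of b a s n U G] 1 by (auto simp: fwf_append)
  next
    case nz: False
    show ?thesis
    proof (cases "a + fabove e \<le> b")
      case True
      then show ?thesis
        using nz val_exchange[OF True 1] fwf_exchange[OF True] 1 by (auto simp: fwf_append)
    next
      case False
      show ?thesis
      proof (cases "b + fbelow f \<le> a")
        case le: True
        let ?a = "a - fbelow f + fabove f"
        have ab: "b + fabove f \<le> ?a" and eq: "?a - fabove f + fbelow f = a" using le by auto
        have "fwf P s n (U @ (b, f) # (?a, e) # G) n"
          using 1 fwf_exchange[OF ab, of s _ e] unfolding eq by (auto simp: fwf_append)
        then show ?thesis
          using nz False le val_exchange[OF ab, of s n U e G] unfolding eq by auto
      qed (use nz False 1 in auto)
    qed
  qed
next
  case (2 i d G)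
  then show ?case using "2.IH"[of "U @ [d]"] by simp
qed auto

lemma slides_sound:
  assumes "fwf P s n G n"
  shows "fwf P s n (fold slide ps G) n \<and> val P n s (fold slide ps G) = val P n s G"
  using assms
proof (induction ps arbitrary: G)
  case (Cons i ps)
  then show ?case using slide_sound[of s n "[]" G i] by auto
qed auto

lemma val_isotopic:
  assumes "fwf P s n G n" "fwf P s n H n" "fold slide ps G = fold slide qs H"
  shows "val P n s G = val P n s H"
  using slides_sound[OF assms(1), of ps] slides_sound[OF assms(2), of qs] assms(3) by simp

end

section \<open>Identities between tangles\<close>

lemma fwf_shift:
  "fwf P t m G n \<Longrightarrow> t = (if even a then s else opp s) \<Longrightarrow> fwf P s (a + m + r) (shift a G) (a + n + r)"
proof (induction P t m G n rule: fwf.induct)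
  case (3 P t m b G n)
  then show ?case by (simp add: add_ac)
next
  case (4 P t m b G n)
  then have "a + (m - 2) + r = a + m + r - 2" by simp
  then show ?case using 4 by simp
qed (auto split: if_splits)

context planar begin

text \<open>Frees \<open>val_substitute\<close> from the well-formedness of the glued diagram:
  \<open>G\<close> has as many strings below as above, so it fits wherever the box did.\<close>

lemma val_insert:
  assumes t: "t = (if even a then s else opp s)" and G: "fwf P t k G k"
    and wf: "fwf P s n (U @ (a, FBox (val P k t G) k) # W) n"
  shows "val P n s (U @ (a, FBox (val P k t G) k) # W) = val P n s (U @ shift a G @ W)"
proof -
  obtain m where m: "fwf P s n U m" "a + k \<le> m" "fwf P s m W n"
    using wf by (auto simp: fwf_append)
  have "fwf P s (a + k + (m - a - k)) (shift a G) (a + k + (m - a - k))"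
    by (rule fwf_shift[OF G t])
  then have "fwf P s n (U @ shift a G @ W) n" using m by (auto simp: fwf_append)
  then show ?thesis using val_substitute[of s n U a G W k] assms by simp
qed

section \<open>Nested operations as one flat diagram\<close>

lemma mult_flat:
  assumes G: "fwf P s n G n" and H: "fwf P s n H n"
  shows "pa_mult P n s (val P n s G) (val P n s H) = val P n s (G @ H)"
proof -
  have "pa_mult P n s (val P n s G) (val P n s H) =
      val P n s ([(0, FBox (val P n s G) n)] @ (0, FBox (val P n s H) n) # [])"
    by (simp add: pa_mult_def val_def)
  also have "\<dots> = val P n s ([(0, FBox (val P n s G) n)] @ shift 0 H @ [])"
    by (rule val_insert[OF _ H]) (use val_closed[OF G] val_closed[OF H] in auto)
  also have "\<dots> = val P n s ([] @ (0, FBox (val P n s G) n) # H)" by simp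
  also have "\<dots> = val P n s ([] @ shift 0 G @ H)"
    by (rule val_insert[OF _ G]) (use val_closed[OF G] H in auto)
  finally show ?thesis by simp
qed

lemma one_flat: "pa_one P n s = val P n s []"
  by (simp add: pa_one_def val_def)

lemma fourier_flat:
  assumes G: "fwf P s 2 G 2"
  shows "fourier P s (val P 2 s G) = val P 2 (opp s) ((0, FCup) # shift 1 G @ [(2, FCap)])"
proof -
  have "fourier P s (val P 2 s G) =
      val P 2 (opp s) ([(0, FCup)] @ (1, FBox (val P 2 s G) 2) # [(2, FCap)])"
    by (simp add: fourier_def val_def)
  also have "\<dots> = val P 2 (opp s) ([(0, FCup)] @ shift 1 G @ [(2, FCap)])"
    by (rule val_insert[OF _ G]) (use val_closed[OF G] in auto)
  finally show ?thesis by simp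
qed

lemma bar_flat:
  assumes G: "fwf P s 1 G 1"
  shows "bar P s (val P 1 s G) = val P 1 (opp s) ((1, FCup) # shift 1 G @ [(0, FCap)])"
proof -
  have "bar P s (val P 1 s G) = val P 1 (opp s) ([(1, FCup)] @ (1, FBox (val P 1 s G) 1) # [(0, FCap)])"
    by (simp add: bar_def val_def)
  also have "\<dots> = val P 1 (opp s) ([(1, FCup)] @ shift 1 G @ [(0, FCap)])"
    by (rule val_insert[OF _ G]) (use val_closed[OF G] in auto)
  finally show ?thesis by simp
qed

lemma conv_left_flat:
  assumes t: "t = opp s" and G: "fwf P s 1 G 1" and H: "fwf P t 2 H 2"
  shows "conv_left P s (val P 1 s G) (val P 2 t H) =
    val P 1 s ((0, FCup) # G @ shift 1 H @ [(0, FCap)])"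
proof -
  let ?g = "val P 1 s G" and ?h = "val P 2 t H"
  have H': "fwf P s 3 (shift 1 H) 3" using fwf_shift[OF H, of 1 s 0] t by (simp add: eval_nat_numeral)
  have "conv_left P s ?g ?h = val P 1 s ([(0, FCup), (0, FBox ?g 1)] @ (1, FBox ?h 2) # [(0, FCap)])"
    by (simp add: conv_left_def val_def)
  also have "\<dots> = val P 1 s ([(0, FCup), (0, FBox ?g 1)] @ shift 1 H @ [(0, FCap)])"
    by (rule val_insert[OF _ H]) (use t val_closed[OF G] val_closed[OF H] in auto)
  also have "\<dots> = val P 1 s ([(0, FCup)] @ (0, FBox ?g 1) # (shift 1 H @ [(0, FCap)]))" by simp
  also have "\<dots> = val P 1 s ([(0, FCup)] @ shift 0 G @ (shift 1 H @ [(0, FCap)]))"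
    by (rule val_insert[OF _ G]) (use val_closed[OF G] H' in \<open>auto simp: fwf_append eval_nat_numeral\<close>)
  finally show ?thesis by simp
qed

lemma conv_right_flat:
  assumes G: "fwf P s 2 G 2" and H: "fwf P s 1 H 1"
  shows "conv_right P s (val P 2 s G) (val P 1 s H) =
    val P 1 s ((1, FCup) # G @ shift 2 H @ [(1, FCap)])"
proof -
  let ?g = "val P 2 s G" and ?h = "val P 1 s H"
  have H': "fwf P s 3 (shift 2 H) 3" using fwf_shift[OF H, of 2 s 0] by (simp add: eval_nat_numeral)
  have "conv_right P s ?g ?h = val P 1 s ([(1, FCup), (0, FBox ?g 2)] @ (2, FBox ?h 1) # [(1, FCap)])"
    by (simp add: conv_right_def val_def)
  also have "\<dots> = val P 1 s ([(1, FCup), (0, FBox ?g 2)] @ shift 2 H @ [(1, FCap)])"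
    by (rule val_insert[OF _ H]) (use val_closed[OF G] val_closed[OF H] in auto)
  also have "\<dots> = val P 1 s ([(1, FCup)] @ (0, FBox ?g 2) # (shift 2 H @ [(1, FCap)]))" by simp
  also have "\<dots> = val P 1 s ([(1, FCup)] @ shift 0 G @ (shift 2 H @ [(1, FCap)]))"
    by (rule val_insert[OF _ G]) (use val_closed[OF G] H' in \<open>auto simp: fwf_append eval_nat_numeral\<close>)
  finally show ?thesis by simp
qed

lemma conv_flat:
  assumes G: "fwf P s 2 G 2" and H: "fwf P s 2 H 2"
  shows "conv P s (val P 2 s G) (val P 2 s H) =
    val P 2 s ((1, FCup) # G @ shift 2 H @ [(1, FCap)])"
proof -
  let ?g = "val P 2 s G" and ?h = "val P 2 s H"
  have H': "fwf P s 4 (shift 2 H) 4" using fwf_shift[OF H, of 2 s 0] by (simp add: eval_nat_numeral)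
  have "conv P s ?g ?h = val P 2 s ([(1, FCup), (0, FBox ?g 2)] @ (2, FBox ?h 2) # [(1, FCap)])"
    by (simp add: conv_def val_def)
  also have "\<dots> = val P 2 s ([(1, FCup), (0, FBox ?g 2)] @ shift 2 H @ [(1, FCap)])"
    by (rule val_insert[OF _ H]) (use val_closed[OF G] val_closed[OF H] in auto)
  also have "\<dots> = val P 2 s ([(1, FCup)] @ (0, FBox ?g 2) # (shift 2 H @ [(1, FCap)]))" by simp
  also have "\<dots> = val P 2 s ([(1, FCup)] @ shift 0 G @ (shift 2 H @ [(1, FCap)]))"
    by (rule val_insert[OF _ G]) (use val_closed[OF G] H' in \<open>auto simp: fwf_append eval_nat_numeral\<close>)
  finally show ?thesis by simp
qed

lemma juxtapose_flat:
  assumes t: "t = opp s" and G: "fwf P s 1 G 1" and H: "fwf P t 1 H 1"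
  shows "juxtapose P s (val P 1 s G) (val P 1 t H) = val P 2 s (G @ shift 1 H)"
proof -
  let ?g = "val P 1 s G" and ?h = "val P 1 t H"
  have H': "fwf P s 2 (shift 1 H) 2" using fwf_shift[OF H, of 1 s 0] t by (simp add: eval_nat_numeral)
  have "juxtapose P s ?g ?h = val P 2 s ([(0, FBox ?g 1)] @ (1, FBox ?h 1) # [])"
    by (simp add: juxtapose_def val_def)
  also have "\<dots> = val P 2 s ([(0, FBox ?g 1)] @ shift 1 H @ [])"
    by (rule val_insert[OF _ H]) (use t val_closed[OF G] val_closed[OF H] in auto)
  also have "\<dots> = val P 2 s ([] @ (0, FBox ?g 1) # shift 1 H)" by simp
  also have "\<dots> = val P 2 s ([] @ shift 0 G @ shift 1 H)"
    by (rule val_insert[OF _ G]) (use val_closed[OF G] H' in auto)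
  finally show ?thesis by simp
qed

lemma closure1_flat:
  assumes G: "fwf P s 1 G 1"
  shows "pa_closure P 1 s (val P 1 s G) = val P 0 s ((0, FCup) # G @ [(0, FCap)])"
proof -
  have "pa_closure P 1 s (val P 1 s G) = val P 0 s ([(0, FCup)] @ (0, FBox (val P 1 s G) 1) # [(0, FCap)])"
    by (simp add: pa_closure_def val_def nested_cups_def nested_caps_def)
  also have "\<dots> = val P 0 s ([(0, FCup)] @ shift 0 G @ [(0, FCap)])"
    by (rule val_insert[OF _ G]) (use val_closed[OF G] in auto)
  finally show ?thesis by simp
qed

lemma closure2_flat:
  assumes G: "fwf P s 2 G 2"
  shows "pa_closure P 2 s (val P 2 s G) =
    val P 0 s ((0, FCup) # (1, FCup) # G @ [(1, FCap), (0, FCap)])"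
proof -
  have "pa_closure P 2 s (val P 2 s G) =
      val P 0 s ([(0, FCup), (1, FCup)] @ (0, FBox (val P 2 s G) 2) # [(1, FCap), (0, FCap)])"
    by (simp add: pa_closure_def val_def nested_cups_def nested_caps_def upt_conv_Cons)
  also have "\<dots> = val P 0 s ([(0, FCup), (1, FCup)] @ shift 0 G @ [(1, FCap), (0, FCap)])"
    by (rule val_insert[OF _ G]) (use val_closed[OF G] in auto)
  finally show ?thesis by simp
qed

text \<open>The 90 degree rotation in the other direction. It undoes \<open>fourier\<close>, and it
  also arises from \<open>fourier\<close> by reflection, that is, by taking adjoints.\<close>

definition fourier_inv :: "shade \<Rightarrow> 'a \<Rightarrow> 'a" where
  "fourier_inv s x = val P 2 (opp s) [(2, FCup), (1, FBox x 2), (0, FCap)]"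

lemma fourier_inv_flat:
  assumes G: "fwf P s 2 G 2"
  shows "fourier_inv s (val P 2 s G) = val P 2 (opp s) ((2, FCup) # shift 1 G @ [(0, FCap)])"
proof -
  have "fourier_inv s (val P 2 s G) =
      val P 2 (opp s) ([(2, FCup)] @ (1, FBox (val P 2 s G) 2) # [(0, FCap)])"
    by (simp add: fourier_inv_def)
  also have "\<dots> = val P 2 (opp s) ([(2, FCup)] @ shift 1 G @ [(0, FCap)])"
    by (rule val_insert[OF _ G]) (use val_closed[OF G] in auto)
  finally show ?thesis by simp
qed

lemmas flat = mult_flat one_flat fourier_flat fourier_inv_flat bar_flat conv_left_flat
  conv_right_flat conv_flat juxtapose_flat closure1_flat closure2_flat

lemma bar_turn:
  assumes "y \<in> box_space P 1 s"
  shows "bar P s y = val P 1 (opp s) [(0, FCup), (1, FBox y 1), (1, FCap)]"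
  using val_turn[of "opp s" 1 "[]" 0 y "[]"] assms by (simp add: bar_def val_def)

section \<open>Identities obtained by sliding boxes along strings\<close>

lemma juxtapose_mult:
  assumes [simp]: "a \<in> box_space P 1 s" "b \<in> box_space P 1 (opp s)" "c \<in> box_space P 1 s" "d \<in> box_space P 1 (opp s)"
  shows "pa_mult P 2 s (juxtapose P s a b) (juxtapose P s c d) =
    juxtapose P s (pa_mult P 1 s a c) (pa_mult P 1 (opp s) b d)"
proof -
  \<comment> \<open>Writing each box as a one-piece diagram lets the flat rules merge each side into
    a single diagram; \<open>val_box\<close> removes the disguise at the end. The identities below
    use the same device.\<close>
  let ?a = "val P 1 s [(0, FBox a 1)]"
    and ?b = "val P 1 (opp s) [(0, FBox b 1)]"
    and ?c = "val P 1 s [(0, FBox c 1)]"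
    and ?d = "val P 1 (opp s) [(0, FBox d 1)]"
  have "pa_mult P 2 s (juxtapose P s ?a ?b) (juxtapose P s ?c ?d) =
      juxtapose P s (pa_mult P 1 s ?a ?c) (pa_mult P 1 (opp s) ?b ?d)"
    by (simp add: flat del: One_nat_def, rule val_isotopic[where ps = "[1]" and qs = "[]"])
      (simp del: One_nat_def, simp del: One_nat_def, simp add: eval_nat_numeral)
  then show ?thesis by (simp add: val_box del: One_nat_def)
qed

lemma bar_mult:
  assumes [simp]: "a \<in> box_space P 1 s" "b \<in> box_space P 1 s"
  shows "bar P s (pa_mult P 1 s a b) =
    pa_mult P 1 (opp s) (bar P s b) (bar P s a)"
proof -
  let ?a = "val P 1 s [(0, FBox a 1)]"
    and ?b = "val P 1 s [(0, FBox b 1)]"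
  have "bar P s (pa_mult P 1 s ?a ?b) =
      pa_mult P 1 (opp s) (bar P s ?b) (bar P s ?a)"
    by (simp add: flat del: One_nat_def, rule val_isotopic[where ps = "[]" and qs = "[2, 1, 0, 3, 2, 1, 4, 3, 2]"])
      (simp del: One_nat_def, simp del: One_nat_def, simp add: eval_nat_numeral)
  then show ?thesis by (simp add: val_box del: One_nat_def)
qed

lemma bar_bar:
  assumes [simp]: "y \<in> box_space P 1 s"
  shows "bar P (opp s) (bar P s y) =
    y"
proof -
  let ?y = "val P 1 s [(0, FBox y 1)]"
  \<comment> \<open>The inner half turn is drawn opposite to the outer one. The two then cancel by
    zigzags; drawn in the same direction they would add up to a full turn.\<close>
  have "bar P (opp s) (val P 1 (opp s) [(0, FCup), (1, FBox y 1), (1, FCap)]) =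
      ?y"
    by (simp add: flat del: One_nat_def, rule val_isotopic[where ps = "[0, 1, 2, 1, 0]" and qs = "[]"])
      (simp del: One_nat_def, simp del: One_nat_def, simp add: eval_nat_numeral)
  then show ?thesis by (simp add: val_box bar_turn del: One_nat_def)
qed

lemma conv_left_assoc:
  assumes [simp]: "y \<in> box_space P 1 s" "u \<in> box_space P 2 (opp s)" "w \<in> box_space P 2 (opp s)"
  shows "conv_left P s (conv_left P s y u) w =
    conv_left P s y (conv P (opp s) u w)"
proof -
  let ?y = "val P 1 s [(0, FBox y 1)]"
    and ?u = "val P 2 (opp s) [(0, FBox u 2)]"
    and ?w = "val P 2 (opp s) [(0, FBox w 2)]"
  have "conv_left P s (conv_left P s ?y ?u) ?w =
      conv_left P s ?y (conv P (opp s) ?u ?w)"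
    by (simp add: flat del: One_nat_def, rule val_isotopic[where ps = "[4, 5]" and qs = "[1, 0]"])
      (simp del: One_nat_def, simp del: One_nat_def, simp add: eval_nat_numeral)
  then show ?thesis by (simp add: val_box del: One_nat_def)
qed

lemma conv_left_bar_mult:
  assumes [simp]: "v \<in> box_space P 1 s" "a \<in> box_space P 1 s" "u \<in> box_space P 2 (opp s)"
  shows "conv_left P s v (pa_mult P 2 (opp s) (juxtapose P (opp s) (bar P s a) (pa_one P 1 s)) u) =
    conv_left P s (pa_mult P 1 s a v) u"
proof -
  let ?v = "val P 1 s [(0, FBox v 1)]"
    and ?a = "val P 1 s [(0, FBox a 1)]"
    and ?u = "val P 2 (opp s) [(0, FBox u 2)]"
  have "conv_left P s ?v (pa_mult P 2 (opp s) (juxtapose P (opp s) (bar P s ?a) (pa_one P 1 s)) ?u) =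
      conv_left P s (pa_mult P 1 s ?a ?v) ?u"
    by (simp add: flat del: One_nat_def, rule val_isotopic[where ps = "[1, 0, 2, 1, 3, 2]" and qs = "[]"])
      (simp del: One_nat_def, simp del: One_nat_def, simp add: eval_nat_numeral)
  then show ?thesis by (simp add: val_box del: One_nat_def)
qed

lemma conv_left_mult_bar:
  assumes [simp]: "v \<in> box_space P 1 s" "a \<in> box_space P 1 s" "u \<in> box_space P 2 (opp s)"
  shows "conv_left P s v (pa_mult P 2 (opp s) u (juxtapose P (opp s) (bar P s a) (pa_one P 1 s))) =
    conv_left P s (pa_mult P 1 s v a) u"
proof -
  let ?v = "val P 1 s [(0, FBox v 1)]"
    and ?a = "val P 1 s [(0, FBox a 1)]"
    and ?u = "val P 2 (opp s) [(0, FBox u 2)]"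
  have "conv_left P s ?v (pa_mult P 2 (opp s) ?u (juxtapose P (opp s) (val P 1 (opp s) [(0, FCup), (1, FBox a 1), (1, FCap)]) (pa_one P 1 s))) =
      conv_left P s (pa_mult P 1 s ?v ?a) ?u"
    by (simp add: flat del: One_nat_def, rule val_isotopic[where ps = "[5, 4, 3]" and qs = "[2]"])
      (simp del: One_nat_def, simp del: One_nat_def, simp add: eval_nat_numeral)
  then show ?thesis by (simp add: val_box bar_turn del: One_nat_def)
qed

lemma conv_left_right_mult:
  assumes [simp]: "v \<in> box_space P 1 s" "a \<in> box_space P 1 s" "u \<in> box_space P 2 (opp s)"
  shows "conv_left P s v (pa_mult P 2 (opp s) (juxtapose P (opp s) (pa_one P 1 (opp s)) a) u) =
    pa_mult P 1 s a (conv_left P s v u)"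
proof -
  let ?v = "val P 1 s [(0, FBox v 1)]"
    and ?a = "val P 1 s [(0, FBox a 1)]"
    and ?u = "val P 2 (opp s) [(0, FBox u 2)]"
  have "conv_left P s ?v (pa_mult P 2 (opp s) (juxtapose P (opp s) (pa_one P 1 (opp s)) ?a) ?u) =
      pa_mult P 1 s ?a (conv_left P s ?v ?u)"
    by (simp add: flat del: One_nat_def, rule val_isotopic[where ps = "[1]" and qs = "[0]"])
      (simp del: One_nat_def, simp del: One_nat_def, simp add: eval_nat_numeral)
  then show ?thesis by (simp add: val_box del: One_nat_def)
qed

lemma conv_left_mult_right:
  assumes [simp]: "v \<in> box_space P 1 s" "a \<in> box_space P 1 s" "u \<in> box_space P 2 (opp s)"
  shows "conv_left P s v (pa_mult P 2 (opp s) u (juxtapose P (opp s) (pa_one P 1 (opp s)) a)) =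
    pa_mult P 1 s (conv_left P s v u) a"
proof -
  let ?v = "val P 1 s [(0, FBox v 1)]"
    and ?a = "val P 1 s [(0, FBox a 1)]"
    and ?u = "val P 2 (opp s) [(0, FBox u 2)]"
  have "conv_left P s ?v (pa_mult P 2 (opp s) ?u (juxtapose P (opp s) (pa_one P 1 (opp s)) ?a)) =
      pa_mult P 1 s (conv_left P s ?v ?u) ?a"
    by (simp add: flat del: One_nat_def, rule val_isotopic[where ps = "[3]" and qs = "[]"])
      (simp del: One_nat_def, simp del: One_nat_def, simp add: eval_nat_numeral)
  then show ?thesis by (simp add: val_box del: One_nat_def)
qed

lemma fourier_mult_bar:
  assumes [simp]: "x \<in> box_space P 2 s" "y \<in> box_space P 1 s"
  shows "fourier P s (pa_mult P 2 s x (juxtapose P s (pa_one P 1 s) (bar P s y))) =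
    pa_mult P 2 (opp s) (juxtapose P (opp s) (pa_one P 1 (opp s)) y) (fourier P s x)"
proof -
  let ?x = "val P 2 s [(0, FBox x 2)]"
    and ?y = "val P 1 s [(0, FBox y 1)]"
  have "fourier P s (pa_mult P 2 s ?x (juxtapose P s (pa_one P 1 s) (bar P s ?y))) =
      pa_mult P 2 (opp s) (juxtapose P (opp s) (pa_one P 1 (opp s)) ?y) (fourier P s ?x)"
    by (simp add: flat del: One_nat_def, rule val_isotopic[where ps = "[4, 3, 2]" and qs = "[0, 1]"])
      (simp del: One_nat_def, simp del: One_nat_def, simp add: eval_nat_numeral)
  then show ?thesis by (simp add: val_box del: One_nat_def)
qed

lemma fourier_bar_mult:
  assumes [simp]: "x \<in> box_space P 2 s" "y \<in> box_space P 1 s"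
  shows "fourier P s (pa_mult P 2 s (juxtapose P s (pa_one P 1 s) (bar P s y)) x) =
    pa_mult P 2 (opp s) (juxtapose P (opp s) (bar P s y) (pa_one P 1 s)) (fourier P s x)"
proof -
  let ?x = "val P 2 s [(0, FBox x 2)]"
    and ?y = "val P 1 s [(0, FBox y 1)]"
  have "fourier P s (pa_mult P 2 s (juxtapose P s (pa_one P 1 s) (bar P s ?y)) ?x) =
      pa_mult P 2 (opp s) (juxtapose P (opp s) (bar P s ?y) (pa_one P 1 s)) (fourier P s ?x)"
    by (simp add: flat del: One_nat_def, rule val_isotopic[where ps = "[0, 1, 2]" and qs = "[]"])
      (simp del: One_nat_def, simp del: One_nat_def, simp add: eval_nat_numeral)
  then show ?thesis by (simp add: val_box del: One_nat_def)
qed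

lemma fourier_mult_left:
  assumes [simp]: "x \<in> box_space P 2 s" "y \<in> box_space P 1 s"
  shows "fourier P s (pa_mult P 2 s x (juxtapose P s y (pa_one P 1 (opp s)))) =
    pa_mult P 2 (opp s) (fourier P s x) (juxtapose P (opp s) (pa_one P 1 (opp s)) y)"
proof -
  let ?x = "val P 2 s [(0, FBox x 2)]"
    and ?y = "val P 1 s [(0, FBox y 1)]"
  have "fourier P s (pa_mult P 2 s ?x (juxtapose P s ?y (pa_one P 1 (opp s)))) =
      pa_mult P 2 (opp s) (fourier P s ?x) (juxtapose P (opp s) (pa_one P 1 (opp s)) ?y)"
    by (simp add: flat del: One_nat_def, rule val_isotopic[where ps = "[2]" and qs = "[]"])
      (simp del: One_nat_def, simp del: One_nat_def, simp add: eval_nat_numeral)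
  then show ?thesis by (simp add: val_box del: One_nat_def)
qed

lemma fourier_left_mult:
  assumes [simp]: "x \<in> box_space P 2 s" "y \<in> box_space P 1 s"
  shows "fourier P s (pa_mult P 2 s (juxtapose P s y (pa_one P 1 (opp s))) x) =
    pa_mult P 2 (opp s) (fourier P s x) (juxtapose P (opp s) (bar P s y) (pa_one P 1 s))"
proof -
  let ?x = "val P 2 s [(0, FBox x 2)]"
    and ?y = "val P 1 s [(0, FBox y 1)]"
  have "fourier P s (pa_mult P 2 s (juxtapose P s ?y (pa_one P 1 (opp s))) ?x) =
      pa_mult P 2 (opp s) (fourier P s ?x) (juxtapose P (opp s) (val P 1 (opp s) [(0, FCup), (1, FBox y 1), (1, FCap)]) (pa_one P 1 s))"
    by (simp add: flat del: One_nat_def, rule val_isotopic[where ps = "[]" and qs = "[2, 1, 0, 3, 2, 1, 4, 3, 2]"])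
      (simp del: One_nat_def, simp del: One_nat_def, simp add: eval_nat_numeral)
  then show ?thesis by (simp add: val_box bar_turn del: One_nat_def)
qed

lemma fourier_inv_fourier:
  assumes [simp]: "x \<in> box_space P 2 s"
  shows "fourier_inv (opp s) (fourier P s x) =
    x"
proof -
  let ?x = "val P 2 s [(0, FBox x 2)]"
  have "fourier_inv (opp s) (fourier P s ?x) =
      ?x"
    by (simp add: flat del: One_nat_def, rule val_isotopic[where ps = "[0, 1, 2, 1, 0]" and qs = "[]"])
      (simp del: One_nat_def, simp del: One_nat_def, simp add: eval_nat_numeral)
  then show ?thesis by (simp add: val_box del: One_nat_def)
qed

text \<open>Convolution by \<open>u\<close> from the left and from the right are transposes of each
  other for the pairing of \<open>y\<close> and \<open>z\<close> by the closure of \<open>y\<close>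
  times the rotation of \<open>z\<close>. This carries the right eigenvector over to a functional on
  the left.\<close>

lemma closure_conv_left:
  assumes [simp]: "y \<in> box_space P 1 s" "u \<in> box_space P 2 (opp s)" "z \<in> box_space P 1 (opp s)"
  shows "pa_closure P 1 s (pa_mult P 1 s (conv_left P s y u) (bar P (opp s) z)) =
    pa_closure P 1 s (pa_mult P 1 s y (bar P (opp s) (conv_right P (opp s) u z)))"
proof -
  let ?y = "val P 1 s [(0, FBox y 1)]"
    and ?u = "val P 2 (opp s) [(0, FBox u 2)]"
    and ?z = "val P 1 (opp s) [(0, FBox z 1)]"
  have "pa_closure P 1 s (pa_mult P 1 s (conv_left P s ?y ?u) (bar P (opp s) ?z)) =
      pa_closure P 1 s (pa_mult P 1 s ?y (bar P (opp s) (conv_right P (opp s) ?u ?z)))"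
    by (simp add: flat del: One_nat_def, rule val_isotopic[where ps = "[0, 1, 7, 6, 5, 4, 5]" and qs = "[7, 6, 5, 4, 3, 2]"])
      (simp del: One_nat_def, simp del: One_nat_def, simp add: eval_nat_numeral)
  then show ?thesis by (simp add: val_box del: One_nat_def)
qed

text \<open>For \<open>d = adj P c\<close> the second factor on the right is the adjoint of the
  first. Positivity and faithfulness of convolution both come from this identity.\<close>

lemma closure_conv_left_one:
  assumes [simp]: "c \<in> box_space P 2 (opp s)" "d \<in> box_space P 2 (opp s)"
  shows "pa_closure P 1 s (conv_left P s (pa_one P 1 s) (pa_mult P 2 (opp s) c d)) =
    pa_closure P 2 s (pa_mult P 2 s (fourier P (opp s) c) (fourier_inv (opp s) d))"
proof -
  let ?c = "val P 2 (opp s) [(0, FBox c 2)]"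
    and ?d = "val P 2 (opp s) [(0, FBox d 2)]"
  have "pa_closure P 1 s (conv_left P s (pa_one P 1 s) (pa_mult P 2 (opp s) ?c ?d)) =
      pa_closure P 2 s (pa_mult P 2 s (fourier P (opp s) ?c) (fourier_inv (opp s) ?d))"
    by (simp add: flat del: One_nat_def, rule val_isotopic[where ps = "[]" and qs = "[1, 2, 3, 5, 4, 3]"])
      (simp del: One_nat_def, simp del: One_nat_def, simp add: eval_nat_numeral)
  then show ?thesis by (simp add: val_box del: One_nat_def)
qed

end

section \<open>Traced finite-dimensional C*-algebras\<close>

locale traced_cstar =
  fixes scl :: "complex \<Rightarrow> 'a::real_normed_vector \<Rightarrow> 'a" (infixr "*\<^sub>C" 75)
    and A :: "'a set" and mul :: "'a \<Rightarrow> 'a \<Rightarrow> 'a" (infixl "\<cdot>" 70)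
    and e :: 'a and star :: "'a \<Rightarrow> 'a" and tr :: "'a \<Rightarrow> complex"
  assumes vs: "vector_space scl" and sub: "module.subspace scl A"
    and alg: "findim_cstar_algebra scl A mul e star"
    and scl_real: "complex_of_real c *\<^sub>C x = c *\<^sub>R x"
    and tr_add: "x \<in> A \<Longrightarrow> y \<in> A \<Longrightarrow> tr (x + y) = tr x + tr y"
    and tr_scl: "x \<in> A \<Longrightarrow> tr (c *\<^sub>C x) = c * tr x"
    and tr_mul: "x \<in> A \<Longrightarrow> y \<in> A \<Longrightarrow> tr (x \<cdot> y) = tr (y \<cdot> x)"
    and tr_pos: "x \<in> A \<Longrightarrow> \<exists>t\<ge>0. tr (star x \<cdot> x) = complex_of_real t"
    and tr_faithful: "x \<in> A \<Longrightarrow> tr (star x \<cdot> x) = 0 \<Longrightarrow> x = 0"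
begin

sublocale V: vector_space scl by (rule vs)

lemma zero_in [simp]: "0 \<in> A" and add_in [simp]: "x \<in> A \<Longrightarrow> y \<in> A \<Longrightarrow> x + y \<in> A"
  and scl_in [simp]: "x \<in> A \<Longrightarrow> c *\<^sub>C x \<in> A" and diff_in [simp]: "x \<in> A \<Longrightarrow> y \<in> A \<Longrightarrow> x - y \<in> A"
  and uminus_in [simp]: "x \<in> A \<Longrightarrow> - x \<in> A"
  and sum_in [simp]: "(\<And>i. i \<in> S \<Longrightarrow> f i \<in> A) \<Longrightarrow> sum f S \<in> A"
  using sub V.subspace_0 V.subspace_add V.subspace_scale V.subspace_diff V.subspace_neg V.subspace_sum
  by metis+

lemma scaleR_in [simp]: "x \<in> A \<Longrightarrow> r *\<^sub>R x \<in> A"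
  by (metis scl_real scl_in)

lemma e_in [simp]: "e \<in> A" and e_mul [simp]: "x \<in> A \<Longrightarrow> e \<cdot> x = x" "x \<in> A \<Longrightarrow> x \<cdot> e = x"
  and mul_in [simp]: "x \<in> A \<Longrightarrow> y \<in> A \<Longrightarrow> x \<cdot> y \<in> A"
  and mul_assoc: "x \<in> A \<Longrightarrow> y \<in> A \<Longrightarrow> z \<in> A \<Longrightarrow> x \<cdot> y \<cdot> z = x \<cdot> (y \<cdot> z)"
  and add_mul: "x \<in> A \<Longrightarrow> y \<in> A \<Longrightarrow> z \<in> A \<Longrightarrow> (x + y) \<cdot> z = x \<cdot> z + y \<cdot> z"
  and mul_add: "x \<in> A \<Longrightarrow> y \<in> A \<Longrightarrow> z \<in> A \<Longrightarrow> x \<cdot> (y + z) = x \<cdot> y + x \<cdot> z"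
  and scl_mul [simp]: "x \<in> A \<Longrightarrow> y \<in> A \<Longrightarrow> (c *\<^sub>C x) \<cdot> y = c *\<^sub>C (x \<cdot> y)"
  and mul_scl [simp]: "x \<in> A \<Longrightarrow> y \<in> A \<Longrightarrow> x \<cdot> (c *\<^sub>C y) = c *\<^sub>C (x \<cdot> y)"
  using alg unfolding findim_cstar_algebra_def by simp_all

lemma star_in [simp]: "x \<in> A \<Longrightarrow> star x \<in> A" and star_star [simp]: "x \<in> A \<Longrightarrow> star (star x) = x"
  and star_add: "x \<in> A \<Longrightarrow> y \<in> A \<Longrightarrow> star (x + y) = star x + star y"
  and star_scl: "x \<in> A \<Longrightarrow> star (c *\<^sub>C x) = cnj c *\<^sub>C star x"
  and star_mul: "x \<in> A \<Longrightarrow> y \<in> A \<Longrightarrow> star (x \<cdot> y) = star y \<cdot> star x"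
  and norm_mul: "x \<in> A \<Longrightarrow> y \<in> A \<Longrightarrow> norm (x \<cdot> y) \<le> norm x * norm y"
  and cstar: "x \<in> A \<Longrightarrow> norm (star x \<cdot> x) = (norm x)\<^sup>2"
  and norm_scl: "x \<in> A \<Longrightarrow> norm (c *\<^sub>C x) = cmod c * norm x"
  using alg unfolding findim_cstar_algebra_def by simp_all

lemma fin_dim: "\<exists>B. finite B \<and> A = V.span B"
  using alg unfolding findim_cstar_algebra_def by blast

lemma zero_mul [simp]: "x \<in> A \<Longrightarrow> 0 \<cdot> x = 0" and mul_zero [simp]: "x \<in> A \<Longrightarrow> x \<cdot> 0 = 0"
  using scl_mul[of 0 x 0] mul_scl[of x 0 0] by auto

lemma minus_mul: "x \<in> A \<Longrightarrow> y \<in> A \<Longrightarrow> (- x) \<cdot> y = - (x \<cdot> y)"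
  and mul_minus: "x \<in> A \<Longrightarrow> y \<in> A \<Longrightarrow> x \<cdot> (- y) = - (x \<cdot> y)"
  using scl_mul[of x y "-1"] mul_scl[of x y "-1"] by auto

lemma diff_mul: "x \<in> A \<Longrightarrow> y \<in> A \<Longrightarrow> z \<in> A \<Longrightarrow> (x - y) \<cdot> z = x \<cdot> z - y \<cdot> z"
  and mul_diff: "x \<in> A \<Longrightarrow> y \<in> A \<Longrightarrow> z \<in> A \<Longrightarrow> x \<cdot> (y - z) = x \<cdot> y - x \<cdot> z"
  using add_mul[of x "- y" z] mul_add[of x y "- z"] by (auto simp: minus_mul mul_minus)

lemma scaleR_mul [simp]: "x \<in> A \<Longrightarrow> y \<in> A \<Longrightarrow> (r *\<^sub>R x) \<cdot> y = r *\<^sub>R (x \<cdot> y)"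
  and mul_scaleR [simp]: "x \<in> A \<Longrightarrow> y \<in> A \<Longrightarrow> x \<cdot> (r *\<^sub>R y) = r *\<^sub>R (x \<cdot> y)"
  using scl_mul[of x y "of_real r"] mul_scl[of x y "of_real r"] by (auto simp: scl_real)

lemma star_scaleR: "x \<in> A \<Longrightarrow> star (r *\<^sub>R x) = r *\<^sub>R star x"
  using star_scl[of x "of_real r"] by (auto simp: scl_real)

lemma star_minus: "x \<in> A \<Longrightarrow> star (- x) = - star x"
  using star_scl[of x "-1"] by auto

lemma star_diff: "x \<in> A \<Longrightarrow> y \<in> A \<Longrightarrow> star (x - y) = star x - star y"
  using star_add[of x "- y"] by (auto simp: star_minus)

lemma star_0 [simp]: "star 0 = 0"
  using star_scl[of 0 0] by simp

lemma star_e [simp]: "star e = e"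
  by (metis e_in e_mul star_in star_mul star_star)

lemma sum_mul: "(\<And>i. i \<in> S \<Longrightarrow> f i \<in> A) \<Longrightarrow> y \<in> A \<Longrightarrow> sum f S \<cdot> y = (\<Sum>i\<in>S. f i \<cdot> y)"
  by (induction S rule: infinite_finite_induct) (auto simp: add_mul)

lemma mul_sum: "(\<And>i. i \<in> S \<Longrightarrow> f i \<in> A) \<Longrightarrow> y \<in> A \<Longrightarrow> y \<cdot> sum f S = (\<Sum>i\<in>S. y \<cdot> f i)"
  by (induction S rule: infinite_finite_induct) (auto simp: mul_add)

lemma star_sum: "(\<And>i. i \<in> S \<Longrightarrow> f i \<in> A) \<Longrightarrow> star (sum f S) = (\<Sum>i\<in>S. star (f i))"
  by (induction S rule: infinite_finite_induct) (auto simp: star_add)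

lemma tr_0 [simp]: "tr 0 = 0"
  using tr_scl[of 0 0] by simp

lemma tr_minus: "x \<in> A \<Longrightarrow> tr (- x) = - tr x"
  using tr_scl[of x "-1"] by simp

lemma tr_diff: "x \<in> A \<Longrightarrow> y \<in> A \<Longrightarrow> tr (x - y) = tr x - tr y"
  using tr_add[of x "- y"] by (simp add: tr_minus)

lemma tr_scaleR: "x \<in> A \<Longrightarrow> tr (r *\<^sub>R x) = r *\<^sub>R tr x"
  using tr_scl[of x "of_real r"] by (auto simp: scl_real scaleR_conv_of_real)

lemma star_mul_self_eq_0: "x \<in> A \<Longrightarrow> star x \<cdot> x = 0 \<Longrightarrow> x = 0"
  using cstar[of x] by simp

lemma norm_star: assumes x: "x \<in> A" shows "norm (star x) = norm x"
proof -
  have *: "norm y \<le> norm (star y)" if "y \<in> A" for y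
    using cstar[OF that] norm_mul[of "star y" y] that
    by (cases "norm y = 0") (auto simp: power2_eq_square)
  show ?thesis using *[OF x] *[of "star x"] x by simp
qed

text \<open>The relation is one of the family, not of its range: if \<open>v\<close> repeats a
  value, the difference of two equal terms serves.\<close>

lemma linear_dependence:
  assumes v: "\<And>i::nat. v i \<in> A"
  obtains n c where "\<exists>i\<le>n. c i \<noteq> 0" "(\<Sum>i\<le>n. c i *\<^sub>C v i) = 0"
proof -
  obtain B where B: "finite B" "A = V.span B" using fin_dim by blast
  let ?n = "card B"
  show ?thesis
  proof (cases "inj_on v {..?n}")
    case True
    then have c: "card (v ` {..?n}) = Suc ?n" by (simp add: card_image)
    have "V.dependent (v ` {..?n})"
      using V.independent_span_bound[OF B(1), of "v ` {..?n}"] v B(2) c by fastforce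
    then obtain u where u: "\<exists>x\<in>v ` {..?n}. u x \<noteq> 0" "(\<Sum>x\<in>v ` {..?n}. u x *\<^sub>C x) = 0"
      using V.dependent_finite[of "v ` {..?n}"] by blast
    show ?thesis
      using u True by (intro that[of ?n "u \<circ> v"]) (auto simp: sum.reindex)
  next
    case False
    then obtain i j where ij: "i \<le> ?n" "j \<le> ?n" "i \<noteq> j" "v i = v j" by (auto simp: inj_on_def)
    let ?c = "\<lambda>k. if k = i then 1 else if k = j then -1 else 0"
    have "(\<Sum>k\<le>?n. ?c k *\<^sub>C v k) = (\<Sum>k\<in>{i, j}. ?c k *\<^sub>C v k)"
      by (rule sum.mono_neutral_right) (use ij in auto)
    also have "\<dots> = 0" using ij by simp
    finally show ?thesis using ij by (intro that[of ?n ?c]) auto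
  qed
qed

section \<open>Polynomial calculus and spectral resolutions\<close>

definition ev :: "'a \<Rightarrow> complex poly \<Rightarrow> 'a" where
  "ev a p = fold_coeffs (\<lambda>c x. c *\<^sub>C e + a \<cdot> x) p 0"

lemma ev_0 [simp]: "ev a 0 = 0"
  by (simp add: ev_def)

lemma ev_pCons [simp]: "a \<in> A \<Longrightarrow> ev a (pCons c p) = c *\<^sub>C e + a \<cdot> ev a p"
  by (cases "p = 0 \<and> c = 0") (auto simp: ev_def)

lemma ev_in [simp]: "a \<in> A \<Longrightarrow> ev a p \<in> A"
  by (induction p) auto

lemma ev_add: "a \<in> A \<Longrightarrow> ev a (p + q) = ev a p + ev a q"
  by (induction p q rule: poly_induct2) (auto simp: mul_add V.scale_left_distrib)

lemma ev_smult: "a \<in> A \<Longrightarrow> ev a (smult c p) = c *\<^sub>C ev a p"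
  by (induction p) (auto simp: V.scale_right_distrib)

lemma ev_mult: "a \<in> A \<Longrightarrow> ev a (p * q) = ev a p \<cdot> ev a q"
  by (induction p) (auto simp: ev_add ev_smult add_mul mul_assoc)

lemma ev_sum: "a \<in> A \<Longrightarrow> ev a (sum f S) = (\<Sum>i\<in>S. ev a (f i))"
  by (induction S rule: infinite_finite_induct) (auto simp: ev_add)

lemma ev_commute: "a \<in> A \<Longrightarrow> ev a p \<cdot> ev a q = ev a q \<cdot> ev a p"
  by (metis ev_mult mult.commute)

lemma ev_eigen:
  assumes "a \<in> A" "c \<in> A" "a \<cdot> c = l *\<^sub>C c"
  shows "ev a p \<cdot> c = poly p l *\<^sub>C c"
proof (induction p)
  case (pCons k p)
  then show ?case using assms by (simp add: add_mul mul_assoc V.scale_left_distrib mult.commute)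
qed (use assms in auto)

lemma ev_annihilator:
  assumes "a \<in> A"
  obtains q where "q \<noteq> 0" "ev a q = 0"
proof -
  obtain n c where nc: "\<exists>i\<le>n. c i \<noteq> 0" "(\<Sum>i\<le>n. c i *\<^sub>C ev a (monom 1 i)) = 0"
    using linear_dependence[of "\<lambda>i. ev a (monom 1 i)"] assms by auto
  let ?q = "\<Sum>i\<le>n. smult (c i) (monom 1 i)"
  obtain i where i: "i \<le> n" "c i \<noteq> 0" using nc by blast
  have "coeff ?q i = (\<Sum>j\<le>n. if j = i then c j else 0)"
    unfolding coeff_sum by (intro sum.cong) auto
  then have "coeff ?q i = c i" using i by simp
  then show ?thesis using nc i assms by (intro that[of ?q]) (auto simp: ev_sum ev_smult)
qed

lemma sa_eigenvalue_real:
  assumes a: "a \<in> A" "star a = a" and c: "c \<in> A" "c \<noteq> 0" "a \<cdot> c = l *\<^sub>C c"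
  shows "complex_of_real (Re l) = l"
proof -
  have eq: "star c \<cdot> (a \<cdot> c) = l *\<^sub>C (star c \<cdot> c)" using c by simp
  have "star (star c \<cdot> (a \<cdot> c)) = star c \<cdot> (a \<cdot> c)" using a c(1) by (simp add: star_mul mul_assoc)
  moreover have "star (l *\<^sub>C (star c \<cdot> c)) = cnj l *\<^sub>C (star c \<cdot> c)"
    using c by (subst star_scl) (simp_all add: star_mul)
  ultimately have "l *\<^sub>C (star c \<cdot> c) = cnj l *\<^sub>C (star c \<cdot> c)" using eq by metis
  moreover have "star c \<cdot> c \<noteq> 0" using c star_mul_self_eq_0 by blast
  ultimately have "l = cnj l" using V.scale_right_imp_eq by blast
  then show ?thesis by (metis Reals_cnj_iff of_real_Re)
qed

lemma sa_square_eq_0: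
  assumes "x \<in> A" "star x = x" "c \<in> A" "x \<cdot> (x \<cdot> c) = 0"
  shows "x \<cdot> c = 0"
proof (rule star_mul_self_eq_0)
  show "star (x \<cdot> c) \<cdot> (x \<cdot> c) = 0" using assms by (simp add: star_mul mul_assoc)
qed (use assms in auto)

text \<open>The projections are nonzero so that every index is an eigenvalue and inherits bounds
  from \<open>a\<close>.\<close>

definition spectral :: "'a \<Rightarrow> real set \<Rightarrow> (real \<Rightarrow> 'a) \<Rightarrow> bool" where
  "spectral a I E \<longleftrightarrow> finite I \<and> (\<forall>l\<in>I. E l \<in> A \<and> star (E l) = E l \<and> E l \<noteq> 0) \<and>
     (\<forall>l\<in>I. \<forall>m\<in>I. E l \<cdot> E m = (if l = m then E l else 0)) \<and>
     sum E I = e \<and> a = (\<Sum>l\<in>I. l *\<^sub>R E l)"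

text \<open>A real root of the minimal polynomial is simple, because \<open>sa_square_eq_0\<close>
  would remove a repeated factor. Dividing the root out and normalizing gives the polynomial whose
  value at \<open>a\<close> is the eigenprojection.\<close>

lemma spectral_exists:
  assumes a: "a \<in> A" "star a = a"
  shows "\<exists>I E. spectral a I E"
proof -
  obtain q0 where q0: "q0 \<noteq> 0" "ev a q0 = 0" using ev_annihilator a by blast
  obtain q where q: "q \<noteq> 0" "ev a q = 0"
    and qmin: "\<And>g. g \<noteq> 0 \<Longrightarrow> ev a g = 0 \<Longrightarrow> degree q \<le> degree g"
    using ex_has_least_nat[of "\<lambda>q. q \<noteq> 0 \<and> ev a q = 0" q0 degree] q0 by blast
  have lin: "ev a [:-l, 1:] = a - l *\<^sub>C e" for l using a by simp
  have fac: "\<exists>g'. g = [:-l, 1:] * g' \<and> g' \<noteq> 0 \<and> degree g' < degree g"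
    if "g \<noteq> 0" "poly g l = 0" for g :: "complex poly" and l
  proof -
    obtain g' where g': "g = [:-l, 1:] * g'" using \<open>poly g l = 0\<close> unfolding poly_eq_0_iff_dvd by (elim dvdE)
    with that have "g' \<noteq> 0" by auto
    moreover have "degree g = degree [:-l, 1:] + degree g'"
      unfolding g' by (rule degree_mult_eq) (use \<open>g' \<noteq> 0\<close> in auto)
    ultimately show ?thesis using g' by auto
  qed
  \<comment> \<open>Only real roots are collected; that they account for everything is the content
    of \<open>sum E I = e\<close> below.\<close>
  define I where "I = {l::real. poly q (of_real l) = 0}"
  have "finite (complex_of_real -` {z. poly q z = 0})"
    using q by (intro finite_vimageI poly_roots_finite inj_of_real)
  then have fin: "finite I" by (simp add: I_def vimage_def)
  have "\<exists>g. q = [:-of_real l, 1:] * g \<and> g \<noteq> 0 \<and> degree g < degree q" if "l \<in> I" for l :: real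
    using fac[of q "of_real l"] that q by (auto simp: I_def)
  then obtain d where d: "\<And>l::real. l \<in> I \<Longrightarrow>
      q = [:-of_real l, 1:] * d l \<and> d l \<noteq> 0 \<and> degree (d l) < degree q" by metis
  have evd: "ev a (d l) \<noteq> 0" if "l \<in> I" for l
    using d[OF that] qmin[of "d l"] by (auto simp: not_less)
  have ad: "a \<cdot> ev a (d l) = of_real l *\<^sub>C ev a (d l)" if "l \<in> I" for l
  proof -
    have "0 = ev a [:-of_real l, 1:] \<cdot> ev a (d l)"
      using d[OF that] q(2) a ev_mult by metis
    then show ?thesis unfolding lin using a by (simp add: diff_mul)
  qed
  have dl: "poly (d l) (of_real l) \<noteq> 0" if l: "l \<in> I" for l
  proof
    assume "poly (d l) (of_real l) = 0"
    then obtain g where g: "d l = [:-of_real l, 1:] * g" using fac[of "d l" "of_real l"] d[OF l] by blast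
    let ?x = "a - complex_of_real l *\<^sub>C e"
    have "ev a (d l) = ?x \<cdot> ev a g" using g a by (metis lin ev_mult)
    moreover have "?x \<cdot> ev a (d l) = 0" using ad[OF l] a by (simp add: diff_mul)
    moreover have "star ?x = ?x" using a by (simp add: star_diff star_scl)
    ultimately have "ev a (d l) = 0" using sa_square_eq_0[of ?x "ev a g"] a by auto
    then show False using evd[OF l] by simp
  qed
  \<comment> \<open>Lagrange interpolation: the normalized polynomial is 1 at \<open>l\<close> and 0
    at the other roots.\<close>
  define E where "E l = inverse (poly (d l) (of_real l)) *\<^sub>C ev a (d l)" for l
  have E_in: "E l \<in> A" for l using a by (simp add: E_def)
  have aE: "a \<cdot> E l = of_real l *\<^sub>C E l" if "l \<in> I" for l
    using ad[OF that] a by (simp add: E_def mult.commute)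
  have evE: "ev a g \<cdot> E l = poly g (of_real l) *\<^sub>C E l" if "l \<in> I" for g l
    using ev_eigen aE[OF that] E_in a by blast
  have E_id: "E l \<cdot> c = c" if l: "l \<in> I" and c: "c \<in> A" "a \<cdot> c = of_real l *\<^sub>C c" for l c
    using ev_eigen[OF a(1) c, of "d l"] dl[OF l] a c by (simp add: E_def)
  have EE: "E l \<cdot> E m = (if l = m then E l else 0)" if l: "l \<in> I" and m: "m \<in> I" for l m
  proof (cases "l = m")
    case True then show ?thesis using E_id[OF l E_in aE[OF l]] by simp
  next
    case False
    have "poly q (of_real m) = (of_real m - of_real l) * poly (d l) (of_real m)"
      using d[OF l] by (metis mult_1 poly_mult poly_pCons poly_0 add.commute mult_zero_right add_0 uminus_add_conv_diff mult.commute)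
    then have "poly (d l) (of_real m) = 0" using m False by (auto simp: I_def)
    then show ?thesis using evE[OF m, of "d l"] dl[OF m] False a E_in by (simp add: E_def)
  qed
  have Es: "star (E l) = E l" if l: "l \<in> I" for l
  proof -
    have sa: "star (E l) \<cdot> a = of_real l *\<^sub>C star (E l)"
      using aE[OF l] a E_in by (metis complex_cnj_complex_of_real star_mul star_scl)
    have "star (E l) \<cdot> ev a g = poly g (of_real l) *\<^sub>C star (E l)" for g
    proof (induction g)
      case (pCons k g)
      have "star (E l) \<cdot> (a \<cdot> ev a g) = of_real l *\<^sub>C (star (E l) \<cdot> ev a g)"
        using sa a E_in mul_assoc[of "star (E l)" a "ev a g"] by simp
      then show ?case using pCons a E_in by (simp add: mul_add V.scale_left_distrib)
    qed (use E_in in auto)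
    \<comment> \<open>The left side is self-adjoint, hence so is \<open>star (E l)\<close>.\<close>
    then have eq: "star (E l) \<cdot> E l = star (E l)" using dl[OF l] a E_in by (simp add: E_def)
    have "star (star (E l) \<cdot> E l) = star (E l) \<cdot> E l" using E_in by (simp add: star_mul)
    then show ?thesis using eq E_in by simp
  qed
  have sumE: "sum E I = e"
  proof (rule ccontr)
    assume ne: "sum E I \<noteq> e"
    \<comment> \<open>Every \<open>E l\<close> kills the remainder \<open>x\<close>. A polynomial of
      least degree annihilating \<open>x\<close> would nevertheless produce an eigenvector of the
      form \<open>ev a h \<cdot> x\<close>, which some \<open>E l\<close> fixes.\<close>
    define x where "x = e - sum E I"
    have x: "x \<in> A" "x \<noteq> 0" using ne E_in by (auto simp: x_def)
    have Ex: "E l \<cdot> x = 0" if l: "l \<in> I" for l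
    proof -
      have "E l \<cdot> sum E I = (\<Sum>m\<in>I. E l \<cdot> E m)" using E_in by (simp add: mul_sum)
      also have "\<dots> = (\<Sum>m\<in>I. if l = m then E l else 0)" using EE l by (intro sum.cong) auto
      finally show ?thesis using l fin E_in by (simp add: x_def mul_diff)
    qed
    obtain g where g: "g \<noteq> 0" "ev a g \<cdot> x = 0"
      and gmin: "\<And>h. h \<noteq> 0 \<Longrightarrow> ev a h \<cdot> x = 0 \<Longrightarrow> degree g \<le> degree h"
      using ex_has_least_nat[of "\<lambda>q. q \<noteq> 0 \<and> ev a q \<cdot> x = 0" q degree] q x by auto
    have "degree g \<noteq> 0"
    proof
      assume "degree g = 0"
      then obtain k where "g = [:k:]" by (rule degree_eq_zeroE)
      then show False using g x a by simp
    qed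
    then obtain l where l: "poly g l = 0"
      using fundamental_theorem_of_algebra[of g] constant_degree[of g] by auto
    then obtain h where h: "g = [:-l, 1:] * h" "h \<noteq> 0" "degree h < degree g" using fac g by blast
    let ?c = "ev a h \<cdot> x"
    have c: "?c \<in> A" "?c \<noteq> 0" using gmin[of h] h a x by auto
    have "ev a g = (a - l *\<^sub>C e) \<cdot> ev a h" using h(1) a by (metis ev_mult lin)
    then have "(a - l *\<^sub>C e) \<cdot> ?c = 0" using g x a by (simp add: mul_assoc)
    then have ac: "a \<cdot> ?c = l *\<^sub>C ?c" using c a by (simp add: diff_mul)
    have lr: "l = of_real (Re l)" using sa_eigenvalue_real[OF a c ac] by simp
    have "ev a q \<cdot> ?c = poly q l *\<^sub>C ?c" using ev_eigen[OF a(1) c(1) ac] .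
    then have "poly q l = 0" using q c x a by auto
    then have lI: "Re l \<in> I" using lr by (simp add: I_def)
    have "?c = E (Re l) \<cdot> ?c" using E_id[OF lI c(1)] ac lr by simp
    also have "\<dots> = ev a h \<cdot> (E (Re l) \<cdot> x)"
      using a x ev_commute[of a "d (Re l)" h] mul_assoc[of "ev a (d (Re l))" "ev a h" x]
        mul_assoc[of "ev a h" "ev a (d (Re l))" x] by (simp add: E_def)
    also have "\<dots> = 0" using Ex[OF lI] a by simp
    finally show False using c by simp
  qed
  have "a = a \<cdot> sum E I" using sumE a by simp
  also have "\<dots> = (\<Sum>l\<in>I. a \<cdot> E l)" using E_in a by (simp add: mul_sum)
  also have "\<dots> = (\<Sum>l\<in>I. l *\<^sub>R E l)" using aE by (simp add: scl_real)
  finally have aeq: "a = (\<Sum>l\<in>I. l *\<^sub>R E l)" .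
  have "E l \<noteq> 0" if "l \<in> I" for l using dl[OF that] evd[OF that] by (simp add: E_def)
  then have "spectral a I E" unfolding spectral_def using fin E_in Es EE sumE aeq by simp
  then show ?thesis by blast
qed

end

section \<open>Positive elements and projections\<close>

context traced_cstar begin

definition pos :: "'a \<Rightarrow> bool" where
  "pos x \<longleftrightarrow> (\<exists>y\<in>A. x = star y \<cdot> y)"

definition proj :: "'a \<Rightarrow> bool" where
  "proj q \<longleftrightarrow> q \<in> A \<and> star q = q \<and> q \<cdot> q = q"

lemma pos_in [simp]: "pos x \<Longrightarrow> x \<in> A" and pos_sa: "pos x \<Longrightarrow> star x = x"
  by (auto simp: pos_def star_mul)

lemma proj_in [simp]: "proj x \<Longrightarrow> x \<in> A" and proj_sa: "proj x \<Longrightarrow> star x = x"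
  and proj_idem: "proj x \<Longrightarrow> x \<cdot> x = x"
  by (auto simp: proj_def)

lemma proj_pos: "proj x \<Longrightarrow> pos x"
  by (metis pos_def proj_def)

lemma proj_e: "proj e"
  by (simp add: proj_def)

lemma proj_compl: "proj x \<Longrightarrow> proj (e - x)"
  unfolding proj_def by (auto simp: star_diff diff_mul mul_diff)

lemma pos_0 [simp]: "pos 0"
  unfolding pos_def by (rule bexI[of _ 0]) auto

lemma pos_tr: "pos x \<Longrightarrow> 0 \<le> Re (tr x)" "pos x \<Longrightarrow> Im (tr x) = 0"
  using tr_pos by (fastforce simp: pos_def)+

lemma pos_tr_eq_0: "pos x \<Longrightarrow> Re (tr x) = 0 \<Longrightarrow> x = 0"
  using tr_faithful pos_tr(2)[of x] unfolding pos_def by (metis complex_eqI zero_complex.sel mul_zero star_in)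

lemma pos_conj: "pos x \<Longrightarrow> k \<in> A \<Longrightarrow> pos (star k \<cdot> x \<cdot> k)"
  unfolding pos_def
proof (elim bexE)
  fix y assume "k \<in> A" "y \<in> A" "x = star y \<cdot> y"
  then show "\<exists>y\<in>A. star k \<cdot> x \<cdot> k = star y \<cdot> y"
    by (intro bexI[of _ "y \<cdot> k"]) (auto simp: star_mul mul_assoc)
qed

lemma pos_scaleR: "pos x \<Longrightarrow> 0 \<le> r \<Longrightarrow> pos (r *\<^sub>R x)"
  unfolding pos_def
proof (elim bexE)
  fix y assume "0 \<le> r" "y \<in> A" "x = star y \<cdot> y"
  then show "\<exists>y\<in>A. r *\<^sub>R x = star y \<cdot> y"
    by (intro bexI[of _ "sqrt r *\<^sub>R y"]) (auto simp: star_scaleR)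
qed

subsection \<open>Functional calculus\<close>

text \<open>Complex values are allowed because the norm estimate below needs a unitary.\<close>

definition fc :: "real set \<Rightarrow> (real \<Rightarrow> 'a) \<Rightarrow> (real \<Rightarrow> complex) \<Rightarrow> 'a" where
  "fc I E g = (\<Sum>l\<in>I. g l *\<^sub>C E l)"

lemma fc_in [simp]: "spectral a I E \<Longrightarrow> fc I E g \<in> A"
  by (auto simp: fc_def spectral_def)

lemma fc_mul:
  assumes "spectral a I E"
  shows "fc I E g \<cdot> fc I E h = fc I E (\<lambda>l. g l * h l)"
proof -
  have E: "\<And>l. l \<in> I \<Longrightarrow> E l \<in> A" and I: "finite I"
    and EE: "\<And>l m. l \<in> I \<Longrightarrow> m \<in> I \<Longrightarrow> E l \<cdot> E m = (if l = m then E l else 0)"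
    using assms by (auto simp: spectral_def)
  have "fc I E g \<cdot> fc I E h = (\<Sum>l\<in>I. \<Sum>m\<in>I. (g l *\<^sub>C E l) \<cdot> (h m *\<^sub>C E m))"
    unfolding fc_def using E by (subst sum_mul; simp add: mul_sum)
  also have "\<dots> = (\<Sum>l\<in>I. \<Sum>m\<in>I. if m = l then (g l * h m) *\<^sub>C E l else 0)"
    by (intro sum.cong refl) (auto simp: E EE)
  also have "\<dots> = fc I E (\<lambda>l. g l * h l)" using I by (simp add: fc_def)
  finally show ?thesis .
qed

lemma fc_star: "spectral a I E \<Longrightarrow> star (fc I E g) = fc I E (\<lambda>l. cnj (g l))"
  by (auto simp: fc_def star_sum spectral_def star_scl intro!: sum.cong)

lemma fc_id: "spectral a I E \<Longrightarrow> fc I E of_real = a"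
  by (simp add: fc_def spectral_def scl_real)

lemma fc_1: "spectral a I E \<Longrightarrow> fc I E (\<lambda>_. 1) = e"
  by (simp add: fc_def spectral_def)

lemma fc_cong: "(\<And>l. l \<in> I \<Longrightarrow> g l = h l) \<Longrightarrow> fc I E g = fc I E h"
  by (simp add: fc_def)

lemma fc_add: "fc I E g + fc I E h = fc I E (\<lambda>l. g l + h l)"
  and fc_diff: "fc I E g - fc I E h = fc I E (\<lambda>l. g l - h l)"
  and fc_scl: "c *\<^sub>C fc I E g = fc I E (\<lambda>l. c * g l)"
  by (simp_all add: fc_def sum.distrib sum_subtractf V.scale_sum_right
      V.scale_left_distrib V.scale_left_diff_distrib)

lemma fc_scaleR: "r *\<^sub>R fc I E g = fc I E (\<lambda>l. of_real r * g l)"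
  by (metis fc_scl scl_real)

lemma pos_fc:
  assumes "spectral a I E" "\<And>l. l \<in> I \<Longrightarrow> 0 \<le> g l"
  shows "pos (fc I E (\<lambda>l. of_real (g l)))"
proof -
  let ?y = "fc I E (\<lambda>l. of_real (sqrt (g l)))"
  have "star ?y \<cdot> ?y = fc I E (\<lambda>l. of_real (g l))"
    using assms by (auto simp: fc_star fc_mul simp flip: of_real_mult intro!: fc_cong)
  then show ?thesis using assms unfolding pos_def by (metis fc_in)
qed

text \<open>The test element is \<open>E l\<close> itself: it isolates the eigenvalue, and its trace
  is strictly positive by faithfulness.\<close>

lemma eigenvalue_nonneg:
  assumes sp: "spectral a I E" and l: "l \<in> I"
    and tr: "\<And>k. k \<in> A \<Longrightarrow> 0 \<le> Re (tr (star k \<cdot> fc I E (\<lambda>l. of_real (g l)) \<cdot> k))"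
  shows "0 \<le> g l"
proof -
  have I: "finite I" and E: "E l \<in> A" "star (E l) = E l" "E l \<cdot> E l = E l" "E l \<noteq> 0"
    using sp l by (auto simp: spectral_def)
  have Efc: "E l = fc I E (\<lambda>m. if m = l then 1 else 0)"
    using I l by (simp add: fc_def if_distrib[of "\<lambda>c. c *\<^sub>C _"] cong: if_cong)
  have "star (E l) \<cdot> fc I E (\<lambda>l. of_real (g l)) \<cdot> E l = g l *\<^sub>R E l"
    unfolding E(2) unfolding Efc by (simp add: fc_mul[OF sp] fc_scaleR, rule fc_cong, auto)
  then have "0 \<le> g l * Re (tr (E l))"
    using tr[OF E(1)] E by (simp add: tr_scaleR)
  moreover have "pos (E l)" using E by (intro proj_pos) (unfold proj_def, simp)
  then have "0 < Re (tr (E l))" using pos_tr(1)[of "E l"] pos_tr_eq_0[of "E l"] E by fastforce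
  ultimately show ?thesis by (simp add: zero_le_mult_iff)
qed

text \<open>Positivity becomes a family of linear inequalities, which sums and limits inherit; from
  the factorization in the definition this cannot be read off.\<close>

lemma pos_iff:
  assumes "x \<in> A" "star x = x"
  shows "pos x \<longleftrightarrow> (\<forall>k\<in>A. 0 \<le> Re (tr (star k \<cdot> x \<cdot> k)))"
proof (intro iffI ballI)
  fix k assume "pos x" "k \<in> A"
  then show "0 \<le> Re (tr (star k \<cdot> x \<cdot> k))" using pos_conj pos_tr by blast
next
  assume *: "\<forall>k\<in>A. 0 \<le> Re (tr (star k \<cdot> x \<cdot> k))"
  obtain I E where sp: "spectral x I E" using spectral_exists assms by blast
  have "0 \<le> l" if "l \<in> I" for l
    by (rule eigenvalue_nonneg[OF sp that, of "\<lambda>l. l"]) (use * fc_id[OF sp] in auto)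
  then have "pos (fc I E (\<lambda>l. of_real l))" using pos_fc[OF sp, of "\<lambda>l. l"] by blast
  then show "pos x" using fc_id[OF sp] by simp
qed

lemma pos_eigenvalue_nonneg:
  "spectral a I E \<Longrightarrow> l \<in> I \<Longrightarrow> pos (fc I E (\<lambda>l. of_real (g l))) \<Longrightarrow> 0 \<le> g l"
  using eigenvalue_nonneg[of a I E l g] pos_iff pos_sa pos_in by blast

lemma pos_add: assumes "pos x" "pos y" shows "pos (x + y)"
proof -
  have "0 \<le> Re (tr (star k \<cdot> (x + y) \<cdot> k))" if "k \<in> A" for k
    using that assms pos_conj[of x k] pos_conj[of y k]
    by (simp add: mul_add add_mul tr_add pos_tr)
  then show ?thesis using assms pos_sa by (subst pos_iff) (auto simp: star_add)
qed

lemma pos_sum: "(\<And>i. i \<in> S \<Longrightarrow> pos (f i)) \<Longrightarrow> pos (sum f S)"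
  by (induction S rule: infinite_finite_induct) (auto intro: pos_add)

lemma pos_antisym: assumes "pos x" "pos (- x)" shows "x = 0"
proof (rule pos_tr_eq_0)
  show "Re (tr x) = 0" using pos_tr(1)[OF assms(1)] pos_tr(1)[OF assms(2)] assms
    by (simp add: tr_minus)
qed (rule assms)

lemma pos_le_norm: assumes "x \<in> A" "star x = x" shows "pos (norm x *\<^sub>R e - x)"
proof -
  obtain I E where sp: "spectral x I E" using spectral_exists assms by blast
  have "0 \<le> norm x - l" if l: "l \<in> I" for l
  proof -
    have I: "finite I" and E: "E l \<in> A" "star (E l) = E l" "E l \<cdot> E l = E l" "E l \<noteq> 0"
      using sp l by (auto simp: spectral_def)
    have Efc: "E l = fc I E (\<lambda>m. if m = l then 1 else 0)"
      using I l by (simp add: fc_def if_distrib[of "\<lambda>c. c *\<^sub>C _"] cong: if_cong)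
    have "x \<cdot> E l = l *\<^sub>R E l"
      unfolding Efc fc_id[OF sp, symmetric] by (simp add: fc_mul[OF sp] fc_scaleR, rule fc_cong, auto)
    then have "\<bar>l\<bar> * norm (E l) \<le> norm x * norm (E l)" using norm_mul[OF assms(1) E(1)] by simp
    then show ?thesis using E(4) by simp
  qed
  then have "pos (fc I E (\<lambda>l. of_real (norm x - l)))" using pos_fc[OF sp] by blast
  also have "fc I E (\<lambda>l. of_real (norm x - l)) = norm x *\<^sub>R fc I E (\<lambda>_. 1) - fc I E of_real"
    by (simp add: fc_scaleR fc_diff)
  finally show ?thesis by (simp only: fc_1[OF sp] fc_id[OF sp])
qed

lemma norm_le:
  assumes x: "pos x" "pos (r *\<^sub>R e - x)" and r: "0 \<le> r"
  shows "norm x \<le> r"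
proof (cases "r = 0")
  case True
  then show ?thesis using pos_antisym x by simp
next
  case False
  obtain I E where sp: "spectral x I E" using spectral_exists x pos_sa pos_in by blast
  have "fc I E (\<lambda>l. of_real (r - l)) = r *\<^sub>R fc I E (\<lambda>_. 1) - fc I E of_real"
    by (simp add: fc_scaleR fc_diff)
  then have eq: "fc I E (\<lambda>l. of_real (r - l)) = r *\<^sub>R e - x"
    by (simp only: fc_1[OF sp] fc_id[OF sp])
  have l: "0 \<le> l" "l \<le> r" if "l \<in> I" for l
    using pos_eigenvalue_nonneg[OF sp that, of "\<lambda>l. l"] fc_id[OF sp] x
      pos_eigenvalue_nonneg[OF sp that, of "\<lambda>l. r - l"] eq by auto
  \<comment> \<open>\<open>x / r\<close> is the real part of the unitary \<open>u\<close>\<close>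
  define u where "u = fc I E (\<lambda>l. Complex (l / r) (sqrt (1 - (l / r)\<^sup>2)))"
  have u: "u \<in> A" using sp by (simp add: u_def)
  have sq: "(l / r)\<^sup>2 \<le> 1" if "l \<in> I" for l
    using l[OF that] False r by (simp add: power_le_one)
  have "star u \<cdot> u = fc I E (\<lambda>_. 1)"
    unfolding u_def fc_star[OF sp] fc_mul[OF sp]
    using sq by (intro fc_cong) (auto simp: complex_eq_iff power2_eq_square)
  then have "(norm u)\<^sup>2 = norm e" using cstar[OF u] fc_1[OF sp] by simp
  \<comment> \<open>Only an inequality, because in the zero algebra \<open>e\<close> has norm
    0.\<close>
  moreover have "norm e \<le> 1" using cstar[of e]
    by (metis e_in e_mul(1) mult_cancel_right1 norm_ge_zero order.refl power2_eq_square star_e zero_le_one)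
  ultimately have nu: "norm u \<le> 1" by (metis norm_ge_zero power_le_one_iff zero_neq_numeral)
  have "(r / 2) *\<^sub>R (u + star u) = fc I E of_real"
    unfolding u_def fc_star[OF sp] fc_add fc_scaleR
    using False by (intro fc_cong) (auto simp: complex_eq_iff)
  then have "x = (r / 2) *\<^sub>R (u + star u)" using fc_id[OF sp] by simp
  then have "norm x = r / 2 * norm (u + star u)" using r by simp
  also have "\<dots> \<le> r / 2 * (1 + 1)"
    using nu norm_triangle_ineq[of u "star u"] norm_star[OF u] r by (intro mult_left_mono) auto
  finally show ?thesis by simp
qed

text \<open>Compressing \<open>y - x\<close> by \<open>g\<close> leaves the negative of the positive
  element \<open>star g \<cdot> x \<cdot> g\<close>, which must then vanish. Most of the support
  arguments below rest on this.\<close>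

lemma pos_dominated:
  assumes "pos x" "pos (y - x)" "y \<in> A" "g \<in> A" "star g = g" "y \<cdot> g = 0"
  shows "x \<cdot> g = 0"
proof -
  obtain k where k: "k \<in> A" "x = star k \<cdot> k" using assms(1) by (auto simp: pos_def)
  have "pos (star g \<cdot> (y - x) \<cdot> g)" using pos_conj assms by blast
  also have "star g \<cdot> (y - x) \<cdot> g = - (star g \<cdot> x \<cdot> g)"
    using assms by (simp add: diff_mul mul_diff mul_assoc)
  finally have "star g \<cdot> x \<cdot> g = 0" using pos_antisym pos_conj assms by blast
  then have "star (k \<cdot> g) \<cdot> (k \<cdot> g) = 0" using k assms(4) by (simp add: star_mul mul_assoc)
  then have "k \<cdot> g = 0" using star_mul_self_eq_0[of "k \<cdot> g"] k(1) assms(4) by simp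
  then show ?thesis using k assms(4) by (simp add: mul_assoc)
qed

lemma proj_le_iff:
  assumes "proj p" "proj q"
  shows "pos (q - p) \<longleftrightarrow> q \<cdot> p = p"
proof
  assume "pos (q - p)"
  then have "p \<cdot> (e - q) = 0"
    using assms by (intro pos_dominated[of p q]) (auto simp: proj_pos proj_compl proj_sa mul_diff proj_idem)
  then have "p \<cdot> q = p" using assms by (simp add: mul_diff)
  then show "q \<cdot> p = p" using assms by (metis proj_in proj_sa star_mul)
next
  assume qp: "q \<cdot> p = p"
  then have "p \<cdot> q = p" using assms by (metis proj_in proj_sa star_mul)
  then have "proj (q - p)"
    using qp assms unfolding proj_def by (auto simp: star_diff diff_mul mul_diff)
  then show "pos (q - p)" by (rule proj_pos)
qed

section \<open>Range projections, meets and maximal supports\<close>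

definition rng :: "'a \<Rightarrow> 'a" where
  "rng a = (THE q. proj q \<and> q \<cdot> a = a \<and> (\<forall>q'. proj q' \<and> q' \<cdot> a = a \<longrightarrow> pos (q' - q)))"

lemma support:
  assumes a: "a \<in> A" "star a = a"
  obtains w where "w \<in> A" "star w = w" "a \<cdot> w = rng a" "w \<cdot> a = rng a" "rng a \<cdot> w = w" "w \<cdot> rng a = w"
    and "proj (rng a)" "rng a \<cdot> a = a" "a \<cdot> rng a = a"
    and "\<And>q. proj q \<Longrightarrow> q \<cdot> a = a \<Longrightarrow> q \<cdot> rng a = rng a"
    and "pos a \<Longrightarrow> \<exists>c>0. pos (c *\<^sub>R a - rng a)"
proof -
  obtain I E where sp: "spectral a I E" using spectral_exists a by blast
  have I: "finite I" using sp by (simp add: spectral_def)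
  \<comment> \<open>Since \<open>inverse 0 = 0\<close>, \<open>w\<close> vanishes on the kernel of
    \<open>a\<close>.\<close>
  define w where "w = fc I E (\<lambda>l. of_real (inverse l))"
  define f where "f = fc I E (\<lambda>l. of_real (if l = 0 then 0 else 1))"
  have af: "a = fc I E of_real" using fc_id[OF sp] by simp
  let ?a = "fc I E of_real"
  have "?a \<cdot> w = f" "w \<cdot> ?a = f" "f \<cdot> w = w" "w \<cdot> f = w" "f \<cdot> ?a = ?a" "?a \<cdot> f = ?a"
    "f \<cdot> f = f" "star w = w" "star f = f"
    unfolding w_def f_def fc_mul[OF sp] fc_star[OF sp] by (auto intro!: fc_cong)
  note 1 = this[unfolded fc_id[OF sp]]
  have in': "w \<in> A" "f \<in> A" using sp by (auto simp: w_def f_def)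
  have f: "proj f" unfolding proj_def using 1 in' by simp
  have min: "q \<cdot> f = f" if "proj q" "q \<cdot> a = a" for q
  proof -
    have "q \<cdot> (a \<cdot> w) = q \<cdot> a \<cdot> w" using that(1) in' a(1) by (simp add: mul_assoc)
    then show ?thesis using that 1 by simp
  qed
  have rng: "rng a = f" unfolding rng_def
  proof (rule the_equality)
    show "proj f \<and> f \<cdot> a = a \<and> (\<forall>q'. proj q' \<and> q' \<cdot> a = a \<longrightarrow> pos (q' - f))"
      using f 1 min proj_le_iff by auto
  next
    fix q assume q: "proj q \<and> q \<cdot> a = a \<and> (\<forall>q'. proj q' \<and> q' \<cdot> a = a \<longrightarrow> pos (q' - q))"
    then have "pos (f - q)" using f 1 by blast
    moreover have "pos (- (f - q))" using q min proj_le_iff[OF f, of q] by auto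
    ultimately show "q = f" using pos_antisym by fastforce
  qed
  have lower: "\<exists>c>0. pos (c *\<^sub>R a - f)" if "pos a"
  proof -
    \<comment> \<open>The sum dominates each inverse eigenvalue; the summand 1 keeps
      \<open>c\<close> positive even if the sum is 0.\<close>
    define c where "c = 1 + (\<Sum>l\<in>I. \<bar>inverse l\<bar>)"
    have nn: "0 \<le> l" if "l \<in> I" for l
      using pos_eigenvalue_nonneg[OF sp that, of "\<lambda>l. l"] \<open>pos a\<close> af by simp
    have "1 \<le> c * l" if l: "l \<in> I" "l \<noteq> 0" for l
    proof -
      have "\<bar>inverse l\<bar> \<le> c"
        using member_le_sum[OF l(1), of "\<lambda>l. \<bar>inverse l\<bar>"] I by (simp add: c_def)
      then show ?thesis using nn[OF l(1)] l(2) by (simp add: field_simps)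
    qed
    then have "pos (fc I E (\<lambda>l. of_real (c * l - (if l = 0 then 0 else 1))))"
      by (intro pos_fc[OF sp]) auto
    also have "fc I E (\<lambda>l. of_real (c * l - (if l = 0 then 0 else 1))) = c *\<^sub>R a - f"
      unfolding f_def by (subst af) (simp add: fc_scaleR fc_diff)
    finally have "pos (c *\<^sub>R a - f)" .
    moreover have "c > 0" unfolding c_def by (intro add_pos_nonneg sum_nonneg) auto
    ultimately show ?thesis by blast
  qed
  show thesis
    by (rule that[of w]; (unfold rng)?) (use 1 in' f min lower in auto)
qed

text \<open>The description is meaningful only once a meet is exhibited. It is the kernel projection
  of \<open>(e - p) + (e - q)\<close>, because a sum of positive elements vanishes only where both
  summands do.\<close>

lemma meet_eq_0D:
  assumes pq: "proj p" "proj q"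
    and meet: "(THE m. proj m \<and> pos (p - m) \<and> pos (q - m) \<and>
      (\<forall>m'. proj m' \<and> pos (p - m') \<and> pos (q - m') \<longrightarrow> pos (m - m'))) = 0"
    and h: "proj h" "p \<cdot> h = h" "q \<cdot> h = h"
  shows "h = 0"
proof -
  let ?M = "\<lambda>m. proj m \<and> pos (p - m) \<and> pos (q - m) \<and>
      (\<forall>m'. proj m' \<and> pos (p - m') \<and> pos (q - m') \<longrightarrow> pos (m - m'))"
  define b where "b = (e - p) + (e - q)"
  have pp: "pos (e - p)" "pos (e - q)" using pq proj_compl proj_pos by auto
  then have b: "pos b" by (simp add: b_def pos_add)
  obtain w where w: "w \<in> A" "w \<cdot> b = rng b" "proj (rng b)" "b \<cdot> rng b = b"
    using support[of b] b pos_sa pos_in by metis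
  define m where "m = e - rng b"
  have m: "proj m" using w proj_compl by (simp add: m_def)
  have bm: "b \<cdot> m = 0" using w b by (simp add: m_def mul_diff)
  have "(e - p) \<cdot> m = 0" "(e - q) \<cdot> m = 0"
    using pos_dominated[of "e - p" b m] pos_dominated[of "e - q" b m] pp b m bm
    by (auto simp: b_def proj_sa)
  then have "p \<cdot> m = m" "q \<cdot> m = m" using pq m by (auto simp: diff_mul)
  then have le: "pos (p - m)" "pos (q - m)" using pq m by (auto simp: proj_le_iff)
  have gr: "pos (m - m')" if m': "proj m'" "pos (p - m')" "pos (q - m')" for m'
  proof -
    have "b \<cdot> m' = 0" using m' pq by (simp add: proj_le_iff b_def add_mul diff_mul)
    then have "rng b \<cdot> m' = 0" using w m' b by (metis mul_assoc mul_zero pos_in proj_in)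
    then show ?thesis using m m' w by (simp add: proj_le_iff) (simp add: m_def diff_mul)
  qed
  have M: "?M m" using m le gr by blast
  have "(THE m. ?M m) = m"
  proof (rule the_equality)
    show "?M m" by (fact M)
  next
    fix n assume n: "?M n"
    then have "pos (n - m)" "pos (- (n - m))" using M by auto
    then show "n = m" using pos_antisym by fastforce
  qed
  then have "m = 0" using meet by simp
  then have "pos (- h)" using gr[of h] h pq by (simp add: proj_le_iff)
  then show "h = 0" using pos_antisym h proj_pos by blast
qed

text \<open>A basis of the span of \<open>S\<close> can be chosen inside \<open>S\<close>. Each of
  its members lies below their sum, so the support of the sum covers the whole span.\<close>

lemma maximal_support:
  assumes pos: "\<And>y. y \<in> S \<Longrightarrow> pos y" and 0: "0 \<in> S" and add: "\<And>x y. x \<in> S \<Longrightarrow> y \<in> S \<Longrightarrow> x + y \<in> S"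
  obtains y where "y \<in> S" "\<And>x. x \<in> S \<Longrightarrow> rng y \<cdot> x = x"
proof -
  obtain B where B: "B \<subseteq> S" "V.independent B" "S \<subseteq> V.span B"
    using V.maximal_independent_subset[of S] by metis
  obtain C where C: "finite C" "A = V.span C" using fin_dim by blast
  have BA: "B \<subseteq> A" using B(1) pos pos_in by blast
  then have fin: "finite B" using V.independent_span_bound[OF C(1) B(2)] C(2) by blast
  have sums: "sum (\<lambda>v. v) B' \<in> S" if "finite B'" "B' \<subseteq> S" for B'
    using that by induction (auto intro: 0 add)
  define y where "y = sum (\<lambda>v. v) B"
  have y: "y \<in> S" "pos y" using sums fin B(1) pos by (auto simp: y_def)
  have f: "proj (rng y)" "y \<cdot> rng y = y" using support[of y] y pos_sa pos_in by metis+
  let ?g = "e - rng y"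
  have g: "?g \<in> A" "star ?g = ?g" "y \<cdot> ?g = 0" using f y by (auto simp: mul_diff proj_compl proj_sa)
  have "v \<cdot> ?g = 0" if v: "v \<in> B" for v
  proof (rule pos_dominated[of v y])
    have "y - v = sum (\<lambda>v. v) (B - {v})" using fin v by (simp add: y_def sum_diff1)
    then show "pos (y - v)" using pos_sum B(1) pos by (metis Diff_subset subset_iff)
  qed (use v B(1) pos y g in auto)
  then have Bg: "x \<cdot> ?g = 0" if "x \<in> B" for x using that by blast
  have sg: "x \<in> A \<and> x \<cdot> ?g = 0" if "x \<in> V.span B" for x
    using that
  proof (induction rule: V.span_induct_alt)
    case (step c x y)
    then show ?case using Bg BA g by (auto simp: add_mul)
  qed (use g in auto)
  have "rng y \<cdot> x = x" if "x \<in> S" for x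
  proof -
    have "x \<in> A" "x \<cdot> ?g = 0" using sg that B(3) by blast+
    then have "x \<cdot> rng y = x" using f by (simp add: mul_diff)
    then show ?thesis using pos[OF that] f by (metis pos_in pos_sa proj_in proj_sa star_mul)
  qed
  then show thesis using that y by blast
qed

text \<open>The trace is not assumed continuous. On self-adjoint elements the bound by
  \<open>norm b *\<^sub>R e\<close> supplies what is needed, and the limit is self-adjoint because
  the involution is isometric.\<close>

lemma pos_limit:
  assumes X: "\<And>n::nat. pos (X n)" "X \<longlonglongrightarrow> L" and L: "L \<in> A"
  shows "pos L"
proof -
  have lim: "(\<lambda>n. norm (X n - L)) \<longlonglongrightarrow> 0" using X(2) by (metis LIM_zero tendsto_norm_zero)
  have "norm (star L - X n) = norm (X n - L)" for n
    using norm_star[of "X n - L"] L X(1) by (simp add: star_diff pos_sa norm_minus_commute)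
  then have "X \<longlonglongrightarrow> star L"
    using lim by (simp add: tendsto_iff dist_norm norm_minus_commute)
  then have sa: "star L = L" using LIMSEQ_unique X(2) by blast
  have "0 \<le> Re (tr (star k \<cdot> L \<cdot> k))" if k: "k \<in> A" for k
  proof -
    have "- Re (tr (star k \<cdot> L \<cdot> k)) \<le> norm k * norm k * Re (tr e) * norm (X n - L)" for n
    proof -
      let ?b = "star k \<cdot> (X n - L) \<cdot> k"
      have b: "?b \<in> A" "star ?b = ?b"
        using k L X(1) by (auto simp: star_mul star_diff sa pos_sa mul_assoc)
      have "norm ?b \<le> norm (star k \<cdot> (X n - L)) * norm k"
        by (rule norm_mul) (use k L X(1) in auto)
      also have "\<dots> \<le> (norm (star k) * norm (X n - L)) * norm k"
        by (intro mult_right_mono norm_mul) (use k L X(1) in auto)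
      finally have nb: "norm ?b \<le> norm k * norm k * norm (X n - L)"
        using norm_star[OF k] by (simp add: mult_ac)
      have "0 \<le> Re (tr (star k \<cdot> X n \<cdot> k))" using pos_conj[OF X(1) k] pos_tr by blast
      also have "\<dots> = Re (tr ?b) + Re (tr (star k \<cdot> L \<cdot> k))"
        using k L X(1) by (simp add: mul_diff diff_mul tr_diff)
      also have "Re (tr ?b) \<le> norm ?b * Re (tr e)"
        using pos_tr(1)[OF pos_le_norm[OF b]] b by (simp add: tr_diff tr_scaleR)
      also have "\<dots> \<le> norm k * norm k * norm (X n - L) * Re (tr e)"
        using nb pos_tr(1)[OF proj_pos[OF proj_e]] by (rule mult_right_mono)
      finally show ?thesis by (simp add: mult_ac)
    qed
    moreover have "(\<lambda>n. norm k * norm k * Re (tr e) * norm (X n - L)) \<longlonglongrightarrow> 0"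
      using tendsto_mult_right_zero[OF lim] by blast
    ultimately have "- Re (tr (star k \<cdot> L \<cdot> k)) \<le> 0" by (intro LIMSEQ_le_const) auto
    then show ?thesis by simp
  qed
  then show ?thesis using pos_iff L sa by blast
qed

end

subsection \<open>Mean ergodic theorem\<close>

context traced_cstar begin

text \<open>Take a linear relation between \<open>p\<close>, \<open>N p\<close>,
  \<open>N (N p)\<close> and so on. Its vanishing leading coefficients are pulled out as the power
  \<open>k\<close>; dividing by the first nonzero one leaves \<open>p + N g\<close>.\<close>

lemma minimal_relation:
  assumes W: "V.subspace W" "W \<subseteq> A" and p: "p \<in> W"
    and N: "\<And>x. x \<in> W \<Longrightarrow> N x \<in> W" "\<And>x y. x \<in> W \<Longrightarrow> y \<in> W \<Longrightarrow> N (x + y) = N x + N y"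
      "\<And>c x. x \<in> W \<Longrightarrow> N (c *\<^sub>C x) = c *\<^sub>C N x"
  obtains k g where "g \<in> W" "(N ^^ k) (p + N g) = 0"
proof -
  note W_simps = V.subspace_add[OF W(1)] V.subspace_scale[OF W(1)] V.subspace_0[OF W(1)]
  have NkW: "(N ^^ i) x \<in> W" if "x \<in> W" for i x using that by (induction i) (auto intro: N)
  have Nk_scl: "(N ^^ i) (c *\<^sub>C x) = c *\<^sub>C (N ^^ i) x" if "x \<in> W" for i c x
    using that by (induction i) (auto simp: N NkW)
  have N0: "N 0 = 0" using N(3)[of 0 0] W_simps by simp
  have Nsum: "N (sum f S) = (\<Sum>i\<in>S. N (f i))" if "\<And>i. i \<in> S \<Longrightarrow> f i \<in> W" for f :: "nat \<Rightarrow> 'a" and S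
    using that by (induction S rule: infinite_finite_induct)
      (auto simp: N N0 V.subspace_sum[OF W(1)])
  have rel: "\<exists>k g. g \<in> W \<and> (N ^^ k) (p + N g) = 0"
    if "(N ^^ j) (\<Sum>i\<le>n. c i *\<^sub>C (N ^^ i) p) = 0" "\<exists>i\<le>n. c i \<noteq> 0" for n j c
    using that
  proof (induction n arbitrary: j c)
    case 0
    then have "(N ^^ j) p = 0" using Nk_scl[OF p] by simp
    then show ?case using W_simps N0 by (intro exI[of _ j] exI[of _ 0]) simp
  next
    case (Suc n)
    let ?h = "\<Sum>i\<le>n. c (Suc i) *\<^sub>C (N ^^ i) p"
    have h: "?h \<in> W" using p by (intro V.subspace_sum[OF W(1)] W_simps NkW)
    have "N ?h = (\<Sum>i\<le>n. c (Suc i) *\<^sub>C (N ^^ Suc i) p)"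
      using p by (subst Nsum) (auto simp: N NkW W_simps)
    then have eq: "(\<Sum>i\<le>Suc n. c i *\<^sub>C (N ^^ i) p) = c 0 *\<^sub>C p + N ?h"
      by (subst sum.atMost_Suc_shift) simp
    show ?case
    proof (cases "c 0 = 0")
      case True
      then have "(N ^^ Suc j) ?h = 0" using Suc.prems(1) eq by (simp add: funpow_swap1)
      moreover have "\<exists>i\<le>n. c (Suc i) \<noteq> 0" using Suc.prems(2) True by (metis Suc_le_mono not0_implies_Suc)
      ultimately show ?thesis using Suc.IH[of "Suc j" "\<lambda>i. c (Suc i)"] by blast
    next
      case False
      let ?g = "inverse (c 0) *\<^sub>C ?h"
      have "c 0 *\<^sub>C (p + N ?g) = c 0 *\<^sub>C p + N ?h"
        using False h N(3)[OF h] by (simp add: V.scale_right_distrib)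
      then have "c 0 *\<^sub>C (N ^^ j) (p + N ?g) = 0"
        using Suc.prems(1) eq Nk_scl[of "p + N ?g" j "c 0"] h p W_simps N by simp
      then show ?thesis using False h W_simps by (intro exI[of _ j] exI[of _ ?g]) simp
    qed
  qed
  obtain n c where "\<exists>i\<le>n. c i \<noteq> 0" "(\<Sum>i\<le>n. c i *\<^sub>C (N ^^ i) p) = 0"
    using linear_dependence[of "\<lambda>i. (N ^^ i) p"] NkW[OF p] W(2) by blast
  then show thesis using rel[where j = 0 and n = n and c = c] that by auto
qed

text \<open>Two limits are recorded because they serve different ends: the Abel means are those in
  the definition of \<open>PF_zeta\<close>, while the Cesaro means form a sequence of positive
  combinations and transmit order bounds.\<close>

lemma mean_ergodic:
  assumes W: "V.subspace W" "W \<subseteq> A" and p: "p \<in> W"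
    and T: "\<And>x. x \<in> W \<Longrightarrow> T x \<in> W" "\<And>x y. x \<in> W \<Longrightarrow> y \<in> W \<Longrightarrow> T (x + y) = T x + T y"
      "\<And>c x. x \<in> W \<Longrightarrow> T (c *\<^sub>C x) = c *\<^sub>C T x"
    and bounded: "\<And>x. x \<in> W \<Longrightarrow> \<exists>C. \<forall>n. norm ((T ^^ n) x) \<le> C"
  obtains f where "f \<in> W" "T f = f"
    and "\<And>t. 0 < t \<Longrightarrow> t < 1 \<Longrightarrow> summable (\<lambda>j. t ^ j *\<^sub>R (T ^^ j) p)"
    and "(\<lambda>n. (1 / real n) *\<^sub>R (\<Sum>j<n. (T ^^ j) p)) \<longlonglongrightarrow> f"
    and "((\<lambda>t. (1 - t) *\<^sub>R (\<Sum>j. t ^ j *\<^sub>R (T ^^ j) p)) \<longlongrightarrow> f) (at_left 1)"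
proof -
  note W_simps [simp, intro] = V.subspace_add[OF W(1)] V.subspace_scale[OF W(1)] V.subspace_0[OF W(1)]
    V.subspace_diff[OF W(1)] V.subspace_neg[OF W(1)]
  have W_scaleR [simp]: "r *\<^sub>R x \<in> W" if "x \<in> W" for r x using that by (metis W_simps(2) scl_real)
  have T_scaleR [simp]: "T (r *\<^sub>R x) = r *\<^sub>R T x" if "x \<in> W" for r x using T(3) that by (metis scl_real)
  have T_diff: "T (x - y) = T x - T y" if "x \<in> W" "y \<in> W" for x y
    using T(2)[of x "- y"] T(3)[of y "-1"] that by simp
  have TnW [simp]: "(T ^^ n) x \<in> W" if "x \<in> W" for n x using that by (induction n) (auto intro: T)
  have Tn_scaleR: "(T ^^ n) (r *\<^sub>R x) = r *\<^sub>R (T ^^ n) x" if "x \<in> W" for n r x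
    using that by (induction n) (auto simp: T)
  \<comment> \<open>\<open>1 - t T\<close> is injective on \<open>W\<close> for \<open>0 < t < 1\<close> and has no generalized kernel for \<open>t = 1\<close>\<close>
  define N where "N t x = x - t *\<^sub>R T x" for t x
  have NW [simp]: "N t x \<in> W" if "x \<in> W" for t x using that T by (simp add: N_def)
  have N_add: "N t (x + y) = N t x + N t y" if "x \<in> W" "y \<in> W" for t x y
    using that T(2) by (simp add: N_def scaleR_add_right)
  have N_scl: "N t (c *\<^sub>C x) = c *\<^sub>C N t x" if "x \<in> W" for t x c
    using that T(3) by (simp add: N_def V.scale_right_diff_distrib mult.commute flip: scl_real)
  have NkW: "(N t ^^ k) x \<in> W" if "x \<in> W" for t k x using that by (induction k) auto
  have split: "\<exists>h\<in>W. N t (p + N t h) = 0" if p: "p \<in> W" and t: "\<And>h. h \<in> W \<Longrightarrow> N t (N t h) = 0 \<Longrightarrow> N t h = 0"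
    for t p
  proof -
    obtain k g where kg: "g \<in> W" "(N t ^^ k) (p + N t g) = 0"
      by (rule minimal_relation[OF W p, of "N t"]) (auto simp: N_add N_scl)
    have ker: "N t h = 0" if "(N t ^^ k) h = 0" "h \<in> W" for h k
      using that
    proof (induction k arbitrary: h)
      case 0
      then show ?case using T(3)[of 0 0] by (simp add: N_def)
    next
      case (Suc k)
      then have "N t (N t h) = 0" by (metis NW comp_apply funpow_Suc_right)
      then show ?case using t Suc.prems by blast
    qed
    have "N t (p + N t g) = 0" by (rule ker[OF kg(2)]) (use kg(1) p in simp)
    then show ?thesis using kg by blast
  qed
  \<comment> \<open>Here the orbit of \<open>h\<close> is \<open>h - real n *\<^sub>R N 1 h\<close>,
    and linear growth contradicts boundedness unless \<open>N 1 h = 0\<close>.\<close>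
  have ker1: "N 1 h = 0" if h: "h \<in> W" and NN: "N 1 (N 1 h) = 0" for h
  proof -
    obtain C where C: "\<And>n. norm ((T ^^ n) h) \<le> C" using bounded[OF h] by blast
    have TN: "T (N 1 h) = N 1 h" using NN by (simp add: N_def)
    have "(T ^^ n) h = h - real n *\<^sub>R N 1 h" for n
    proof (induction n)
      case (Suc n)
      have "(T ^^ Suc n) h = T h - real n *\<^sub>R N 1 h" using Suc h TN by (simp add: T_diff)
      also have "T h = h - N 1 h" by (simp add: N_def)
      finally show ?case by (simp add: algebra_simps)
    qed simp
    then have "real n *\<^sub>R N 1 h = h - (T ^^ n) h" for n by simp
    then have "real n * norm (N 1 h) = norm (h - (T ^^ n) h)" for n
      by (metis abs_of_nat norm_scaleR)
    then have *: "real n * norm (N 1 h) \<le> norm h + C" for n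
      using norm_triangle_ineq4[of h "(T ^^ n) h"] C[of n] by (metis add_left_mono order_trans)
    show ?thesis
    proof (rule ccontr)
      assume "N 1 h \<noteq> 0"
      then obtain n where "norm h + C < real n * norm (N 1 h)"
        using reals_Archimedean3[of "norm (N 1 h)"] by auto
      then show False using *[of n] by simp
    qed
  qed
  have inj: "h = 0" if h: "h \<in> W" and Nh: "N t h = 0" and t: "0 < t" "t < 1" for h t
  proof -
    obtain C where C: "\<And>n. norm ((T ^^ n) h) \<le> C" using bounded[OF h] by blast
    have hT: "h = t *\<^sub>R T h" using Nh by (simp add: N_def)
    have "h = t ^ n *\<^sub>R (T ^^ n) h" for n
    proof (induction n)
      case (Suc n)
      have "(T ^^ n) h = (T ^^ n) (t *\<^sub>R T h)" using hT by simp
      also have "\<dots> = t *\<^sub>R (T ^^ Suc n) h" using h T Tn_scaleR[of "T h"] by (simp add: funpow_swap1)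
      finally have "t ^ n *\<^sub>R (T ^^ n) h = t ^ n *\<^sub>R (t *\<^sub>R (T ^^ Suc n) h)" by (rule arg_cong)
      with Suc have "h = t ^ n *\<^sub>R (t *\<^sub>R (T ^^ Suc n) h)" by (rule trans)
      then show ?case by (simp only: scaleR_scaleR power_Suc2)
    qed simp
    then have "norm h = t ^ n * norm ((T ^^ n) h)" for n
      using t by (metis abs_of_nonneg norm_scaleR order_less_imp_le zero_le_power)
    then have "norm h \<le> t ^ n * C" for n using C[of n] t by (metis mult_left_mono order_less_imp_le zero_le_power)
    moreover have "(\<lambda>n. t ^ n * C) \<longlonglongrightarrow> 0"
      using t by (intro tendsto_mult_left_zero LIMSEQ_power_zero) auto
    ultimately have "norm h \<le> 0" by (intro LIMSEQ_le_const) auto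
    then show ?thesis by simp
  qed
  have resolvent: "\<exists>h\<in>W. N t h = x \<and> (\<lambda>j. t ^ j *\<^sub>R (T ^^ j) x) sums h"
    if x: "x \<in> W" and t: "0 < t" "t < 1" for x t
  proof -
    obtain g where g: "g \<in> W" "N t (x + N t g) = 0"
      using split[OF x, of t] inj t NW by blast
    then have "x + N t g = 0" using inj[of "x + N t g" t] x t by simp
    moreover define h where "h = - g"
    ultimately have h: "h \<in> W" "N t h = x"
      using g N_scl[OF g(1), of t "-1"] by (auto simp: add_eq_0_iff)
    obtain C where C: "\<And>n. norm ((T ^^ n) h) \<le> C" using bounded[OF h(1)] by blast
    \<comment> \<open>The partial sums telescope because
      \<open>x = h - t *\<^sub>R T h\<close>.\<close>
    have "(\<Sum>j<n. t ^ j *\<^sub>R (T ^^ j) x) = h - t ^ n *\<^sub>R (T ^^ n) h" for n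
    proof (induction n)
      case (Suc n)
      have "(T ^^ n) x = (T ^^ n) h - t *\<^sub>R (T ^^ Suc n) h"
      proof (induction n)
        case 0 then show ?case using h by (simp add: N_def)
      next
        case (Suc n)
        have "(T ^^ Suc n) x = T ((T ^^ n) h - t *\<^sub>R (T ^^ Suc n) h)" using Suc by simp
        also have "\<dots> = (T ^^ Suc n) h - t *\<^sub>R (T ^^ Suc (Suc n)) h"
          using h(1) T(1) TnW[OF h(1), of "Suc n"] by (subst T_diff) auto
        finally show ?case .
      qed
      then show ?case using Suc by (simp add: scaleR_diff_right mult.commute)
    qed simp
    moreover have "(\<lambda>n. t ^ n *\<^sub>R (T ^^ n) h) \<longlonglongrightarrow> 0"
    proof (rule Lim_null_comparison)
      show "(\<lambda>n. t ^ n * C) \<longlonglongrightarrow> 0"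
        using t by (intro tendsto_mult_left_zero LIMSEQ_power_zero) auto
      show "\<forall>\<^sub>F n in sequentially. norm (t ^ n *\<^sub>R (T ^^ n) h) \<le> t ^ n * C"
        using C t by (intro always_eventually allI) (simp add: mult_left_mono)
    qed
    ultimately have "(\<lambda>j. t ^ j *\<^sub>R (T ^^ j) x) sums h"
      unfolding sums_def using tendsto_diff[OF tendsto_const, of _ 0 _ h] by fastforce
    then show ?thesis using h by blast
  qed
  obtain g where g: "g \<in> W" "N 1 (p + N 1 g) = 0" using split[OF p ker1] by blast
  define f where "f = p + N 1 g"
  have f: "f \<in> W" "T f = f" using g p by (auto simp: f_def) (simp add: N_def)
  have peq: "p = f - N 1 g" by (simp add: f_def)
  have Tf: "(T ^^ n) f = f" for n by (induction n) (auto simp: f)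
  obtain C where C: "\<And>n. norm ((T ^^ n) g) \<le> C" using bounded[OF g(1)] by blast
  have C0: "0 \<le> C" using C[of 0] norm_ge_zero order_trans by blast
  have "(\<lambda>n. (1 / real n) *\<^sub>R (\<Sum>j<n. (T ^^ j) p) - f) \<longlonglongrightarrow> 0"
  proof (rule Lim_null_comparison)
    show "(\<lambda>n. (norm g + C) / real n) \<longlonglongrightarrow> 0" by (rule lim_const_over_n)
    have Tp: "(T ^^ n) p = f - ((T ^^ n) g - (T ^^ Suc n) g)" for n
    proof (induction n)
      case 0 then show ?case by (simp add: peq N_def)
    next
      case (Suc n)
      have "(T ^^ Suc n) p = T (f - ((T ^^ n) g - (T ^^ Suc n) g))" using Suc by simp
      also have "\<dots> = T f - (T ((T ^^ n) g) - T ((T ^^ Suc n) g))"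
        using f g(1) TnW[OF g(1), of "Suc n"] by (subst T_diff, simp, simp, subst T_diff) auto
      finally show ?case using f by simp
    qed
    have "(\<Sum>j<n. (T ^^ j) p) = real n *\<^sub>R f - (g - (T ^^ n) g)" for n
      by (induction n) (auto simp: Tp algebra_simps)
    then have "(1 / real n) *\<^sub>R (\<Sum>j<n. (T ^^ j) p) - f = - ((1 / real n) *\<^sub>R (g - (T ^^ n) g))"
      if "n > 0" for n using that by (simp add: scaleR_diff_right)
    then have "norm ((1 / real n) *\<^sub>R (\<Sum>j<n. (T ^^ j) p) - f) \<le> (norm g + C) / real n" if "n > 0" for n
      using that norm_triangle_ineq4[of g "(T ^^ n) g"] C[of n]
      by (simp add: divide_right_mono)
    then show "\<forall>\<^sub>F n in sequentially. norm ((1 / real n) *\<^sub>R (\<Sum>j<n. (T ^^ j) p) - f) \<le> (norm g + C) / real n"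
      using eventually_gt_at_top[of 0] by (rule eventually_mono[rotated])
  qed
  then have cesaro: "(\<lambda>n. (1 / real n) *\<^sub>R (\<Sum>j<n. (T ^^ j) p)) \<longlonglongrightarrow> f"
    using LIM_zero_iff by blast
  \<comment> \<open>With \<open>p = f - N 1 g\<close> and \<open>v\<close> solving
    \<open>N t v = g\<close>, the error is \<open>(1 - t) *\<^sub>R N 1 v\<close> up to sign. The
    geometric series gives \<open>norm v \<le> C / (1 - t)\<close>, so
    \<open>t *\<^sub>R N 1 v = g - (1 - t) *\<^sub>R v\<close> stays bounded as \<open>t\<close>
    tends to 1.\<close>
  have est: "norm ((1 - t) *\<^sub>R (\<Sum>j. t ^ j *\<^sub>R (T ^^ j) p) - f) \<le> (1 - t) * ((C + norm g) / t)"
    if t: "0 < t" "t < 1" for t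
  proof -
    obtain h where h: "h \<in> W" "N t h = p" "(\<lambda>j. t ^ j *\<^sub>R (T ^^ j) p) sums h"
      using resolvent[OF p t] by blast
    obtain v where v: "v \<in> W" "N t v = g" "(\<lambda>j. t ^ j *\<^sub>R (T ^^ j) g) sums v"
      using resolvent[OF g(1) t] by blast
    have comm: "N t (N 1 v) = N 1 (N t v)"
      using v(1) T by (simp add: N_def T_diff scaleR_diff_right)
    have "N t ((1 - t) *\<^sub>R h - (f - (1 - t) *\<^sub>R N 1 v)) =
        (1 - t) *\<^sub>R N t h - (N t f - (1 - t) *\<^sub>R N t (N 1 v))"
    proof -
      have s: "N t (r *\<^sub>R x) = r *\<^sub>R N t x" if "x \<in> W" for r x
        using N_scl[OF that, of t "of_real r"] by (simp add: scl_real)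
      have d: "N t (x - y) = N t x - N t y" if "x \<in> W" "y \<in> W" for x y
        using N_add[of x "- y" t] N_scl[OF that(2), of t "-1"] that by simp
      show ?thesis using h(1) f(1) v(1) by (simp add: s d)
    qed
    also have "N t f = (1 - t) *\<^sub>R f" using f by (simp add: N_def algebra_simps)
    also have "(1 - t) *\<^sub>R N t h - ((1 - t) *\<^sub>R f - (1 - t) *\<^sub>R N t (N 1 v)) = 0"
      unfolding comm v(2) h(2) by (subst peq) (simp add: algebra_simps)
    finally have "(1 - t) *\<^sub>R h - (f - (1 - t) *\<^sub>R N 1 v) = 0"
      by (rule inj[rotated, OF _ t]) (use h(1) f(1) v(1) in simp)
    then have eq: "(1 - t) *\<^sub>R h - f = - ((1 - t) *\<^sub>R N 1 v)" by (simp add: algebra_simps)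
    have "t *\<^sub>R T v = v - g" using v(2) by (simp add: N_def algebra_simps)
    then have "t *\<^sub>R N 1 v = g - (1 - t) *\<^sub>R v" by (simp add: N_def algebra_simps)
    then have "t * norm (N 1 v) = norm (g - (1 - t) *\<^sub>R v)" using t
      by (metis abs_of_pos norm_scaleR)
    also have "\<dots> \<le> norm g + (1 - t) * norm v"
      using norm_triangle_ineq4[of g "(1 - t) *\<^sub>R v"] t by simp
    also have "norm v \<le> C / (1 - t)"
    proof (rule LIMSEQ_le_const2)
      show "(\<lambda>n. norm (\<Sum>j<n. t ^ j *\<^sub>R (T ^^ j) g)) \<longlonglongrightarrow> norm v"
        using v(3) unfolding sums_def by (rule tendsto_norm)
      have "norm (\<Sum>j<n. t ^ j *\<^sub>R (T ^^ j) g) \<le> C / (1 - t)" for n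
      proof -
        have "norm (\<Sum>j<n. t ^ j *\<^sub>R (T ^^ j) g) \<le> (\<Sum>j<n. t ^ j * C)"
          using C t by (intro sum_norm_le) (simp add: mult_left_mono)
        also have "\<dots> = (\<Sum>j<n. t ^ j) * C" by (simp add: sum_distrib_right)
        also have "(\<Sum>j<n. t ^ j) \<le> (\<Sum>j. t ^ j)"
          using t by (intro sum_le_suminf summable_geometric) auto
        also have "\<dots> = 1 / (1 - t)" using t by (simp add: suminf_geometric)
        finally show ?thesis using C0 by (simp add: mult_right_mono)
      qed
      then show "\<exists>N. \<forall>n\<ge>N. norm (\<Sum>j<n. t ^ j *\<^sub>R (T ^^ j) g) \<le> C / (1 - t)" by blast
    qed
    finally have "t * norm (N 1 v) \<le> norm g + C" using t by (simp add: mult_left_mono)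
    then have "norm (N 1 v) \<le> (C + norm g) / t" using t by (simp add: field_simps)
    then have "(1 - t) * norm (N 1 v) \<le> (1 - t) * ((C + norm g) / t)" using t by (intro mult_left_mono) auto
    then show ?thesis using h(3) eq t by (simp add: sums_iff)
  qed
  have "((\<lambda>t. (1 - t) *\<^sub>R (\<Sum>j. t ^ j *\<^sub>R (T ^^ j) p) - f) \<longlongrightarrow> 0) (at_left 1)"
  proof (rule Lim_null_comparison)
    have "((\<lambda>t. (1 - t) * ((C + norm g) / t)) \<longlongrightarrow> (1 - 1) * ((C + norm g) / 1)) (at_left 1)"
      by (intro tendsto_intros) auto
    then show "((\<lambda>t. (1 - t) * ((C + norm g) / t)) \<longlongrightarrow> 0) (at_left 1)" by simp
    have "\<forall>\<^sub>F t in at_left 1. t \<in> {0<..<1::real}" by (rule eventually_at_left_real) simp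
    then show "\<forall>\<^sub>F t in at_left 1. norm ((1 - t) *\<^sub>R (\<Sum>j. t ^ j *\<^sub>R (T ^^ j) p) - f)
        \<le> (1 - t) * ((C + norm g) / t)"
      by (rule eventually_mono) (use est in auto)
  qed
  then have "((\<lambda>t. (1 - t) *\<^sub>R (\<Sum>j. t ^ j *\<^sub>R (T ^^ j) p)) \<longlongrightarrow> f) (at_left 1)"
    by (rule LIM_zero_cancel)
  moreover have "summable (\<lambda>j. t ^ j *\<^sub>R (T ^^ j) p)" if "0 < t" "t < 1" for t
    using resolvent[OF p that] by (auto simp: sums_iff)
  ultimately show thesis by (intro that[OF f _ cesaro])
qed

end

section \<open>Involution and multilinearity\<close>

locale cplanar =
  fixes P :: "('a::real_normed_vector, 'm) star_planar_algebra_scheme"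
  assumes cpa: "cstar_planar_algebra P"
begin

lemmas cstar_axioms = cpa[unfolded cstar_planar_algebra_def]

sublocale planar P
  by unfold_locales (rule cstar_axioms[THEN conjunct1])

lemmas cscale_real = cstar_axioms[THEN conjunct2, THEN conjunct1, rule_format]
  and findim_cstar = cstar_axioms[THEN conjunct2, THEN conjunct2, THEN conjunct1, rule_format]
  and adj_act = cstar_axioms[THEN conjunct2, THEN conjunct2, THEN conjunct2, THEN conjunct1, rule_format]
  and traces = cstar_axioms[THEN conjunct2, THEN conjunct2, THEN conjunct2, THEN conjunct2]

text \<open>All sizes and shadings are packed together because the closure formula compares traces
  of different box sizes through size 0.\<close>

definition is_trace :: "(nat \<Rightarrow> shade \<Rightarrow> 'a \<Rightarrow> complex) \<Rightarrow> bool" where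
  "is_trace tr \<longleftrightarrow> (\<forall>n s.
    traced_cstar (cscale P) (box_space P n s) (pa_mult P n s) (pa_one P n s) (adj P) (tr n s) \<and>
    (\<forall>x\<in>box_space P n s. tr n s x = tr 0 s (pa_closure P n s x)))"

lemma trace_exists: "\<exists>tr. is_trace tr"
  using traces
proof (elim exE)
  fix tr :: "nat \<Rightarrow> shade \<Rightarrow> 'a \<Rightarrow> complex"
  assume tr: "\<forall>n s.
        (\<forall>x\<in>box_space P n s. \<forall>y\<in>box_space P n s. tr n s (x + y) = tr n s x + tr n s y) \<and>
        (\<forall>c. \<forall>x\<in>box_space P n s. tr n s (cscale P c x) = c * tr n s x) \<and>
        (\<forall>x\<in>box_space P n s. \<forall>y\<in>box_space P n s.
           tr n s (pa_mult P n s x y) = tr n s (pa_mult P n s y x)) \<and>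
        (\<forall>x\<in>box_space P n s. \<exists>t\<ge>0. tr n s (pa_mult P n s (adj P x) x) = complex_of_real t) \<and>
        (\<forall>x\<in>box_space P n s. tr n s (pa_mult P n s (adj P x) x) = 0 \<longrightarrow> x = 0) \<and>
        (\<forall>x\<in>box_space P n s. tr n s x = tr 0 s (pa_closure P n s x))"
  have "is_trace tr"
    unfolding is_trace_def
  proof (intro allI conjI)
    fix n s
    show "traced_cstar (cscale P) (box_space P n s) (pa_mult P n s) (pa_one P n s) (adj P) (tr n s)"
      by (rule traced_cstar.intro; (rule vs sub findim_cstar cscale_real | use tr in blast))
    show "\<forall>x\<in>box_space P n s. tr n s x = tr 0 s (pa_closure P n s x)" using tr by blast
  qed
  then show "\<exists>tr. is_trace tr" by blast
qed

definition tr :: "nat \<Rightarrow> shade \<Rightarrow> 'a \<Rightarrow> complex" where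
  "tr = (SOME tr. is_trace tr)"

lemma is_trace_tr: "is_trace tr"
  unfolding tr_def using trace_exists by (rule someI_ex)

lemma traced_cstar: "traced_cstar (cscale P) (box_space P n s) (pa_mult P n s) (pa_one P n s) (adj P) (tr n s)"
  and tr_closure: "x \<in> box_space P n s \<Longrightarrow> tr n s x = tr 0 s (pa_closure P n s x)"
  using is_trace_tr unfolding is_trace_def by auto

lemma adj_val:
  assumes G: "fwf P s n G n" and G': "fwf P s n (freflect (adj P) G) n"
  shows "adj P (val P n s G) = val P n s (freflect (adj P) G)"
proof -
  let ?D = "number 0 G" and ?f = "\<lambda>i. contents G ! (i - 0)"
  let ?R = "rev (map (\<lambda>(a, e). (a, reflect_piece e)) ?D)"
  note N = numbered[OF G, of 0]
  have fR: "fill (\<lambda>i. adj P (?f i)) ?R = freflect (adj P) G"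
    using fill_reflect[of "adj P" ?f ?D] N(3) by simp
  have T: "is_tangle (Tangle n s ?R)"
    using wf_fill[of P s n "\<lambda>i. adj P (?f i)" ?R n] fR G'
    by (simp add: is_tangle_def labels_reflect)
  have "adj P (val P n s G) = act P (Tangle n s ?R) (\<lambda>i. adj P (?f i))"
    using adj_act[OF N(1,2)] by (simp add: val_def reflect_tangle_def)
  also have "\<dots> = val P n s (freflect (adj P) G)"
    using act_val[OF T, of "\<lambda>i. adj P (?f i)"] fR G' by simp
  finally show ?thesis .
qed

lemma adj_closed [simp]: "x \<in> box_space P n s \<Longrightarrow> adj P x \<in> box_space P n s"
  using traced_cstar.star_in[OF traced_cstar] .

lemma adj_bar:
  assumes [simp]: "y \<in> box_space P 1 s"
  shows "adj P (bar P s y) = bar P s (adj P y)"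
proof -
  have "adj P (val P 1 (opp s) [(1, FCup), (1, FBox y 1), (0, FCap)]) =
      val P 1 (opp s) [(0, FCup), (1, FBox (adj P y) 1), (1, FCap)]"
    by (subst adj_val) (simp_all del: One_nat_def)
  moreover have "val P 1 (opp s) [(1, FCup), (1, FBox y 1), (0, FCap)] = bar P s y"
    by (simp add: bar_def val_def)
  ultimately show ?thesis using bar_turn[of "adj P y" s] by (simp del: One_nat_def)
qed

lemma adj_juxtapose:
  assumes [simp]: "a \<in> box_space P 1 s" "b \<in> box_space P 1 (opp s)"
  shows "adj P (juxtapose P s a b) = juxtapose P s (adj P a) (adj P b)"
proof -
  have "adj P (val P 2 s [(0, FBox a 1), (1, FBox b 1)]) =
      val P 2 s [(1, FBox (adj P b) 1), (0, FBox (adj P a) 1)]"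
    by (subst adj_val) (simp_all del: One_nat_def)
  also have "\<dots> = val P 2 s [(0, FBox (adj P a) 1), (1, FBox (adj P b) 1)]"
    by (rule val_isotopic[where ps = "[0]" and qs = "[]"])
      (simp del: One_nat_def, simp del: One_nat_def, simp add: eval_nat_numeral)
  finally show ?thesis by (simp add: juxtapose_def val_def)
qed

text \<open>Reflection in a horizontal line reverses the sense of rotation.\<close>

lemma adj_fourier:
  assumes [simp]: "x \<in> box_space P 2 s"
  shows "adj P (fourier P s x) = fourier_inv s (adj P x)"
proof -
  have "adj P (val P 2 (opp s) [(0, FCup), (1, FBox x 2), (2, FCap)]) =
      val P 2 (opp s) [(2, FCup), (1, FBox (adj P x) 2), (0, FCap)]"
    by (subst adj_val) (simp_all del: One_nat_def)
  then show ?thesis by (simp add: fourier_def fourier_inv_def val_def)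
qed

lemma adj_conv_left:
  assumes [simp]: "y \<in> box_space P 1 s" "u \<in> box_space P 2 (opp s)"
  shows "adj P (conv_left P s y u) = conv_left P s (adj P y) (adj P u)"
proof -
  have "adj P (val P 1 s [(0, FCup), (0, FBox y 1), (1, FBox u 2), (0, FCap)]) =
      val P 1 s [(0, FCup), (1, FBox (adj P u) 2), (0, FBox (adj P y) 1), (0, FCap)]"
    by (subst adj_val) (simp_all del: One_nat_def)
  also have "\<dots> = val P 1 s [(0, FCup), (0, FBox (adj P y) 1), (1, FBox (adj P u) 2), (0, FCap)]"
    by (rule val_isotopic[where ps = "[1]" and qs = "[]"])
      (simp del: One_nat_def, simp del: One_nat_def, simp add: eval_nat_numeral)
  finally show ?thesis by (simp add: conv_left_def val_def)
qed

end

section \<open>Closure and linearity of the operations\<close>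

context planar begin

lemma bar_closed [simp]: "y \<in> box_space P 1 s \<Longrightarrow> bar P s y \<in> box_space P 1 (opp s)"
  using val_closed[of "opp s" 1 "[(1, FCup), (1, FBox y 1), (0, FCap)]"] by (simp add: bar_def val_def)

lemma fourier_closed [simp]: "x \<in> box_space P 2 s \<Longrightarrow> fourier P s x \<in> box_space P 2 (opp s)"
  using val_closed[of "opp s" 2 "[(0, FCup), (1, FBox x 2), (2, FCap)]"] by (simp add: fourier_def val_def)

lemma juxtapose_closed [simp]:
  "a \<in> box_space P 1 s \<Longrightarrow> b \<in> box_space P 1 (opp s) \<Longrightarrow> juxtapose P s a b \<in> box_space P 2 s"
  using val_closed[of s 2 "[(0, FBox a 1), (1, FBox b 1)]"] by (simp add: juxtapose_def val_def)

lemma conv_left_closed [simp]: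
  "y \<in> box_space P 1 s \<Longrightarrow> u \<in> box_space P 2 (opp s) \<Longrightarrow> conv_left P s y u \<in> box_space P 1 s"
  using val_closed[of s 1 "[(0, FCup), (0, FBox y 1), (1, FBox u 2), (0, FCap)]"]
  by (simp add: conv_left_def val_def)

lemma conv_right_closed [simp]:
  "u \<in> box_space P 2 s \<Longrightarrow> z \<in> box_space P 1 s \<Longrightarrow> conv_right P s u z \<in> box_space P 1 s"
  using val_closed[of s 1 "[(1, FCup), (0, FBox u 2), (2, FBox z 1), (1, FCap)]"]
  by (simp add: conv_right_def val_def)

lemma conv_closed [simp]:
  "u \<in> box_space P 2 s \<Longrightarrow> v \<in> box_space P 2 s \<Longrightarrow> conv P s u v \<in> box_space P 2 s"
  using val_closed[of s 2 "[(1, FCup), (0, FBox u 2), (2, FBox v 2), (1, FCap)]"]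
  by (simp add: conv_def val_def)

lemma bar_linear:
  assumes "y \<in> box_space P 1 s" "z \<in> box_space P 1 s"
  shows "bar P s (y + z) = bar P s y + bar P s z" "bar P s (cscale P c y) = cscale P c (bar P s y)"
  using val_linear[of "opp s" 1 "[(1, FCup)]" 1 y 1 "[(0, FCap)]" z] assms
  by (simp_all add: bar_def val_def)

lemma conv_left_linear1:
  assumes "y \<in> box_space P 1 s" "z \<in> box_space P 1 s" "u \<in> box_space P 2 (opp s)"
  shows "conv_left P s (y + z) u = conv_left P s y u + conv_left P s z u"
    "conv_left P s (cscale P c y) u = cscale P c (conv_left P s y u)"
  using val_linear[of s 1 "[(0, FCup)]" 0 y 1 "[(1, FBox u 2), (0, FCap)]" z] assms
  by (simp_all add: conv_left_def val_def)

lemma conv_left_linear2: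
  assumes "y \<in> box_space P 1 s" "u \<in> box_space P 2 (opp s)" "v \<in> box_space P 2 (opp s)"
  shows "conv_left P s y (u + v) = conv_left P s y u + conv_left P s y v"
    "conv_left P s y (cscale P c u) = cscale P c (conv_left P s y u)"
  using val_linear[of s 1 "[(0, FCup), (0, FBox y 1)]" 1 u 2 "[(0, FCap)]" v] assms
  by (simp_all add: conv_left_def val_def)

end

section \<open>Left and right legs of a 2-box\<close>

locale planar_legs = cplanar P for P :: "('a::real_normed_vector, 'm) star_planar_algebra_scheme" +
  fixes s :: shade
begin

declare One_nat_def [simp del]

sublocale M: traced_cstar "cscale P" "box_space P 1 s" "pa_mult P 1 s" "pa_one P 1 s" "adj P" "tr 1 s"
  by (rule traced_cstar)
sublocale N: traced_cstar "cscale P" "box_space P 1 (opp s)" "pa_mult P 1 (opp s)" "pa_one P 1 (opp s)" "adj P" "tr 1 (opp s)"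
  by (rule traced_cstar)
sublocale B: traced_cstar "cscale P" "box_space P 2 (opp s)" "pa_mult P 2 (opp s)" "pa_one P 2 (opp s)" "adj P" "tr 2 (opp s)"
  by (rule traced_cstar)
sublocale C: traced_cstar "cscale P" "box_space P 2 s" "pa_mult P 2 s" "pa_one P 2 s" "adj P" "tr 2 s"
  by (rule traced_cstar)

abbreviation M where "M \<equiv> box_space P 1 s"
abbreviation B where "B \<equiv> box_space P 2 (opp s)"
abbreviation mmult (infixl "\<cdot>" 70) where "a \<cdot> b \<equiv> pa_mult P 1 s a b"
abbreviation bmult (infixl "\<odot>" 70) where "u \<odot> v \<equiv> pa_mult P 2 (opp s) u v"
abbreviation conv_l (infixl "\<star>" 72) where "v \<star> u \<equiv> conv_left P s v u"
abbreviation one where "one \<equiv> pa_one P 1 s"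

text \<open>
  \<open>L a\<close> and \<open>R a\<close> act on the left and on the right string of a 2-box \<open>u\<close> of shading \<open>opp s\<close>. In
  \<open>v \<star> u\<close> the left string can be slid back into \<open>v\<close>; this reverses the order of factors.
\<close>

definition L :: "'a \<Rightarrow> 'a" where "L a = juxtapose P (opp s) (bar P s a) (pa_one P 1 s)"
definition R :: "'a \<Rightarrow> 'a" where "R a = juxtapose P (opp s) (pa_one P 1 (opp s)) a"

lemma positive_iff: "positive P 1 s = M.pos" "positive P 1 (opp s) = N.pos" "positive P 2 (opp s) = B.pos"
  by (auto simp: fun_eq_iff positive_def M.pos_def N.pos_def B.pos_def)

lemma projection_iff: "projection P 1 s = M.proj" "projection P 1 (opp s) = N.proj"
  by (auto simp: fun_eq_iff projection_def M.proj_def N.proj_def)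

lemma range_proj_eq: "range_proj P 1 s = M.rng" "range_proj P 1 (opp s) = N.rng"
  by (simp_all add: fun_eq_iff range_proj_def M.rng_def N.rng_def projection_iff positive_iff below_def)

lemma LR_in [simp]: assumes "a \<in> M" shows "L a \<in> B" "R a \<in> B"
  using assms bar_closed[of a s] N.e_in M.e_in juxtapose_closed[of _ "opp s"]
  by (simp_all add: L_def R_def)

lemma L_mult: assumes [simp]: "a \<in> M" "b \<in> M" shows "L a \<odot> L b = L (b \<cdot> a)"
  using juxtapose_mult[of "bar P s a" "opp s" one "bar P s b" one] bar_mult[of b s a]
  by (simp add: L_def bar_closed)

lemma LR_commute: assumes [simp]: "a \<in> M" "b \<in> M" shows "L a \<odot> R b = R b \<odot> L a"
  using juxtapose_mult[of "bar P s a" "opp s" one "pa_one P 1 (opp s)" b]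
    juxtapose_mult[of "pa_one P 1 (opp s)" "opp s" b "bar P s a" one]
  by (simp add: R_def L_def bar_closed)

lemma adj_L: assumes [simp]: "a \<in> M" shows "adj P (L a) = L (adj P a)"
  using adj_juxtapose[of "bar P s a" "opp s" one] adj_bar[of a s]
  by (simp add: L_def bar_closed)

lemma adj_R: assumes [simp]: "a \<in> M" shows "adj P (R a) = R (adj P a)"
  using adj_juxtapose[of "pa_one P 1 (opp s)" "opp s" a]
  by (simp add: R_def)

lemma conv_L:
  assumes "v \<in> M" "a \<in> M" "u \<in> B"
  shows "v \<star> (L a \<odot> u) = (a \<cdot> v) \<star> u" "v \<star> (u \<odot> L a) = (v \<cdot> a) \<star> u"
  using assms conv_left_bar_mult[of v s a u] conv_left_mult_bar[of v s a u]
  by (simp_all add: L_def)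

lemma conv_R:
  assumes "v \<in> M" "a \<in> M" "u \<in> B"
  shows "v \<star> (R a \<odot> u) = a \<cdot> (v \<star> u)" "v \<star> (u \<odot> R a) = (v \<star> u) \<cdot> a"
  using assms conv_left_right_mult[of v s a u] conv_left_mult_right[of v s a u]
  by (simp_all add: R_def)

lemma conv_in [simp]: "v \<in> M \<Longrightarrow> u \<in> B \<Longrightarrow> v \<star> u \<in> M"
  by (rule conv_left_closed)

lemma conv_simps1:
  assumes "v \<in> M" "w \<in> M" "u \<in> B"
  shows "(v + w) \<star> u = v \<star> u + w \<star> u" "(v - w) \<star> u = v \<star> u - w \<star> u"
    "cscale P c v \<star> u = cscale P c (v \<star> u)" "(r *\<^sub>R v) \<star> u = r *\<^sub>R (v \<star> u)"
proof -
  note lin = conv_left_linear1[OF _ _ assms(3)]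
  show "(v + w) \<star> u = v \<star> u + w \<star> u" "cscale P c v \<star> u = cscale P c (v \<star> u)"
    using lin assms by auto
  show "(r *\<^sub>R v) \<star> u = r *\<^sub>R (v \<star> u)"
    using lin(2)[OF assms(1,2), of "of_real r"] by (simp only: M.scl_real)
  have "cscale P (-1) w = - w" by simp
  then show "(v - w) \<star> u = v \<star> u - w \<star> u"
    using lin(1)[of v "- w"] lin(2)[OF assms(2,1), of "-1"] assms
    by simp
qed

lemma conv_simps2:
  assumes "v \<in> M" "u \<in> B" "w \<in> B"
  shows "v \<star> (u + w) = v \<star> u + v \<star> w" "v \<star> (u - w) = v \<star> u - v \<star> w"
proof -
  note lin = conv_left_linear2[OF assms(1)]
  show "v \<star> (u + w) = v \<star> u + v \<star> w" using lin assms by auto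
  show "v \<star> (u - w) = v \<star> u - v \<star> w"
    using lin(1)[of u "- w"] lin(2)[OF assms(3,2), of "-1"] assms
    by simp
qed

lemma tr_conv_one:
  assumes D [simp]: "D \<in> B"
  shows "tr 1 s (one \<star> (D \<odot> adj P D)) =
    tr 2 s (pa_mult P 2 s (fourier P (opp s) D) (adj P (fourier P (opp s) D)))"
proof -
  have F: "fourier P (opp s) D \<in> box_space P 2 s" using fourier_closed[OF D] by simp
  have "tr 1 s (one \<star> (D \<odot> adj P D)) = tr 0 s (pa_closure P 1 s (one \<star> (D \<odot> adj P D)))"
    by (rule tr_closure) simp
  also have "\<dots> = tr 0 s (pa_closure P 2 s (pa_mult P 2 s (fourier P (opp s) D) (fourier_inv (opp s) (adj P D))))"
    using closure_conv_left_one[of D s "adj P D"] by simp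
  also have "fourier_inv (opp s) (adj P D) = adj P (fourier P (opp s) D)"
    using adj_fourier[OF D] by simp
  also have "tr 0 s (pa_closure P 2 s (pa_mult P 2 s (fourier P (opp s) D) (adj P (fourier P (opp s) D)))) =
      tr 2 s (pa_mult P 2 s (fourier P (opp s) D) (adj P (fourier P (opp s) D)))"
    by (rule tr_closure[symmetric]) (use F in simp)
  finally show ?thesis .
qed

lemma tr_conv_one_nonneg: "D \<in> B \<Longrightarrow> 0 \<le> Re (tr 1 s (one \<star> (D \<odot> adj P D)))"
  using C.tr_pos[of "adj P (fourier P (opp s) D)"] fourier_closed[of D "opp s"] tr_conv_one[of D]
  by auto

text \<open>Faithfulness of the trace on 2-boxes of shading \<open>s\<close>, pulled back along the
  injective Fourier transform.\<close>

lemma conv_one_eq_0D: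
  assumes D: "D \<in> B" and 0: "one \<star> (D \<odot> adj P D) = 0"
  shows "D = 0"
proof -
  have F: "fourier P (opp s) D \<in> box_space P 2 s" using fourier_closed[OF D] by simp
  have "adj P (fourier P (opp s) D) = 0"
    using C.tr_faithful[of "adj P (fourier P (opp s) D)"] tr_conv_one[OF D] F 0
    by simp
  then have "fourier P (opp s) D = 0" using F by (metis C.star_0 C.star_star)
  moreover have "fourier P (opp s) 0 = 0"
    using fourier_inv_fourier[of 0 s] val_linear(2)[of s 2 "[(0, FCup)]" 1 0 2 "[(2, FCap)]" 0 0] 
    by (simp add: fourier_def val_def)
  ultimately show "D = 0" using fourier_inv_fourier[of D "opp s"] fourier_inv_fourier[of 0 "opp s"] D
    by (metis B.zero_in)
qed

text \<open>A Schur product argument. With \<open>y = adj P w \<cdot> w\<close> and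
  \<open>u = adj P k \<odot> k\<close>, the factors \<open>w\<close> and a test element
  \<open>m\<close> slide onto the two legs of \<open>k\<close>, and the compression of
  \<open>y \<star> u\<close> by \<open>m\<close> becomes
  \<open>one \<star> (D \<odot> adj P D)\<close>, whose trace is nonnegative.\<close>

lemma conv_pos:
  assumes y: "M.pos y" and u: "B.pos u"
  shows "M.pos (y \<star> u)"
proof -
  obtain w where w: "w \<in> M" "y = adj P w \<cdot> w" using y by (auto simp: M.pos_def)
  obtain k where k: "k \<in> B" "u = adj P k \<odot> k" using u by (auto simp: B.pos_def)
  have yu [simp]: "y \<in> M" "u \<in> B" using y u by auto
  show ?thesis
  proof (subst M.pos_iff)
    show "adj P (y \<star> u) = y \<star> u" using adj_conv_left[of y s u] y u by (simp add: M.pos_sa B.pos_sa)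
    show "\<forall>m\<in>M. 0 \<le> Re (tr 1 s (adj P m \<cdot> (y \<star> u) \<cdot> m))"
    proof
      fix m assume m: "m \<in> M"
      let ?D = "R (adj P m) \<odot> (L (adj P w) \<odot> adj P k)"
      have D: "?D \<in> B" using m w k by simp
      have aD: "adj P ?D = (k \<odot> L w) \<odot> R m"
        using m w k by (simp add: B.star_mul adj_L adj_R)
      have "?D \<odot> adj P ?D = R (adj P m) \<odot> ((L (adj P w) \<odot> (u \<odot> L w)) \<odot> R m)"
        unfolding aD k(2) using m w(1) k(1) by (simp add: B.mul_assoc)
      then have "one \<star> (?D \<odot> adj P ?D) = adj P m \<cdot> ((one \<star> (L (adj P w) \<odot> (u \<odot> L w))) \<cdot> m)"
        using m w(1) by (simp add: conv_R)
      also have "one \<star> (L (adj P w) \<odot> (u \<odot> L w)) = y \<star> u"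
        using w by (simp add: conv_L)
      also have "adj P m \<cdot> ((y \<star> u) \<cdot> m) = adj P m \<cdot> (y \<star> u) \<cdot> m"
        using m by (simp add: M.mul_assoc)
      finally show "0 \<le> Re (tr 1 s (adj P m \<cdot> (y \<star> u) \<cdot> m))"
        using tr_conv_one_nonneg[OF D] by simp
    qed
  qed simp
qed

end

section \<open>Perron-Frobenius data\<close>

locale PF = planar_legs P s for P :: "('a::real_normed_vector, 'm) star_planar_algebra_scheme" and s +
  fixes x :: 'a
  assumes x [simp]: "x \<in> box_space P 2 s" and F_pos: "F_positive P s x"
begin

abbreviation xh where "xh \<equiv> fourier P s x"
abbreviation r where "r \<equiv> PF_radius P s x"
abbreviation p where "p \<equiv> p_max P s x"
abbreviation Phi where "Phi v \<equiv> v \<star> xh"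
definition E where "E = pos_part P 1 s (PF_space P s x)"

lemma xh [simp]: "xh \<in> B" by (rule fourier_closed[OF x])

lemma xh_pos: "B.pos xh"
  using F_pos by (simp add: F_positive_def positive_iff)

lemma E_iff: "y \<in> E \<longleftrightarrow> M.pos y \<and> Phi y = r *\<^sub>R y"
  by (auto simp: E_def pos_part_def PF_space_def positive_iff)

lemma Phi_pos: "M.pos y \<Longrightarrow> M.pos (Phi y)"
  by (rule conv_pos[OF _ xh_pos])

text \<open>The cone \<open>E\<close> contains 0 and is closed under sums, so some element has the
  largest support; \<open>p\<close> is that support, possibly 0.\<close>

lemma p_max_E: "\<exists>y\<in>E. p = M.rng y" and E_corner: "y \<in> E \<Longrightarrow> p \<cdot> y = y"
proof -
  obtain y where y: "y \<in> E" and max: "\<And>z. z \<in> E \<Longrightarrow> M.rng y \<cdot> z = z"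
  proof (rule M.maximal_support[of E])
    show "M.pos z" if "z \<in> E" for z using that E_iff by blast
    show "0 \<in> E" using conv_simps1(3)[of 0 0 xh 0] by (simp add: E_iff)
    show "z + w \<in> E" if "z \<in> E" "w \<in> E" for z w
      using that by (simp add: E_iff M.pos_add conv_simps1 scaleR_add_right)
  qed blast
  have le: "M.pos (M.rng y - M.rng z)" if z: "z \<in> E" for z
  proof -
    have zM: "z \<in> M" "adj P z = z" "y \<in> M" "adj P y = y" using z y by (auto simp: E_iff M.pos_sa)
    obtain "M.proj (M.rng y)" "M.proj (M.rng z)" "M.rng y \<cdot> M.rng z = M.rng z"
      using M.support[OF zM(1,2)] M.support[OF zM(3,4)] max[OF z] by metis
    then show ?thesis by (simp add: M.proj_le_iff)
  qed
  have "p = M.rng y" unfolding p_max_def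
  proof (rule the_equality)
    show "M.rng y \<in> PF_projections P s x \<and> (\<forall>q\<in>PF_projections P s x. below P 1 s q (M.rng y))"
      using y le by (auto simp: PF_projections_def range_proj_eq E_def[symmetric] below_def positive_iff)
  next
    fix q assume q: "q \<in> PF_projections P s x \<and> (\<forall>q'\<in>PF_projections P s x. below P 1 s q' q)"
    then have "M.pos (M.rng y - q)" "M.pos (- (M.rng y - q))"
      using y le by (auto simp: PF_projections_def range_proj_eq E_def[symmetric] below_def positive_iff)
    then show "q = M.rng y" using M.pos_antisym by fastforce
  qed
  then show "\<exists>y\<in>E. p = M.rng y" and "y \<in> E \<Longrightarrow> p \<cdot> y = y" for y using y max by auto
qed

lemma E_support:
  assumes "y \<in> E"
  shows "M.proj (M.rng y)" "\<exists>c>0. M.pos (c *\<^sub>R y - M.rng y)"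
  using assms M.support[of y] by (metis E_iff M.pos_in M.pos_sa)+

lemma p_proj: "M.proj p"
  using p_max_E E_support by metis

lemma p_in [simp]: "p \<in> M" and p_adj [simp]: "adj P p = p" and p_idem [simp]: "p \<cdot> p = p"
  using p_proj by (auto simp: M.proj_def)

lemma corner_sym: "y \<in> M \<Longrightarrow> adj P y = y \<Longrightarrow> p \<cdot> y = y \<longleftrightarrow> y \<cdot> p = y"
  by (metis M.star_mul p_adj p_in)

lemma corner_bound:
  assumes "M.pos v" "p \<cdot> v = v"
  shows "M.pos (norm v *\<^sub>R p - v)"
proof -
  have v: "v \<in> M" "adj P v = v" "v \<cdot> p = v" using assms corner_sym by (auto simp: M.pos_sa)
  have "M.pos (adj P p \<cdot> (norm v *\<^sub>R one - v) \<cdot> p)"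
    by (rule M.pos_conj[OF M.pos_le_norm]) (use v in auto)
  then show ?thesis using v assms(2) by (simp add: M.mul_diff M.diff_mul)
qed

lemma Phi_0: "Phi 0 = 0"
  using conv_simps1(2)[of 0 0 xh] by simp

lemma conv_power_closed: "conv_power P (opp s) xh j \<in> B"
proof -
  have "((\<lambda>v. conv P (opp s) v xh) ^^ n) xh \<in> B" for n
    by (induction n) (auto intro: conv_closed)
  then show ?thesis by (simp add: conv_power_def)
qed

text \<open>Associativity turns convolution powers into iterates of \<open>Phi\<close>, which is the
  form in which the ergodic theorem applies.\<close>

lemma conv_left_power_eq: assumes "v \<in> M" shows "conv_left_power P s v xh j = (Phi ^^ j) v"
proof (induction j)
  case (Suc j)
  show ?case
  proof (cases j)
    case 0
    then show ?thesis by (simp add: conv_left_power_def conv_power_def)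
  next
    case (Suc i)
    have "conv_power P (opp s) xh (Suc j) = conv P (opp s) (conv_power P (opp s) xh j) xh"
      by (simp add: conv_power_def Suc)
    then have "conv_left_power P s v xh (Suc j) = Phi (conv_left_power P s v xh j)"
      using conv_left_assoc[of v s "conv_power P (opp s) xh j" xh] assms conv_power_closed Suc
      by (simp add: conv_left_power_def)
    then show ?thesis using Suc.IH by simp
  qed
qed (simp add: conv_left_power_def)

lemma zeta_eqI:
  assumes "((\<lambda>z. (z - r) *\<^sub>R (\<Sum>j. (1 / z ^ (j + 1)) *\<^sub>R (Phi ^^ j) p)) \<longlongrightarrow> f) (at_right r)"
  shows "PF_zeta P s x = f"
  unfolding PF_zeta_def using assms by (intro tendsto_Lim) (simp_all add: conv_left_power_eq)

text \<open>For negative \<open>r\<close> both \<open>r *\<^sub>R y = Phi y\<close> and its negative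
  are positive. The sign of \<open>r\<close>, a real supremum, is not taken for granted.\<close>

lemma E_trivial: "y \<in> E \<Longrightarrow> r < 0 \<Longrightarrow> y = 0"
  using Phi_pos[of y] M.pos_scaleR[of y "- r"] M.pos_antisym[of "r *\<^sub>R y"]
  by (auto simp: E_iff)

text \<open>Some \<open>y\<close> in \<open>E\<close> has support \<open>p\<close>, and
  \<open>T\<close> fixes it. From \<open>p\<close> below \<open>c *\<^sub>R y\<close> the orbit of
  \<open>p\<close> is bounded; from \<open>y\<close> below \<open>k *\<^sub>R p\<close> the averages
  of the orbit, and with them the limit, stay above \<open>y / k\<close>. So the limit dominates a
  multiple of \<open>p\<close>.\<close>

lemma zeta_pos_case:
  assumes r: "0 < r"
  shows "PF_zeta P s x \<in> E \<and> (\<exists>c\<ge>0. M.pos (c *\<^sub>R PF_zeta P s x - p))"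
proof -
  obtain y where y: "y \<in> E" "p = M.rng y" using p_max_E by blast
  obtain c where c: "c > 0" "M.pos (c *\<^sub>R y - p)" using E_support(2)[OF y(1)] y(2) by auto
  have yM [simp]: "y \<in> M" and y_pos: "M.pos y" and Py: "Phi y = r *\<^sub>R y" using y E_iff by auto
  define T where "T v = (1 / r) *\<^sub>R Phi v" for v
  have T_in [simp]: "T v \<in> M" if "v \<in> M" for v using that by (simp add: T_def)
  have Tn_in [simp]: "(T ^^ n) v \<in> M" if "v \<in> M" for v n using that by (induction n) auto
  have T_lin: "T (v + w) = T v + T w" "T (v - w) = T v - T w" "T (cscale P k v) = cscale P k (T v)"
    "T (l *\<^sub>R v) = l *\<^sub>R T v"
    if "v \<in> M" "w \<in> M" for v w k l
    using that conv_simps1[OF that xh]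
    by (simp_all add: T_def M.V.scale_right_distrib M.V.scale_right_diff_distrib mult.commute flip: M.scl_real)
  have Tn_lin: "(T ^^ n) (v + w) = (T ^^ n) v + (T ^^ n) w" "(T ^^ n) (v - w) = (T ^^ n) v - (T ^^ n) w"
    "(T ^^ n) (cscale P k v) = cscale P k ((T ^^ n) v)" "(T ^^ n) (l *\<^sub>R v) = l *\<^sub>R (T ^^ n) v"
    if "v \<in> M" "w \<in> M" for v w k l n
    using that by (induction n) (simp_all add: T_lin)
  have T_pos: "M.pos (T v)" if "M.pos v" for v
    using that Phi_pos r by (simp add: T_def M.pos_scaleR)
  have Tn_pos: "M.pos ((T ^^ n) v)" if "M.pos v" for v n using that by (induction n) (auto intro: T_pos)
  have Ty: "(T ^^ n) y = y" for n using r Py by (induction n) (auto simp: T_def)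
  \<comment> \<open>nothing is known about the norm of \<open>T\<close> outside the vectors with bounded orbits\<close>
  define W where "W = {v \<in> M. \<exists>C. \<forall>n. norm ((T ^^ n) v) \<le> C}"
  have W: "M.V.subspace W"
  proof (rule M.V.subspaceI)
    have "(T ^^ n) 0 = 0" for n using Tn_lin(2)[of 0 0 n] by simp
    then show "0 \<in> W" by (auto simp: W_def)
  next
    fix v w assume "v \<in> W" "w \<in> W"
    then obtain C D where "v \<in> M" "w \<in> M" "\<And>n. norm ((T ^^ n) v) \<le> C" "\<And>n. norm ((T ^^ n) w) \<le> D"
      by (auto simp: W_def)
    then have "v + w \<in> M" "norm ((T ^^ n) (v + w)) \<le> C + D" for n
      by (auto simp: Tn_lin intro: order_trans[OF norm_triangle_ineq] add_mono)
    then show "v + w \<in> W" by (auto simp: W_def)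
  next
    fix k v assume "v \<in> W"
    then obtain C where "v \<in> M" "\<And>n. norm ((T ^^ n) v) \<le> C" by (auto simp: W_def)
    then have "cscale P k v \<in> M" "norm ((T ^^ n) (cscale P k v)) \<le> cmod k * C" for n
      by (auto simp: Tn_lin(3)[of v v] M.norm_scl mult_left_mono)
    then show "cscale P k v \<in> W" by (auto simp: W_def)
  qed
  have pn: "M.pos (c *\<^sub>R y - (T ^^ n) p)" for n
    using Tn_pos[OF c(2), of n] Tn_lin(2)[of "c *\<^sub>R y" p n] Tn_lin(4)[of y y n c] Ty by simp
  have "norm ((T ^^ n) p) \<le> norm (c *\<^sub>R y)" for n
  proof (rule M.norm_le)
    show "M.pos ((T ^^ n) p)" by (rule Tn_pos[OF M.proj_pos[OF p_proj]])
    have "M.pos (norm (c *\<^sub>R y) *\<^sub>R one - c *\<^sub>R y)"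
      using y_pos by (intro M.pos_le_norm) (auto simp: M.star_scaleR M.pos_sa)
    then have "M.pos ((norm (c *\<^sub>R y) *\<^sub>R one - c *\<^sub>R y) + (c *\<^sub>R y - (T ^^ n) p))"
      using pn M.pos_add by blast
    then show "M.pos (norm (c *\<^sub>R y) *\<^sub>R one - (T ^^ n) p)" by simp
  qed simp
  then have pW: "p \<in> W" by (auto simp: W_def)
  obtain f where f: "f \<in> W" "T f = f"
    and summ: "\<And>t. 0 < t \<Longrightarrow> t < 1 \<Longrightarrow> summable (\<lambda>j. t ^ j *\<^sub>R (T ^^ j) p)"
    and cesaro: "(\<lambda>n. (1 / real n) *\<^sub>R (\<Sum>j<n. (T ^^ j) p)) \<longlonglongrightarrow> f"
    and abel: "((\<lambda>t. (1 - t) *\<^sub>R (\<Sum>j. t ^ j *\<^sub>R (T ^^ j) p)) \<longlongrightarrow> f) (at_left 1)"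
  proof (rule M.mean_ergodic[OF W _ pW, of T])
    show "T v \<in> W" if "v \<in> W" for v
    proof -
      obtain C where C: "v \<in> M" "\<And>n. norm ((T ^^ n) v) \<le> C"
        using \<open>v \<in> W\<close> by (auto simp: W_def)
      have "norm ((T ^^ n) (T v)) \<le> C" for n
        using C(2)[of "Suc n"] by (simp add: funpow_swap1)
      with C(1) have "T v \<in> M" "\<forall>n. norm ((T ^^ n) (T v)) \<le> C" by auto
      then show ?thesis by (auto simp: W_def)
    qed
  qed (auto simp: W_def T_lin)
  have fM [simp]: "f \<in> M" using f(1) by (simp add: W_def)
  \<comment> \<open>The summand 1 keeps \<open>k\<close> positive even if
    \<open>y = 0\<close>.\<close>
  define k where "k = norm y + 1"
  have k: "k > 0" by (simp add: k_def add_nonneg_pos)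
  have "M.pos (norm y *\<^sub>R p - y)" by (rule corner_bound[OF y_pos E_corner[OF y(1)]])
  then have "M.pos ((norm y *\<^sub>R p - y) + p)" by (rule M.pos_add[OF _ M.proj_pos[OF p_proj]])
  then have ky: "M.pos (k *\<^sub>R p - y)" by (simp add: k_def algebra_simps)
  have lower: "M.pos (k *\<^sub>R (T ^^ n) p - y)" for n
    using Tn_pos[OF ky, of n] Tn_lin(2)[of "k *\<^sub>R p" y n] Tn_lin(4)[of p p n k] Ty by simp
  have "M.pos (k *\<^sub>R f - y)"
  proof (rule M.pos_limit)
    let ?X = "\<lambda>n. k *\<^sub>R ((1 / real (Suc n)) *\<^sub>R (\<Sum>j<Suc n. (T ^^ j) p)) - y"
    show "?X \<longlonglongrightarrow> k *\<^sub>R f - y"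
      by (intro tendsto_intros LIMSEQ_Suc[OF cesaro])
    show "M.pos (?X n)" for n
    proof -
      have "M.pos ((1 / real (Suc n)) *\<^sub>R (\<Sum>j<Suc n. k *\<^sub>R (T ^^ j) p - y))"
        by (intro M.pos_scaleR M.pos_sum lower) simp
      also have "(1 / real (Suc n)) *\<^sub>R (\<Sum>j<Suc n. k *\<^sub>R (T ^^ j) p - y) = ?X n"
        by (simp only: sum_subtractf scaleR_sum_right[symmetric] sum_constant_scaleR card_lessThan
          scaleR_diff_right) (simp add: mult.commute)
      finally show ?thesis .
    qed
  qed simp
  note kf = this
  have "M.pos ((1 / k) *\<^sub>R ((k *\<^sub>R f - y) + y))"
    by (intro M.pos_scaleR M.pos_add kf y_pos) (use k in simp)
  then have "M.pos f" using k by simp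
  moreover have "Phi f = r *\<^sub>R f"
  proof -
    have "r *\<^sub>R T f = Phi f" using r by (simp add: T_def)
    then show ?thesis using f(2) by simp
  qed
  ultimately have fE: "f \<in> E" by (simp add: E_iff)
  have "M.pos ((c *\<^sub>R (k *\<^sub>R f - y)) + (c *\<^sub>R y - p))"
    by (intro M.pos_add M.pos_scaleR kf c) (use c in simp)
  then have fp: "M.pos ((c * k) *\<^sub>R f - p)" by (simp add: scaleR_diff_right)
  have Phi_T: "(Phi ^^ j) p = r ^ j *\<^sub>R (T ^^ j) p" for j
  proof (induction j)
    case (Suc j)
    have "Phi (r ^ j *\<^sub>R (T ^^ j) p) = r ^ j *\<^sub>R Phi ((T ^^ j) p)" by (rule conv_simps1(4)[where w = p]) auto
    also have "\<dots> = r ^ Suc j *\<^sub>R T ((T ^^ j) p)" using r by (simp add: T_def)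
    finally show ?case using Suc by simp
  qed simp
  have "PF_zeta P s x = f"
  proof (rule zeta_eqI)
    \<comment> \<open>The substitution is \<open>t = r / z\<close>: as \<open>z\<close> falls to
      \<open>r\<close>, \<open>t\<close> rises to 1.\<close>
    have lim: "((\<lambda>z. r / z) \<longlongrightarrow> 1) (at_right r)"
      using r by (auto intro!: tendsto_eq_intros)
    have ev: "\<forall>\<^sub>F z in at_right r. r < z" by (simp add: eventually_at_right_less)
    then have "\<forall>\<^sub>F z in at_right r. r / z \<in> {..<1} \<and> r / z \<noteq> 1"
      by (rule eventually_mono) (use r in auto)
    then have "filterlim (\<lambda>z. r / z) (at_left 1) (at_right r)"
      using lim by (auto simp: filterlim_at elim: eventually_mono)
    from filterlim_compose[OF abel this]
    show "((\<lambda>z. (z - r) *\<^sub>R (\<Sum>j. (1 / z ^ (j + 1)) *\<^sub>R (Phi ^^ j) p)) \<longlongrightarrow> f) (at_right r)"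
    proof (rule Lim_transform_eventually)
      show "\<forall>\<^sub>F z in at_right r. (1 - r / z) *\<^sub>R (\<Sum>j. (r / z) ^ j *\<^sub>R (T ^^ j) p) =
          (z - r) *\<^sub>R (\<Sum>j. (1 / z ^ (j + 1)) *\<^sub>R (Phi ^^ j) p)"
        using ev
      proof (rule eventually_mono)
        fix z assume z: "r < z"
        have "(1 / z ^ (j + 1)) *\<^sub>R (Phi ^^ j) p = (1 / z) *\<^sub>R ((r / z) ^ j *\<^sub>R (T ^^ j) p)" for j
          using z r by (simp add: Phi_T power_divide power_add)
        then have "(\<Sum>j. (1 / z ^ (j + 1)) *\<^sub>R (Phi ^^ j) p) =
            (1 / z) *\<^sub>R (\<Sum>j. (r / z) ^ j *\<^sub>R (T ^^ j) p)"
          using suminf_scaleR_right[OF summ[of "r / z"], of "1 / z"] z r by simp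
        then show "(1 - r / z) *\<^sub>R (\<Sum>j. (r / z) ^ j *\<^sub>R (T ^^ j) p) =
            (z - r) *\<^sub>R (\<Sum>j. (1 / z ^ (j + 1)) *\<^sub>R (Phi ^^ j) p)"
          using z r by (simp add: diff_divide_distrib)
      qed
    qed
  qed
  then show ?thesis using fE fp c k by (intro conjI exI[of _ "c * k"]) auto
qed

lemma zeta: "PF_zeta P s x \<in> E" "\<exists>c\<ge>0. M.pos (c *\<^sub>R PF_zeta P s x - p)"
proof -
  obtain y where y: "y \<in> E" "p = M.rng y" using p_max_E by blast
  obtain c where c: "c > 0" "M.pos (c *\<^sub>R y - p)" using E_support(2)[OF y(1)] y(2) by auto
  have pp: "M.pos p" by (rule M.proj_pos[OF p_proj])
  have "PF_zeta P s x \<in> E \<and> (\<exists>c\<ge>0. M.pos (c *\<^sub>R PF_zeta P s x - p))"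
  proof (cases "0 < r")
    case False
    \<comment> \<open>Only the term \<open>j = 0\<close> of the series survives, so the limit is
      \<open>p\<close>. If \<open>r = 0\<close>, then \<open>Phi p\<close> is squeezed between 0 and
      \<open>c *\<^sub>R Phi y = 0\<close>; if \<open>r\<close> is negative,
      \<open>E_trivial\<close> gives \<open>p = 0\<close>.\<close>
    have Phi_p: "Phi p = 0 \<and> (r = 0 \<or> p = 0)"
    proof (cases "r = 0")
      case True
      have "M.pos (Phi (c *\<^sub>R y - p))" by (rule Phi_pos[OF c(2)])
      also have "Phi (c *\<^sub>R y - p) = - Phi p"
        using y(1) True conv_simps1(4)[of y y xh c] by (simp add: conv_simps1 E_iff)
      finally show ?thesis using M.pos_antisym[OF Phi_pos[OF pp]] True by simp
    next
      case neg: False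
      then have "y = 0" using E_trivial[OF y(1)] False by simp
      then have "p = 0" using c(2) M.pos_antisym[OF pp] by simp
      then show ?thesis using Phi_0 by simp
    qed
    then have Phi_pn: "(Phi ^^ Suc n) p = 0" for n
      by (induction n) (auto simp: Phi_0)
    have "((\<lambda>z. (z - r) *\<^sub>R (\<Sum>j. (1 / z ^ (j + 1)) *\<^sub>R (Phi ^^ j) p)) \<longlongrightarrow> p) (at_right r)"
    proof (rule Lim_transform_eventually[OF tendsto_const])
      have "(\<Sum>j. (1 / z ^ (j + 1)) *\<^sub>R (Phi ^^ j) p) = (1 / z) *\<^sub>R p" for z :: real
      proof -
        have "(\<Sum>j. (1 / z ^ (j + 1)) *\<^sub>R (Phi ^^ j) p) = (\<Sum>j\<in>{0}. (1 / z ^ (j + 1)) *\<^sub>R (Phi ^^ j) p)"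
        proof (rule suminf_finite)
          fix n :: nat assume "n \<notin> {0}"
          then show "(1 / z ^ (n + 1)) *\<^sub>R (Phi ^^ n) p = 0" using Phi_pn by (cases n) auto
        qed simp
        then show ?thesis by simp
      qed
      moreover have "\<forall>\<^sub>F z in at_right r. r < z" by (simp add: eventually_at_right_less)
      ultimately show "\<forall>\<^sub>F z in at_right r. p = (z - r) *\<^sub>R (\<Sum>j. (1 / z ^ (j + 1)) *\<^sub>R (Phi ^^ j) p)"
        using Phi_p by (auto elim!: eventually_mono)
    qed
    then have "PF_zeta P s x = p" by (rule zeta_eqI)
    moreover have "p \<in> E" using Phi_p pp by (auto simp: E_iff)
    ultimately show ?thesis by (auto intro!: exI[of _ 1])
  qed (rule zeta_pos_case)
  then show "PF_zeta P s x \<in> E" "\<exists>c\<ge>0. M.pos (c *\<^sub>R PF_zeta P s x - p)" by auto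
qed

end

section \<open>The corner of \<open>p\<close> and the two algebras\<close>

context PF begin

abbreviation zeta where "zeta \<equiv> PF_zeta P s x"

lemma zeta_props [simp]: "zeta \<in> M" "adj P zeta = zeta" "p \<cdot> zeta = zeta" "zeta \<cdot> p = zeta"
  and zeta_pos: "M.pos zeta" and Phi_zeta: "Phi zeta = r *\<^sub>R zeta"
proof -
  show pos: "M.pos zeta" and "Phi zeta = r *\<^sub>R zeta" using zeta(1) E_iff by auto
  then show z: "zeta \<in> M" "adj P zeta = zeta" using M.pos_in M.pos_sa by auto
  show "p \<cdot> zeta = zeta" using E_corner[OF zeta(1)] .
  then show "zeta \<cdot> p = zeta" using corner_sym z by blast
qed

lemma zeta_dominates:
  assumes "M.pos v" "p \<cdot> v = v"
  shows "\<exists>c\<ge>0. M.pos (c *\<^sub>R zeta - v)"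
proof -
  obtain c where c: "c \<ge> 0" "M.pos (c *\<^sub>R zeta - p)" using zeta(2) by blast
  have "M.pos (norm v *\<^sub>R (c *\<^sub>R zeta - p) + (norm v *\<^sub>R p - v))"
    by (intro M.pos_add M.pos_scaleR c corner_bound assms) simp
  then have "M.pos ((norm v * c) *\<^sub>R zeta - v)" by (simp add: scaleR_diff_right)
  then show ?thesis using c by (intro exI[of _ "norm v * c"]) auto
qed

text \<open>If \<open>v\<close> lies below \<open>c *\<^sub>R zeta\<close>, then
  \<open>Phi v\<close> lies below \<open>(c * r) *\<^sub>R zeta\<close>, whose support is under
  \<open>p\<close>.\<close>

lemma Phi_corner:
  assumes "M.pos v" "p \<cdot> v = v"
  shows "p \<cdot> Phi v = Phi v" "Phi v \<cdot> p = Phi v"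
proof -
  obtain c where c: "c \<ge> 0" "M.pos (c *\<^sub>R zeta - v)" using zeta_dominates assms by blast
  have "M.pos (Phi (c *\<^sub>R zeta - v))" by (rule Phi_pos[OF c(2)])
  also have "Phi (c *\<^sub>R zeta - v) = Phi (c *\<^sub>R zeta) - Phi v"
    using assms by (intro conv_simps1) auto
  also have "Phi (c *\<^sub>R zeta) = c *\<^sub>R Phi zeta" by (rule conv_simps1(4)[where w = p]) auto
  finally have pos: "M.pos ((c * r) *\<^sub>R zeta - Phi v)" by (simp add: Phi_zeta)
  have "Phi v \<cdot> (one - p) = 0"
    by (rule M.pos_dominated[OF Phi_pos[OF assms(1)] pos]) (auto simp: M.mul_diff M.star_diff)
  then show "Phi v \<cdot> p = Phi v" using assms by (simp add: M.mul_diff)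
  then show "p \<cdot> Phi v = Phi v" using corner_sym[of "Phi v"] M.pos_sa[OF Phi_pos[OF assms(1)]] assms by simp
qed

lemma rng_zeta: "M.rng zeta = p"
proof -
  obtain c where c: "M.pos (c *\<^sub>R zeta - p)" using zeta(2) by blast
  have q: "M.proj (M.rng zeta)" "zeta \<cdot> M.rng zeta = zeta" "p \<cdot> M.rng zeta = M.rng zeta"
    using M.support[of zeta] p_proj by (metis zeta_props)+
  have "p \<cdot> (one - M.rng zeta) = 0"
    by (rule M.pos_dominated[OF M.proj_pos[OF p_proj] c])
      (use q in \<open>auto simp: M.mul_diff M.star_diff M.proj_sa\<close>)
  then show ?thesis using q by (simp add: M.mul_diff)
qed

definition xhp where "xhp = fourier P s (cut_down P s p x)"

definition Q where "Q = L p \<odot> R p"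

lemma Q [simp]: "Q \<in> B" "adj P Q = Q"
  by (auto simp: Q_def B.star_mul adj_L adj_R LR_commute)

lemma cut_down_in [simp]: "cut_down P s p x \<in> box_space P 2 s"
  unfolding cut_down_def by (simp add: bar_closed)

text \<open>Each of the four ends of \<open>x\<close> carries \<open>p\<close> or its rotation, and
  the Fourier transform moves them one by one to the ends of \<open>xh\<close>. The one-string
  factors commute, so they can be ordered to be peeled off from the outside.\<close>

lemma xhp_eq: "xhp = Q \<odot> xh \<odot> Q"
proof -
  let ?l = "juxtapose P s p (pa_one P 1 (opp s))" and ?r = "juxtapose P s one (bar P s p)"
  have b: "bar P s p \<in> box_space P 1 (opp s)" by (simp add: bar_closed)
  have lr [simp]: "?l \<in> box_space P 2 s" "?r \<in> box_space P 2 s" using b by auto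
  have J: "juxtapose P s p (bar P s p) = pa_mult P 2 s ?l ?r"
    "juxtapose P s p (bar P s p) = pa_mult P 2 s ?r ?l"
    using juxtapose_mult[of p s "pa_one P 1 (opp s)" one "bar P s p"]
      juxtapose_mult[of one s "bar P s p" p "pa_one P 1 (opp s)"] b by auto
  have "cut_down P s p x =
      pa_mult P 2 s (pa_mult P 2 s (pa_mult P 2 s ?l ?r) x) (pa_mult P 2 s ?r ?l)"
    unfolding cut_down_def using J by metis
  also have "\<dots> = pa_mult P 2 s ?l (pa_mult P 2 s (pa_mult P 2 s (pa_mult P 2 s ?r x) ?r) ?l)"
    by (simp add: C.mul_assoc)
  finally have "xhp = fourier P s \<dots>" by (simp add: xhp_def)
  also have "\<dots> = R p \<odot> (L p \<odot> xh) \<odot> R p \<odot> L p"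
    using fourier_left_mult[of "pa_mult P 2 s (pa_mult P 2 s (pa_mult P 2 s ?r x) ?r) ?l" s p]
      fourier_mult_left[of "pa_mult P 2 s (pa_mult P 2 s ?r x) ?r" s p]
      fourier_mult_bar[of "pa_mult P 2 s ?r x" s p] fourier_bar_mult[of x s p]
    by (simp add: L_def R_def)
  also have "\<dots> = (R p \<odot> L p) \<odot> xh \<odot> (R p \<odot> L p)" by (simp add: B.mul_assoc)
  finally show ?thesis by (simp add: Q_def LR_commute)
qed

lemma xhp_in [simp]: "xhp \<in> B" by (simp add: xhp_eq)

lemma xhp_adj: "adj P xhp = xhp"
  using B.pos_sa[OF xh_pos] by (simp add: xhp_eq B.star_mul B.mul_assoc)

lemma conv_xhp: assumes "v \<in> M" shows "v \<star> xhp = p \<cdot> Phi (p \<cdot> v \<cdot> p) \<cdot> p"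
proof -
  have "xhp = L p \<odot> (R p \<odot> (xh \<odot> L p \<odot> R p))"
    by (simp add: xhp_eq Q_def B.mul_assoc)
  then show ?thesis using assms by (simp add: conv_L conv_R M.mul_assoc)
qed

text \<open>On the corner the cut-down does not change \<open>Phi\<close>. Eigenvector equations for
  \<open>xh\<close> can thus be combined with the algebras, which are defined through
  \<open>xhp\<close>.\<close>

lemma conv_xhp_corner: "M.pos v \<Longrightarrow> p \<cdot> v = v \<Longrightarrow> v \<star> xhp = Phi v"
  using corner_sym[of v] M.pos_sa[of v] Phi_corner[of v] by (simp add: conv_xhp)

lemma fourier_inj: "u \<in> box_space P 2 s \<Longrightarrow> v \<in> box_space P 2 s \<Longrightarrow> fourier P s u = fourier P s v \<Longrightarrow> u = v"
  by (metis fourier_inv_fourier)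

text \<open>Under the injective Fourier transform, commutation becomes the freedom to move
  \<open>y\<close> below \<open>xhp\<close> from the right leg to the left one.\<close>

lemma A_iff: "y \<in> PF_algebra_A P s x \<longleftrightarrow> y \<in> M \<and> R y \<odot> xhp = L y \<odot> xhp"
proof -
  have "pa_mult P 2 s (cut_down P s p x) (juxtapose P s one (bar P s y)) =
      pa_mult P 2 s (juxtapose P s one (bar P s y)) (cut_down P s p x) \<longleftrightarrow> R y \<odot> xhp = L y \<odot> xhp"
    if y: "y \<in> M"
    using fourier_mult_bar[OF cut_down_in y] fourier_bar_mult[OF cut_down_in y] y
    by (simp add: L_def R_def xhp_def) (metis C.mul_in M.e_in bar_closed cut_down_in fourier_inj juxtapose_closed)
  then show ?thesis unfolding PF_algebra_A_def by auto
qed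

lemma B_iff: "y \<in> PF_algebra_B P s x \<longleftrightarrow> y \<in> M \<and> xhp \<odot> R y = xhp \<odot> L y"
proof -
  have "pa_mult P 2 s (cut_down P s p x) (juxtapose P s y (pa_one P 1 (opp s))) =
      pa_mult P 2 s (juxtapose P s y (pa_one P 1 (opp s))) (cut_down P s p x) \<longleftrightarrow> xhp \<odot> R y = xhp \<odot> L y"
    if y: "y \<in> M"
    using fourier_mult_left[OF cut_down_in y] fourier_left_mult[OF cut_down_in y] y
    by (simp add: L_def R_def xhp_def) (metis C.mul_in N.e_in cut_down_in fourier_inj juxtapose_closed)
  then show ?thesis unfolding PF_algebra_B_def by auto
qed

lemma B_adj: assumes "y \<in> M" shows "y \<in> PF_algebra_B P s x \<longleftrightarrow> adj P y \<in> PF_algebra_A P s x"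
proof -
  have "xhp \<odot> R y = xhp \<odot> L y \<longleftrightarrow> adj P (xhp \<odot> R y) = adj P (xhp \<odot> L y)"
    using assms by (metis B.mul_in B.star_star LR_in xhp_in)
  then show ?thesis using assms by (simp add: A_iff B_iff B.star_mul adj_L adj_R xhp_adj)
qed

lemma A_zeta_pos:
  assumes a: "a \<in> PF_algebra_A P s x" and pos: "M.pos (a \<cdot> zeta)"
  shows "a \<cdot> zeta \<in> E"
proof -
  have aM [simp]: "a \<in> M" and eq: "R a \<odot> xhp = L a \<odot> xhp" using a A_iff by auto
  let ?z = "a \<cdot> zeta"
  \<comment> \<open>The support of \<open>zeta\<close> gives the right side; since \<open>?z\<close>
    is self-adjoint, the left side follows without any condition on the support of
    \<open>a\<close>.\<close>
  have "?z \<cdot> p = ?z" by (simp add: M.mul_assoc)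
  then have pz: "p \<cdot> ?z = ?z" using corner_sym[of ?z] M.pos_sa[OF pos] by simp
  have "Phi ?z = ?z \<star> xhp" by (rule conv_xhp_corner[OF pos pz, symmetric])
  also have "\<dots> = zeta \<star> (L a \<odot> xhp)" by (simp add: conv_L)
  also have "\<dots> = a \<cdot> (zeta \<star> xhp)" by (simp add: eq[symmetric] conv_R)
  also have "zeta \<star> xhp = r *\<^sub>R zeta" using conv_xhp_corner[OF zeta_pos] Phi_zeta by simp
  finally show ?thesis using pos by (simp add: E_iff)
qed

end

section \<open>The functional of the right eigenvector and the factorization\<close>

locale PF_right = PF +
  fixes y1 :: 'a
  assumes y1: "right_PF_eigenvector P s x y1"
    and meet: "proj_meet P 1 s (p_max P s x)
           (perp P 1 s (bar P (opp s) (range_proj P 1 (opp s) y1))) = 0"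
begin

lemma y1_pos: "N.pos y1" and Psi_y1: "conv_right P (opp s) xh y1 = r *\<^sub>R y1"
  using y1 by (auto simp: right_PF_eigenvector_def positive_iff)

lemma y1_in [simp]: "y1 \<in> box_space P 1 (opp s)" using N.pos_in[OF y1_pos] .

definition eta where "eta = bar P (opp s) y1"

lemma bar_opp_closed [simp]: "z \<in> box_space P 1 (opp s) \<Longrightarrow> bar P (opp s) z \<in> M"
  using bar_closed[of z "opp s"] by simp

lemma bar_opp_mult: "a \<in> box_space P 1 (opp s) \<Longrightarrow> b \<in> box_space P 1 (opp s) \<Longrightarrow>
    bar P (opp s) (pa_mult P 1 (opp s) a b) = bar P (opp s) b \<cdot> bar P (opp s) a"
  using bar_mult[of a "opp s" b] by simp

lemma eta_in [simp]: "eta \<in> M" by (simp add: eta_def)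

text \<open>The rotation reverses products, so the adjoint factor comes out on the right.\<close>

lemma eta_factor: obtains d where "d \<in> M" "eta = d \<cdot> adj P d"
proof -
  obtain k where k: "k \<in> box_space P 1 (opp s)" "y1 = pa_mult P 1 (opp s) (adj P k) k"
    using y1_pos by (auto simp: N.pos_def)
  have "eta = bar P (opp s) k \<cdot> adj P (bar P (opp s) k)"
    using k(1) adj_bar[of k "opp s"] bar_opp_mult[of "adj P k" k] by (simp add: eta_def k(2)[symmetric])
  then show thesis using that[of "bar P (opp s) k"] k by simp
qed

lemma eta_invariant:
  assumes "v \<in> M" shows "tr 1 s (Phi v \<cdot> eta) = of_real r * tr 1 s (v \<cdot> eta)"
proof -
  have "tr 1 s (Phi v \<cdot> eta) = tr 0 s (pa_closure P 1 s (Phi v \<cdot> eta))"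
    by (rule tr_closure) (use assms in simp)
  also have "pa_closure P 1 s (Phi v \<cdot> eta) =
      pa_closure P 1 s (v \<cdot> bar P (opp s) (conv_right P (opp s) xh y1))"
    unfolding eta_def by (rule closure_conv_left) (use assms in auto)
  also have "bar P (opp s) (conv_right P (opp s) xh y1) = cscale P (of_real r) eta"
    using bar_linear(2)[of y1 "opp s" y1 "of_real r"] by (simp add: Psi_y1 eta_def M.scl_real)
  also have "tr 0 s (pa_closure P 1 s (v \<cdot> cscale P (of_real r) eta)) = tr 1 s (v \<cdot> cscale P (of_real r) eta)"
    by (rule tr_closure[symmetric]) (use assms in simp)
  also have "\<dots> = of_real r * tr 1 s (v \<cdot> eta)" using assms by (simp add: M.tr_scl)
  finally show ?thesis .
qed

text \<open>A zero trace forces \<open>k \<cdot> d = 0\<close>, so the support \<open>?f\<close> of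
  \<open>v\<close> annihilates \<open>eta\<close>. The condition on the meet speaks of the rotated
  range projection of \<open>y1\<close>, not of the range of \<open>eta\<close>;
  \<open>one - ?f\<close> is therefore compared with the range of \<open>y1\<close> in the other
  shading, and the result is rotated back.\<close>

lemma eta_faithful:
  assumes v: "M.pos v" "p \<cdot> v = v" and tr0: "tr 1 s (v \<cdot> eta) = 0"
  shows "v = 0"
proof -
  obtain d where d: "d \<in> M" "eta = d \<cdot> adj P d" using eta_factor by blast
  obtain k where k: "k \<in> M" "v = adj P k \<cdot> k" using v(1) by (auto simp: M.pos_def)
  have "tr 1 s (v \<cdot> eta) = tr 1 s (adj P (k \<cdot> d) \<cdot> (k \<cdot> d))"
  proof -
    have "tr 1 s ((v \<cdot> d) \<cdot> adj P d) = tr 1 s (adj P d \<cdot> (v \<cdot> d))"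
      by (rule M.tr_mul) (use d(1) v in auto)
    then show ?thesis using d k by (simp add: M.mul_assoc M.star_mul)
  qed
  then have "k \<cdot> d = 0" using M.tr_faithful[of "k \<cdot> d"] tr0 k(1) d(1) by simp
  then have veta: "v \<cdot> eta = 0" using k d by (simp add: M.mul_assoc) (metis M.mul_assoc M.mul_zero M.star_in M.zero_mul)
  have vM: "v \<in> M" "adj P v = v" using v M.pos_sa by auto
  let ?f = "M.rng v" and ?q = "N.rng y1"
  have f: "M.proj ?f" "?f \<cdot> eta = 0" "?f \<cdot> v = v" "p \<cdot> ?f = ?f"
  proof -
    obtain w where w: "w \<in> M" "w \<cdot> v = ?f" "M.proj ?f" "?f \<cdot> v = v"
      "\<And>q. M.proj q \<Longrightarrow> q \<cdot> v = v \<Longrightarrow> q \<cdot> ?f = ?f"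
      using M.support[OF vM] by metis
    show "M.proj ?f" "?f \<cdot> v = v" "p \<cdot> ?f = ?f" using w v(2) p_proj by auto
    have "?f \<cdot> eta = w \<cdot> (v \<cdot> eta)" using w(1) vM by (simp add: M.mul_assoc flip: w(2))
    then show "?f \<cdot> eta = 0" using veta w by simp
  qed
  \<comment> \<open>the projection \<open>1 - f\<close>, moved to the other shading, contains the range of \<open>y1\<close>\<close>
  let ?g = "bar P s (one - ?f)"
  have fM [simp]: "?f \<in> M" "adj P ?f = ?f" "?f \<cdot> ?f = ?f" using f(1) by (auto simp: M.proj_def)
  have g: "?g \<in> box_space P 1 (opp s)" by (rule bar_closed) simp
  have bg: "bar P (opp s) ?g = one - ?f" using bar_bar[of "one - ?f" s] by simp
  have gproj: "N.proj ?g"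
    unfolding N.proj_def using g adj_bar[of "one - ?f" s] bar_mult[of "one - ?f" s "one - ?f"]
    by (simp add: M.star_diff M.mul_diff M.diff_mul)
  have "bar P s eta = y1" using bar_bar[of y1 "opp s"] by (simp add: eta_def)
  moreover have "eta \<cdot> (one - ?f) = eta"
  proof -
    have "adj P (?f \<cdot> eta) = eta \<cdot> ?f" using d by (simp add: M.star_mul)
    then show ?thesis using f(2) by (simp add: M.mul_diff)
  qed
  ultimately have gy: "pa_mult P 1 (opp s) ?g y1 = y1"
    using bar_mult[of eta s "one - ?f"] by simp
  obtain "N.proj ?q" "pa_mult P 1 (opp s) ?g ?q = ?q"
    using N.support[OF y1_in N.pos_sa[OF y1_pos]] gproj gy by metis
  then have q: "?q \<in> box_space P 1 (opp s)" "adj P ?q = ?q" "pa_mult P 1 (opp s) ?q ?q = ?q"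
      "pa_mult P 1 (opp s) ?g ?q = ?q" by (auto simp: N.proj_def)
  let ?qb = "bar P (opp s) ?q"
  have qb: "?qb \<in> M" "adj P ?qb = ?qb" "?qb \<cdot> ?qb = ?qb" "?qb \<cdot> (one - ?f) = ?qb"
    using q bar_opp_mult[of ?q ?q] bar_opp_mult[of ?g ?q] adj_bar[of ?q "opp s"] g bg by auto
  then have "?qb \<cdot> ?f = 0" by (simp add: M.mul_diff)
  then have le: "(one - ?qb) \<cdot> ?f = ?f" using qb by (simp add: M.diff_mul)
  have "M.proj ?qb" using qb by (simp add: M.proj_def)
  then have pq: "M.proj (one - ?qb)" by (rule M.proj_compl)
  have "?f = 0"
    using meet unfolding proj_meet_def perp_def range_proj_eq projection_iff below_def positive_iff
    by (rule M.meet_eq_0D[OF p_proj pq _ f(1) f(4) le])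
  then show "v = 0" using f(3) vM by simp
qed

lemma E_factor:
  assumes y: "y \<in> E"
  shows "\<exists>a\<in>PF_algebra_A P s x. y = a \<cdot> zeta \<and> y = zeta \<cdot> adj P a"
proof -
  have yM [simp]: "y \<in> M" "adj P y = y" and Py: "Phi y = r *\<^sub>R y" and y_pos: "M.pos y"
    using y by (auto simp: E_iff M.pos_sa)
  have py [simp]: "p \<cdot> y = y" "y \<cdot> p = y" using E_corner[OF y] corner_sym[of y] by auto
  obtain w where w [simp]: "w \<in> M" "adj P w = w" "zeta \<cdot> w = p" "w \<cdot> zeta = p" "p \<cdot> w = w" "w \<cdot> p = w"
    using M.support[OF zeta_props(1,2)] unfolding rng_zeta by metis
  define a where "a = y \<cdot> w"
  have a [simp]: "a \<in> M" "a \<cdot> zeta = y" "zeta \<cdot> adj P a = y" "a \<cdot> p = a" "p \<cdot> a = a"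
  proof -
    show "a \<in> M" "a \<cdot> zeta = y" "a \<cdot> p = a"
      by (auto simp: a_def M.star_mul M.mul_assoc)
    show "zeta \<cdot> adj P a = y" using M.mul_assoc[of zeta w y] by (simp add: a_def M.star_mul)
    show "p \<cdot> a = a" using M.mul_assoc[of p y w] by (simp add: a_def)
  qed
  have aa [simp]: "adj P a \<in> M" by simp
  obtain k where k [simp]: "k \<in> B" and xk: "xh = adj P k \<odot> k" using xh_pos by (auto simp: B.pos_def)
  \<comment> \<open>The cut by \<open>Q\<close> sits on the left of the factor, so that
    \<open>L p\<close> fixes \<open>c\<close> and, later, \<open>D\<close>.\<close>
  define c where "c = Q \<odot> adj P k"
  have c [simp]: "c \<in> B" by (simp add: c_def)
  have cc: "c \<odot> adj P c = xhp" by (simp add: c_def xhp_eq xk B.star_mul B.mul_assoc)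
  have LQ: "L p \<odot> Q = Q" using B.mul_assoc[of "L p" "L p" "R p"] by (simp add: Q_def L_mult)
  have Lc: "L p \<odot> c = c" using B.mul_assoc[of "L p" Q "adj P k"] by (simp add: c_def LQ)
  \<comment> \<open>the defect of \<open>a\<close> to lie in the algebra\<close>
  define D where "D = L a \<odot> c - R a \<odot> c"
  have D [simp]: "D \<in> B" by (simp add: D_def)
  have aD: "adj P D = adj P c \<odot> L (adj P a) - adj P c \<odot> R (adj P a)"
    unfolding D_def by (simp add: B.star_diff B.star_mul adj_L adj_R)
  let ?X = "D \<odot> adj P D"
  have cX: "u \<odot> (c \<odot> (adj P c \<odot> t)) = u \<odot> (xhp \<odot> t)" if "u \<in> B" "t \<in> B" for u t
    using that B.mul_assoc[of c "adj P c" t] by (simp add: cc)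
  have X: "?X = L a \<odot> (xhp \<odot> L (adj P a)) - L a \<odot> (xhp \<odot> R (adj P a))
      - (R a \<odot> (xhp \<odot> L (adj P a)) - R a \<odot> (xhp \<odot> R (adj P a)))"
    unfolding aD unfolding D_def by (simp add: B.mul_diff B.diff_mul B.mul_assoc cX)
  let ?k = "y \<cdot> adj P a"
  \<comment> \<open>Both products equal \<open>a \<cdot> zeta \<cdot> adj P a\<close>. This lets the
    mixed terms below coincide and makes \<open>?k\<close> positive.\<close>
  have k_eq: "a \<cdot> y = ?k"
    using M.mul_assoc[of a zeta "adj P a"] by simp
  have k_pos: "M.pos ?k"
    using M.pos_conj[OF zeta_pos, of "adj P a"] by simp
  have pk: "p \<cdot> ?k = ?k" using M.mul_assoc[of p y "adj P a"] by simp
  have y_xhp: "y \<star> xhp = r *\<^sub>R y" using conv_xhp_corner[OF y_pos] Py by simp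
  have z_xhp: "zeta \<star> xhp = r *\<^sub>R zeta" using conv_xhp_corner[OF zeta_pos] Phi_zeta by simp
  have "zeta \<star> ?X = ?k \<star> xhp - r *\<^sub>R ?k"
  proof -
    have 1: "zeta \<star> (L a \<odot> (xhp \<odot> L (adj P a))) = ?k \<star> xhp"
      by (simp add: conv_L)
    have 2: "zeta \<star> (L a \<odot> (xhp \<odot> R (adj P a))) = r *\<^sub>R ?k"
      by (simp add: conv_L conv_R y_xhp)
    have 3: "zeta \<star> (R a \<odot> (xhp \<odot> L (adj P a))) = r *\<^sub>R ?k"
      by (simp add: conv_L conv_R y_xhp k_eq)
    have 4: "zeta \<star> (R a \<odot> (xhp \<odot> R (adj P a))) = r *\<^sub>R ?k"
      by (simp add: conv_R z_xhp k_eq)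
    show ?thesis unfolding X by (simp add: conv_simps2 1 2 3 4)
  qed
  then have zX: "zeta \<star> ?X = Phi ?k - r *\<^sub>R ?k" using conv_xhp_corner[OF k_pos pk] by simp
  have X_pos: "B.pos ?X" unfolding B.pos_def by (rule bexI[of _ "adj P D"]) auto
  have "zeta \<star> ?X = 0"
  proof (rule eta_faithful)
    show "M.pos (zeta \<star> ?X)" by (rule conv_pos[OF zeta_pos X_pos])
    show "p \<cdot> (zeta \<star> ?X) = zeta \<star> ?X"
      unfolding zX using Phi_corner[OF k_pos pk] pk k_pos by (simp add: M.mul_diff)
    have "tr 1 s ((zeta \<star> ?X) \<cdot> eta) = tr 1 s (Phi ?k \<cdot> eta) - tr 1 s (r *\<^sub>R ?k \<cdot> eta)"
      unfolding zX using k_pos by (subst M.diff_mul) (auto simp: M.tr_diff)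
    then show "tr 1 s ((zeta \<star> ?X) \<cdot> eta) = 0"
      using eta_invariant[of ?k] by (simp add: M.tr_scaleR scaleR_conv_of_real)
  qed
  obtain m where m: "M.pos (m *\<^sub>R zeta - p)" using zeta(2) by blast
  have pp: "M.pos (p \<star> ?X)" by (rule conv_pos[OF M.proj_pos[OF p_proj] X_pos])
  have "M.pos ((m *\<^sub>R zeta - p) \<star> ?X)" by (rule conv_pos[OF m X_pos])
  also have "(m *\<^sub>R zeta - p) \<star> ?X = m *\<^sub>R (zeta \<star> ?X) - p \<star> ?X"
    using conv_simps1(4)[of zeta zeta ?X m] by (simp add: conv_simps1)
  also have "\<dots> = - (p \<star> ?X)" using \<open>zeta \<star> ?X = 0\<close> by simp
  finally have pX: "p \<star> ?X = 0" using M.pos_antisym[OF pp] by blast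
  \<comment> \<open>The \<open>p\<close> on the left leg of \<open>D\<close> can slide into
    \<open>one\<close>, which turns the vanishing at \<open>p\<close> into vanishing at
    \<open>one\<close>.\<close>
  have "L p \<odot> D = D"
  proof -
    have "L p \<odot> (L a \<odot> c) = L a \<odot> c" using B.mul_assoc[of "L p" "L a" c] by (simp add: L_mult)
    moreover have "L p \<odot> (R a \<odot> c) = R a \<odot> c"
      using B.mul_assoc[of "L p" "R a" c] B.mul_assoc[of "R a" "L p" c] Lc by (simp add: LR_commute)
    ultimately show ?thesis by (simp add: D_def B.mul_diff)
  qed
  then have "one \<star> ?X = one \<star> (L p \<odot> ?X)" using B.mul_assoc[of "L p" D "adj P D"] by simp
  also have "\<dots> = 0" using pX by (simp add: conv_L)
  finally have "D = 0" by (rule conv_one_eq_0D[OF D])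
  then have "L a \<odot> c \<odot> adj P c = R a \<odot> c \<odot> adj P c" by (simp add: D_def)
  then have "R a \<odot> xhp = L a \<odot> xhp" by (simp add: B.mul_assoc cc)
  then have "a \<in> PF_algebra_A P s x" by (simp add: A_iff)
  then show ?thesis using a by (intro bexI[of _ a]) auto
qed

lemma PF_cone:
  "pos_part P 1 s (PF_space P s x) =
     pos_part P 1 s ((\<lambda>a. pa_mult P 1 s a zeta) ` PF_algebra_A P s x)"
  "pos_part P 1 s (PF_space P s x) =
     pos_part P 1 s ((\<lambda>b. pa_mult P 1 s zeta b) ` PF_algebra_B P s x)"
proof -
  show "pos_part P 1 s (PF_space P s x) =
     pos_part P 1 s ((\<lambda>a. pa_mult P 1 s a zeta) ` PF_algebra_A P s x)"
    unfolding E_def[symmetric]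
  proof (intro equalityI subsetI)
    fix y assume "y \<in> E"
    then show "y \<in> pos_part P 1 s ((\<lambda>a. a \<cdot> zeta) ` PF_algebra_A P s x)"
      using E_factor[of y] E_iff by (auto simp: pos_part_def positive_iff)
  next
    fix y assume "y \<in> pos_part P 1 s ((\<lambda>a. a \<cdot> zeta) ` PF_algebra_A P s x)"
    then show "y \<in> E" using A_zeta_pos by (auto simp: pos_part_def positive_iff)
  qed
  show "pos_part P 1 s (PF_space P s x) =
     pos_part P 1 s ((\<lambda>b. pa_mult P 1 s zeta b) ` PF_algebra_B P s x)"
    unfolding E_def[symmetric]
  proof (intro equalityI subsetI)
    fix y assume y: "y \<in> E"
    then obtain a where a: "a \<in> PF_algebra_A P s x" "y = zeta \<cdot> adj P a" using E_factor by blast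
    then have "adj P a \<in> PF_algebra_B P s x" using B_adj[of "adj P a"] A_iff by simp
    then show "y \<in> pos_part P 1 s ((\<lambda>b. zeta \<cdot> b) ` PF_algebra_B P s x)"
      using y a E_iff by (auto simp: pos_part_def positive_iff)
  next
    fix y assume "y \<in> pos_part P 1 s ((\<lambda>b. zeta \<cdot> b) ` PF_algebra_B P s x)"
    then obtain b where b: "b \<in> PF_algebra_B P s x" "y = zeta \<cdot> b" and pos: "M.pos y"
      by (auto simp: pos_part_def positive_iff)
    have bM: "b \<in> M" using b B_iff by blast
    then have "adj P b \<in> PF_algebra_A P s x" using b B_adj by blast
    \<comment> \<open>Taking adjoints of the self-adjoint \<open>y\<close> moves the factor to the
      other side of \<open>zeta\<close>.\<close>
    moreover have "y = adj P b \<cdot> zeta" using M.pos_sa[OF pos] b(2) bM by (simp add: M.star_mul)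
    ultimately show "y \<in> E" using A_zeta_pos pos by blast
  qed
qed

end

theorem theorem5p15:
  fixes P :: "'a::real_normed_vector star_planar_algebra"
    and s :: shade
    and x y1 :: 'a
  assumes "cstar_planar_algebra P"
    and "x \<in> box_space P 2 s"
    and "F_positive P s x"
    and "right_PF_eigenvector P s x y1"
    and "proj_meet P 1 s (p_max P s x)
           (perp P 1 s (bar P (opp s) (range_proj P 1 (opp s) y1))) = 0"
  shows "pos_part P 1 s (PF_space P s x) =
           pos_part P 1 s ((\<lambda>a. pa_mult P 1 s a (PF_zeta P s x)) ` PF_algebra_A P s x)
       \<and> pos_part P 1 s (PF_space P s x) =
           pos_part P 1 s ((\<lambda>b. pa_mult P 1 s (PF_zeta P s x) b) ` PF_algebra_B P s x)"
proof -
  interpret PF_right P s x y1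
    by (intro PF_right.intro PF.intro planar_legs.intro cplanar.intro PF_axioms.intro
        PF_right_axioms.intro assms)
  show ?thesis using PF_cone by blast
qed

end
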